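(* Let $P,Q\in L^2([0,\pi])$ be complex-valued, let $bc\in\{Per^+,Per^-,Dir\}$, and let $L_{bc}$ be the Dirac operator with potential matrix $v=\begin{pmatrix} 0 & P \\ Q & 0 \end{pmatrix}$ subject to the boundary conditions $bc$. Then there is $N\in\mathbb{N}$ such that the Riesz projections $$S_N=\frac{1}{2\pi i}\int_{|z|=N+1/2}(z-L_{bc})^{-1}\,dz,\qquad P_n=\frac{1}{2\pi i}\int_{|z-n|=1/4}(z-L_{bc})^{-1}\,dz\quad(n\in\Gamma_{bc},\ |n|>N)$$ are well defined (the contours lie in the resolvent set of $L_{bc}$), and $$f=S_Nf+\sum_{n\in\Gamma_{bc},\ |n|>N}P_nf\qquad\text{for all } f\in L^2([0,\pi])^2;$$ moreover, this series converges unconditionally in $L^2([0,\pi])^2$.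
   Context: For $P,Q\in L^2([0,\pi])$ put $v(x)=\begin{pmatrix} 0 & P(x) \\ Q(x) & 0 \end{pmatrix}$ and consider the differential expression $$Ly=i\begin{pmatrix} 1 & 0 \\ 0 & -1 \end{pmatrix}\frac{dy}{dx}+v(x)y,\qquad y=\begin{pmatrix} y_1 \\ y_2 \end{pmatrix},\quad x\in[0,\pi],$$ in the Hilbert space $L^2([0,\pi])^2$ with scalar product $\langle F,G\rangle=\frac1\pi\int_0^\pi(f_1\overline{g_1}+f_2\overline{g_2})\,dx$. Boundary conditions: $Per^+$: $y(0)=y(\pi)$; $Per^-$: $y(0)=-y(\pi)$; $Dir$: $y_1(0)=y_2(0)$ and $y_1(\pi)=y_2(\pi)$. The closed operator $L_{bc}$ acts as $L$ on the domain of all $f=(f_1,f_2)$ whose components are absolutely continuous with derivative in $L^2([0,\pi])$ and which satisfy $bc$. Index sets: $\Gamma_{Per^+}=2\mathbb{Z}$, $\Gamma_{Per^-}=1+2\mathbb{Z}$, $\Gamma_{Dir}=\mathbb{Z}$ (the spectrum of the operator with $v=0$). Contours are positively oriented. *)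

theory Defs
  imports "HOL-Complex_Analysis.Complex_Analysis"
begin

text \<open>The real normed structure is that of the library; the class only adds the multiplication by
  complex scalars, so that products and \<open>blinfun\<close> can be used as complex normed spaces.\<close>

class complex_normed_vector = real_normed_vector +
  fixes scaleC :: "complex \<Rightarrow> 'a \<Rightarrow> 'a"  (infixr \<open>*\<^sub>C\<close> 75)
  assumes scaleC_add_right: "a *\<^sub>C (x + y) = a *\<^sub>C x + a *\<^sub>C y"
    and scaleC_add_left: "(a + b) *\<^sub>C x = a *\<^sub>C x + b *\<^sub>C x"
    and scaleC_scaleC: "a *\<^sub>C b *\<^sub>C x = (a * b) *\<^sub>C x"
    and scaleC_of_real: "of_real r *\<^sub>C x = r *\<^sub>R x"
    and norm_scaleC: "norm (a *\<^sub>C x) = cmod a * norm x"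

lemma bounded_linear_scaleC: "bounded_linear (\<lambda>x::'a::complex_normed_vector. a *\<^sub>C x)"
proof (rule bounded_linear_intro)
  show "a *\<^sub>C (r *\<^sub>R x) = r *\<^sub>R (a *\<^sub>C x)" for r and x :: 'a
    by (metis mult.commute scaleC_of_real scaleC_scaleC)
  show "norm (a *\<^sub>C x) \<le> norm x * cmod a" for x :: 'a
    by (simp add: norm_scaleC)
qed (rule scaleC_add_right)

instantiation prod :: (complex_normed_vector, complex_normed_vector) complex_normed_vector
begin

definition scaleC_prod_def: "a *\<^sub>C u = (a *\<^sub>C fst u, a *\<^sub>C snd u)"

instance
proof
  show "norm (a *\<^sub>C x) = cmod a * norm x" for a and x :: "'a \<times> 'b"
    by (simp add: scaleC_prod_def norm_prod_def norm_scaleC power_mult_distrib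
        flip: distrib_left) (simp add: real_sqrt_mult)
qed (simp_all add: scaleC_prod_def prod_eq_iff scaleC_add_right scaleC_add_left scaleC_scaleC
       scaleC_of_real)

end

instantiation blinfun :: (real_normed_vector, complex_normed_vector) complex_normed_vector
begin

lift_definition scaleC_blinfun :: "complex \<Rightarrow> 'a \<Rightarrow>\<^sub>L 'b \<Rightarrow> 'a \<Rightarrow>\<^sub>L 'b"
  is "\<lambda>a T x. a *\<^sub>C T x"
  by (rule bounded_linear_compose[OF bounded_linear_scaleC])

instance
proof
  fix a :: complex and T :: "'a \<Rightarrow>\<^sub>L 'b"
  have le: "norm (a *\<^sub>C T) \<le> cmod a * norm T" for a and T :: "'a \<Rightarrow>\<^sub>L 'b"
    by (rule norm_blinfun_bound)
      (simp_all add: scaleC_blinfun.rep_eq norm_scaleC mult.assoc mult_left_mono norm_blinfun)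
  show "norm (a *\<^sub>C T) = cmod a * norm T"
  proof (cases "a = 0")
    case True
    then show ?thesis using le[of a T] by simp
  next
    case False
    have "inverse a *\<^sub>C a *\<^sub>C T = T"
      using False scaleC_of_real[of 1]
      by (intro blinfun_eqI) (simp add: scaleC_blinfun.rep_eq scaleC_scaleC)
    then have "norm T \<le> inverse (cmod a) * norm (a *\<^sub>C T)"
      using le[of "inverse a" "a *\<^sub>C T"] by (simp add: norm_inverse)
    then have "cmod a * norm T \<le> norm (a *\<^sub>C T)"
      using False by (simp add: field_simps)
    with le[of a T] show ?thesis by simp
  qed
qed (transfer, simp add: scaleC_add_right scaleC_add_left scaleC_scaleC scaleC_of_real)+

end

text \<open>An unbounded operator is a function \<open>T\<close> together with its domain \<open>D\<close>; the values of \<open>T\<close>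
  outside \<open>D\<close> are irrelevant.\<close>

definition resolvent_map ::
    "'a::complex_normed_vector set \<Rightarrow> ('a \<Rightarrow> 'a) \<Rightarrow> complex \<Rightarrow> 'a \<Rightarrow> 'a" where
  "resolvent_map D T z = inv_into D (\<lambda>u. z *\<^sub>C u - T u)"

definition resolvent_set :: "'a::complex_normed_vector set \<Rightarrow> ('a \<Rightarrow> 'a) \<Rightarrow> complex set" where
  "resolvent_set D T =
     {z. bij_betw (\<lambda>u. z *\<^sub>C u - T u) D UNIV \<and> bounded_linear (resolvent_map D T z)}"

definition resolvent ::
    "'a::complex_normed_vector set \<Rightarrow> ('a \<Rightarrow> 'a) \<Rightarrow> complex \<Rightarrow> 'a \<Rightarrow>\<^sub>L 'a" where
  "resolvent D T z = Blinfun (resolvent_map D T z)"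

text \<open>The library's \<open>contour_integral\<close> only covers complex-valued integrands.\<close>

definition vector_contour_integral ::
    "(real \<Rightarrow> complex) \<Rightarrow> (complex \<Rightarrow> 'a::complex_normed_vector) \<Rightarrow> 'a" where
  "vector_contour_integral \<gamma> F =
     integral {0..1} (\<lambda>t. vector_derivative \<gamma> (at t within {0..1}) *\<^sub>C F (\<gamma> t))"

definition riesz_projection ::
    "'a::complex_normed_vector set \<Rightarrow> ('a \<Rightarrow> 'a) \<Rightarrow> (real \<Rightarrow> complex) \<Rightarrow> 'a \<Rightarrow>\<^sub>L 'a" where
  "riesz_projection D T \<gamma> =
     (1 / (2 * of_real pi * \<i>)) *\<^sub>C vector_contour_integral \<gamma> (resolvent D T)"

abbreviation leb_pi :: "real measure" where
  "leb_pi \<equiv> lebesgue_on {0..pi}"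

definition L2_fun :: "(real \<Rightarrow> complex) set" where
  "L2_fun = {f. f \<in> borel_measurable leb_pi \<and> integrable leb_pi (\<lambda>x. (cmod (f x))\<^sup>2)}"

lemma L2_fun_measurable: "f \<in> L2_fun \<Longrightarrow> f \<in> borel_measurable leb_pi"
  by (simp add: L2_fun_def)

lemma L2_fun_zero: "(\<lambda>x. 0) \<in> L2_fun"
  by (simp add: L2_fun_def)

lemma L2_fun_add:
  assumes "f \<in> L2_fun" "g \<in> L2_fun"
  shows "(\<lambda>x. f x + g x) \<in> L2_fun"
proof -
  have [measurable]: "f \<in> borel_measurable leb_pi" "g \<in> borel_measurable leb_pi"
    using assms by (auto simp: L2_fun_def)
  have bound: "(cmod (a + b))\<^sup>2 \<le> 2 * (cmod a)\<^sup>2 + 2 * (cmod b)\<^sup>2" for a b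
  proof -
    have "(cmod (a + b))\<^sup>2 \<le> (cmod a + cmod b)\<^sup>2"
      by (simp add: norm_triangle_ineq power_mono)
    also have "\<dots> \<le> 2 * (cmod a)\<^sup>2 + 2 * (cmod b)\<^sup>2"
      using sum_squares_bound[of "cmod a" "cmod b"] by (simp add: power2_sum)
    finally show ?thesis .
  qed
  have "integrable leb_pi (\<lambda>x. (cmod (f x + g x))\<^sup>2)"
  proof (rule Bochner_Integration.integrable_bound)
    show "integrable leb_pi (\<lambda>x. 2 * (cmod (f x))\<^sup>2 + 2 * (cmod (g x))\<^sup>2)"
      using assms by (auto simp: L2_fun_def)
  qed (use bound in auto)
  then show ?thesis by (simp add: L2_fun_def)
qed

lemma L2_fun_scale:
  assumes "f \<in> L2_fun"
  shows "(\<lambda>x. c * f x) \<in> L2_fun"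
  using assms by (auto simp: L2_fun_def norm_mult power_mult_distrib)

lemma L2_fun_uminus: "f \<in> L2_fun \<Longrightarrow> (\<lambda>x. - f x) \<in> L2_fun"
  using L2_fun_scale[of f "-1"] by simp

lemma L2_fun_diff: "f \<in> L2_fun \<Longrightarrow> g \<in> L2_fun \<Longrightarrow> (\<lambda>x. f x - g x) \<in> L2_fun"
  using L2_fun_add[OF _ L2_fun_uminus, of f g] by simp

lemma L2_fun_cinner_integrable:
  assumes "f \<in> L2_fun" "g \<in> L2_fun"
  shows "integrable leb_pi (\<lambda>x. f x * cnj (g x))"
proof (rule Bochner_Integration.integrable_bound)
  show "integrable leb_pi (\<lambda>x. (cmod (f x))\<^sup>2 + (cmod (g x))\<^sup>2)"
    using assms by (auto simp: L2_fun_def)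
  have [measurable]: "f \<in> borel_measurable leb_pi" "g \<in> borel_measurable leb_pi"
    using assms by (auto simp: L2_fun_def)
  have "cnj \<in> borel_measurable borel"
    by (intro borel_measurable_continuous_onI continuous_intros)
  then show "(\<lambda>x. f x * cnj (g x)) \<in> borel_measurable leb_pi"
    by measurable
  have "cmod a * cmod b \<le> (cmod a)\<^sup>2 + (cmod b)\<^sup>2" for a b
  proof -
    have "2 * (cmod a * cmod b) \<le> (cmod a)\<^sup>2 + (cmod b)\<^sup>2"
      using sum_squares_bound[of "cmod a" "cmod b"] by (simp add: mult.assoc)
    moreover have "0 \<le> cmod a * cmod b" by simp
    ultimately show ?thesis by linarith
  qed
  then show "AE x in leb_pi. norm (f x * cnj (g x)) \<le> norm ((cmod (f x))\<^sup>2 + (cmod (g x))\<^sup>2)"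
    by (simp add: norm_mult)
qed

definition l2_rel :: "(real \<Rightarrow> complex) \<Rightarrow> (real \<Rightarrow> complex) \<Rightarrow> bool" where
  "l2_rel f g \<longleftrightarrow> f \<in> L2_fun \<and> g \<in> L2_fun \<and> (AE x in leb_pi. f x = g x)"

quotient_type l2 = "real \<Rightarrow> complex" / partial: l2_rel
proof (rule part_equivpI)
  show "\<exists>f. l2_rel f f"
    by (rule exI[of _ "\<lambda>x. 0"]) (simp add: l2_rel_def L2_fun_zero)
  show "symp l2_rel"
    by (auto simp: symp_def l2_rel_def)
  show "transp l2_rel"
    by (rule transpI) (auto simp: l2_rel_def)
qed

instantiation l2 :: real_inner
begin

lift_definition zero_l2 :: l2 is "\<lambda>x. 0"
  by (simp add: l2_rel_def L2_fun_zero)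

lift_definition plus_l2 :: "l2 \<Rightarrow> l2 \<Rightarrow> l2" is "\<lambda>f g x. f x + g x"
  by (auto simp: l2_rel_def L2_fun_add)

lift_definition minus_l2 :: "l2 \<Rightarrow> l2 \<Rightarrow> l2" is "\<lambda>f g x. f x - g x"
  by (auto simp: l2_rel_def L2_fun_diff)

lift_definition uminus_l2 :: "l2 \<Rightarrow> l2" is "\<lambda>f x. - f x"
  by (auto simp: l2_rel_def L2_fun_uminus)

lift_definition scaleR_l2 :: "real \<Rightarrow> l2 \<Rightarrow> l2" is "\<lambda>r f x. of_real r * f x"
  by (auto simp: l2_rel_def L2_fun_scale)

text \<open>The real part of the Hermitian scalar product; both induce the same norm. On the product
  type \<open>l2 \<times> l2\<close> the library adds the scalar products of the two components.\<close>

lift_definition inner_l2 :: "l2 \<Rightarrow> l2 \<Rightarrow> real"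
  is "\<lambda>f g. Re ((1 / of_real pi) * (LINT x|leb_pi. f x * cnj (g x)))"
proof -
  fix f f' g g' assume *: "l2_rel f f'" "l2_rel g g'"
  have "(LINT x|leb_pi. f x * cnj (g x)) = (LINT x|leb_pi. f' x * cnj (g' x))"
    by (rule integral_cong_AE)
      (use * in \<open>auto simp: l2_rel_def intro!: borel_measurable_integrable L2_fun_cinner_integrable\<close>)
  then show "Re ((1 / of_real pi) * (LINT x|leb_pi. f x * cnj (g x))) =
             Re ((1 / of_real pi) * (LINT x|leb_pi. f' x * cnj (g' x)))"
    by simp
qed

definition norm_l2 :: "l2 \<Rightarrow> real" where "norm_l2 u = sqrt (inner u u)"
definition dist_l2 :: "l2 \<Rightarrow> l2 \<Rightarrow> real" where "dist_l2 u v = norm (u - v)"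
definition sgn_l2 :: "l2 \<Rightarrow> l2" where "sgn_l2 u = inverse (norm u) *\<^sub>R u"
definition uniformity_l2 :: "(l2 \<times> l2) filter"
  where "uniformity_l2 = (INF e\<in>{0<..}. principal {(x, y). dist x y < e})"
definition open_l2 :: "l2 set \<Rightarrow> bool"
  where "open_l2 U \<longleftrightarrow> (\<forall>x\<in>U. \<forall>\<^sub>F (x', y) in uniformity. x' = x \<longrightarrow> y \<in> U)"

instance
proof
  fix u v w :: l2 and r s :: real
  show "u + v + w = u + (v + w)" by transfer (auto simp: l2_rel_def L2_fun_add add.assoc)
  show "u + v = v + u" by transfer (auto simp: l2_rel_def L2_fun_add add.commute)
  show "0 + u = u" by transfer (auto simp: l2_rel_def)
  show "- u + u = 0" by transfer (auto simp: l2_rel_def L2_fun_zero)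
  show "u - v = u + - v" by transfer (auto simp: l2_rel_def L2_fun_diff)
  show "r *\<^sub>R (u + v) = r *\<^sub>R u + r *\<^sub>R v"
    by transfer (auto simp: l2_rel_def L2_fun_add L2_fun_scale distrib_left)
  show "(r + s) *\<^sub>R u = r *\<^sub>R u + s *\<^sub>R u"
    by transfer (simp add: l2_rel_def L2_fun_add L2_fun_scale distrib_right)
  show "r *\<^sub>R s *\<^sub>R u = (r * s) *\<^sub>R u"
    by transfer (auto simp: l2_rel_def L2_fun_scale mult.assoc)
  show "1 *\<^sub>R u = u" by transfer (auto simp: l2_rel_def)
  show "inner u v = inner v u"
  proof transfer
    fix f g assume "l2_rel f f" "l2_rel g g"
    have "cnj (LINT x|leb_pi. f x * cnj (g x)) = (LINT x|leb_pi. cnj (f x * cnj (g x)))"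
      by (rule Bochner_Integration.integral_cnj[symmetric])
    also have "\<dots> = (LINT x|leb_pi. g x * cnj (f x))"
      by (simp add: mult.commute)
    finally have "(LINT x|leb_pi. g x * cnj (f x)) = cnj (LINT x|leb_pi. f x * cnj (g x))" ..
    then show "Re ((1 / of_real pi) * (LINT x|leb_pi. f x * cnj (g x))) =
               Re ((1 / of_real pi) * (LINT x|leb_pi. g x * cnj (f x)))"
      by simp
  qed
  show "inner (u + v) w = inner u w + inner v w"
    by transfer (simp add: l2_rel_def L2_fun_cinner_integrable distrib_right add_divide_distrib)
  show "inner (r *\<^sub>R u) v = r * inner u v"
    by transfer (simp add: mult.assoc)
  have sq: "Re ((1 / of_real pi) * (LINT x|leb_pi. f x * cnj (f x))) =
            (LINT x|leb_pi. (cmod (f x))\<^sup>2) / pi" for f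
    by (simp add: complex_norm_square[symmetric] integral_complex_of_real flip: of_real_power)
  show "0 \<le> inner u u"
    by transfer (unfold sq, simp)
  show "inner u u = 0 \<longleftrightarrow> u = 0"
  proof transfer
    fix f assume f: "l2_rel f f"
    have "(LINT x|leb_pi. (cmod (f x))\<^sup>2) = 0 \<longleftrightarrow> (AE x in leb_pi. (cmod (f x))\<^sup>2 = 0)"
      by (rule integral_nonneg_eq_0_iff_AE) (use f in \<open>auto simp: l2_rel_def L2_fun_def\<close>)
    then show "Re ((1 / of_real pi) * (LINT x|leb_pi. f x * cnj (f x))) = 0 \<longleftrightarrow>
               l2_rel f (\<lambda>x. 0)"
      unfolding sq using f by (auto simp: l2_rel_def L2_fun_zero)
  qed
qed (simp_all add: norm_l2_def dist_l2_def sgn_l2_def uniformity_l2_def open_l2_def)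

end

instantiation l2 :: complex_normed_vector
begin

lift_definition scaleC_l2 :: "complex \<Rightarrow> l2 \<Rightarrow> l2" is "\<lambda>a f x. a * f x"
  by (auto simp: l2_rel_def L2_fun_scale)

instance
proof
  fix a b :: complex and r :: real and u v :: l2
  show "a *\<^sub>C (u + v) = a *\<^sub>C u + a *\<^sub>C v"
    by transfer (auto simp: l2_rel_def L2_fun_add L2_fun_scale distrib_left)
  show "(a + b) *\<^sub>C u = a *\<^sub>C u + b *\<^sub>C u"
    by transfer (auto simp: l2_rel_def distrib_right intro!: L2_fun_add L2_fun_scale)
  show "a *\<^sub>C b *\<^sub>C u = (a * b) *\<^sub>C u"
    by transfer (auto simp: l2_rel_def L2_fun_scale mult.assoc)
  show "of_real r *\<^sub>C u = r *\<^sub>R u"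
    by transfer (auto simp: l2_rel_def L2_fun_scale)
  have "inner (a *\<^sub>C u) (a *\<^sub>C u) = (cmod a)\<^sup>2 * inner u u"
  proof transfer
    fix a :: complex and f :: "real \<Rightarrow> complex"
    have "a * f x * cnj (a * f x) = of_real ((cmod a)\<^sup>2) * (f x * cnj (f x))" for x
      using complex_norm_square[of a] by (simp add: mult_ac)
    then have "(LINT x|leb_pi. a * f x * cnj (a * f x)) =
        of_real ((cmod a)\<^sup>2) * (LINT x|leb_pi. f x * cnj (f x))"
      by (simp only: integral_mult_right_zero)
    then show "Re ((1 / of_real pi) * (LINT x|leb_pi. a * f x * cnj (a * f x))) =
        (cmod a)\<^sup>2 * Re ((1 / of_real pi) * (LINT x|leb_pi. f x * cnj (f x)))"
      by (simp only:) (simp del: of_real_power)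
  qed
  then show "norm (a *\<^sub>C u) = cmod a * norm u"
    by (simp add: norm_eq_sqrt_inner real_sqrt_mult)
qed

end

definition abs_cont_on :: "real \<Rightarrow> real \<Rightarrow> (real \<Rightarrow> 'a::metric_space) \<Rightarrow> bool" where
  "abs_cont_on a b f \<longleftrightarrow>
     (\<forall>\<epsilon>>0. \<exists>\<delta>>0. \<forall>I. finite I \<longrightarrow>
        (\<forall>(s, t)\<in>I. a \<le> s \<and> s \<le> t \<and> t \<le> b) \<longrightarrow>
        disjoint_family_on (\<lambda>(s, t). {s<..<t}) I \<longrightarrow>
        (\<Sum>(s, t)\<in>I. t - s) < \<delta> \<longrightarrow> (\<Sum>(s, t)\<in>I. dist (f s) (f t)) < \<epsilon>)"

definition H1_fun :: "(real \<Rightarrow> complex) set" where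
  "H1_fun = {f. abs_cont_on 0 pi f \<and>
     (\<exists>g\<in>L2_fun. AE x in leb_pi. (f has_vector_derivative g x) (at x within {0..pi}))}"

datatype boundary_condition = Per_plus | Per_minus | Dir

fun satisfies_bc ::
    "boundary_condition \<Rightarrow> (real \<Rightarrow> complex) \<Rightarrow> (real \<Rightarrow> complex) \<Rightarrow> bool" where
  "satisfies_bc Per_plus y1 y2 \<longleftrightarrow> y1 0 = y1 pi \<and> y2 0 = y2 pi"
| "satisfies_bc Per_minus y1 y2 \<longleftrightarrow> y1 0 = - y1 pi \<and> y2 0 = - y2 pi"
| "satisfies_bc Dir y1 y2 \<longleftrightarrow> y1 0 = y2 0 \<and> y1 pi = y2 pi"

fun free_spectrum :: "boundary_condition \<Rightarrow> int set" where
  "free_spectrum Per_plus = {n. even n}"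
| "free_spectrum Per_minus = {n. odd n}"
| "free_spectrum Dir = UNIV"

text \<open>Elements of \<open>l2\<close> are classes modulo equality almost everywhere, and \<open>abs_l2\<close> maps a square
  integrable function to its class. The boundary conditions and the derivative refer to the
  representatives in \<open>H1_fun\<close>, whose values on the interval are uniquely determined by the class.\<close>

definition dirac_dom :: "boundary_condition \<Rightarrow> (l2 \<times> l2) set" where
  "dirac_dom bc =
     {(abs_l2 y1, abs_l2 y2) | y1 y2. y1 \<in> H1_fun \<and> y2 \<in> H1_fun \<and> satisfies_bc bc y1 y2}"

definition dirac_expr1 ::
    "(real \<Rightarrow> complex) \<Rightarrow> (real \<Rightarrow> complex) \<Rightarrow> (real \<Rightarrow> complex) \<Rightarrow> real \<Rightarrow> complex" where
  "dirac_expr1 P y1 y2 x = \<i> * vector_derivative y1 (at x within {0..pi}) + P x * y2 x"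

definition dirac_expr2 ::
    "(real \<Rightarrow> complex) \<Rightarrow> (real \<Rightarrow> complex) \<Rightarrow> (real \<Rightarrow> complex) \<Rightarrow> real \<Rightarrow> complex" where
  "dirac_expr2 Q y1 y2 x = - \<i> * vector_derivative y2 (at x within {0..pi}) + Q x * y1 x"

definition dirac_op ::
    "(real \<Rightarrow> complex) \<Rightarrow> (real \<Rightarrow> complex) \<Rightarrow> l2 \<times> l2 \<Rightarrow> l2 \<times> l2" where
  "dirac_op P Q u =
     (THE w. \<exists>y1\<in>H1_fun. \<exists>y2\<in>H1_fun. u = (abs_l2 y1, abs_l2 y2) \<and>
        w = (abs_l2 (dirac_expr1 P y1 y2), abs_l2 (dirac_expr2 Q y1 y2)))"

lemma abs_cont_on_continuous:
  assumes "abs_cont_on a b f"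
  shows "continuous_on {a..b} f"
  unfolding continuous_on_iff
proof (intro ballI allI impI)
  fix x e :: real assume x: "x \<in> {a..b}" and e: "0 < e"
  then obtain d where d: "d > 0" and D: "\<And>I. finite I \<Longrightarrow>
        (\<forall>(s, t)\<in>I. a \<le> s \<and> s \<le> t \<and> t \<le> b) \<Longrightarrow>
        disjoint_family_on (\<lambda>(s, t). {s<..<t}) I \<Longrightarrow>
        (\<Sum>(s, t)\<in>I. t - s) < d \<Longrightarrow> (\<Sum>(s, t)\<in>I. dist (f s) (f t)) < e"
    using assms unfolding abs_cont_on_def by meson
  show "\<exists>d>0. \<forall>x'\<in>{a..b}. dist x' x < d \<longrightarrow> dist (f x') (f x) < e"
  proof (intro exI[of _ d] conjI d ballI impI)
    fix y assume y: "y \<in> {a..b}" "dist y x < d"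
    show "dist (f y) (f x) < e"
    proof (cases "x \<le> y")
      case True
      then show ?thesis
        using D[of "{(x, y)}"] x y by (auto simp: disjoint_family_on_def dist_real_def dist_commute)
    next
      case False
      then show ?thesis
        using D[of "{(y, x)}"] x y by (auto simp: disjoint_family_on_def dist_real_def)
    qed
  qed
qed

lemma H1_fun_continuous: "f \<in> H1_fun \<Longrightarrow> continuous_on {0..pi} f"
  by (simp add: H1_fun_def abs_cont_on_continuous)

lemma continuous_measurable_leb_pi:
  fixes f :: "real \<Rightarrow> complex"
  shows "continuous_on {0..pi} f \<Longrightarrow> f \<in> borel_measurable leb_pi"
  by (rule continuous_imp_measurable_on_sets_lebesgue) auto

lemma L2_fun_mult_continuous:
  assumes "P \<in> L2_fun" "continuous_on {0..pi} f"
  shows "(\<lambda>x. P x * f x) \<in> L2_fun"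
proof -
  have [measurable]: "P \<in> borel_measurable leb_pi" "f \<in> borel_measurable leb_pi"
    using assms by (auto simp: L2_fun_def continuous_measurable_leb_pi)
  have "bounded (f ` {0..pi})"
    using assms(2) compact_continuous_image compact_imp_bounded by blast
  then obtain B where B: "\<And>x. x \<in> {0..pi} \<Longrightarrow> cmod (f x) \<le> B"
    unfolding bounded_iff by blast
  have "integrable leb_pi (\<lambda>x. (cmod (P x * f x))\<^sup>2)"
  proof (rule Bochner_Integration.integrable_bound)
    show "integrable leb_pi (\<lambda>x. B\<^sup>2 * (cmod (P x))\<^sup>2)"
      using assms by (auto simp: L2_fun_def)
    have "(cmod (P x))\<^sup>2 * (cmod (f x))\<^sup>2 \<le> B\<^sup>2 * (cmod (P x))\<^sup>2" if "x \<in> {0..pi}" for x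
      using B[OF that] by (subst mult.commute) (intro mult_right_mono power_mono, auto)
    then show "AE x in leb_pi. norm ((cmod (P x * f x))\<^sup>2) \<le> norm (B\<^sup>2 * (cmod (P x))\<^sup>2)"
      by (intro AE_I2) (simp add: norm_mult power_mult_distrib)
  qed simp
  then show ?thesis by (simp add: L2_fun_def)
qed

lemma L2_fun_one: "(\<lambda>x. 1) \<in> L2_fun"
  by (simp add: L2_fun_def)

lemma H1_fun_L2: "f \<in> H1_fun \<Longrightarrow> f \<in> L2_fun"
  using L2_fun_mult_continuous[OF L2_fun_one H1_fun_continuous] by simp

lemma L2_fun_cong_AE:
  assumes "f \<in> L2_fun" and ae: "AE x in leb_pi. f x = g x"
  shows "g \<in> L2_fun"
proof -
  have "AE x in lebesgue. x \<in> {0..pi} \<longrightarrow> f x = g x"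
    using ae by (simp add: AE_restrict_space_iff)
  then have "AE x in lebesgue. (if x \<in> {0..pi} then f x else 0) = (if x \<in> {0..pi} then g x else 0)"
    by eventually_elim auto
  moreover have "(\<lambda>x. if x \<in> {0..pi} then f x else 0) \<in> borel_measurable lebesgue"
    using assms(1) by (subst borel_measurable_if) (auto simp: L2_fun_def)
  ultimately have "(\<lambda>x. if x \<in> {0..pi} then g x else 0) \<in> borel_measurable lebesgue"
    by (rule borel_measurable_AE[rotated])
  then have [measurable]: "g \<in> borel_measurable leb_pi"
    by (subst (asm) borel_measurable_if) auto
  have [measurable]: "f \<in> borel_measurable leb_pi" and
    int: "integrable leb_pi (\<lambda>x. (cmod (f x))\<^sup>2)"
    using assms(1) by (auto simp: L2_fun_def)
  have "integrable leb_pi (\<lambda>x. (cmod (g x))\<^sup>2)"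
    by (rule integrable_cong_AE_imp[OF int]) (use ae in auto)
  then show ?thesis by (simp add: L2_fun_def)
qed

lemma H1_fun_vector_derivative:
  assumes "f \<in> H1_fun"
  shows "(\<lambda>x. vector_derivative f (at x within {0..pi})) \<in> L2_fun"
proof -
  obtain g where g: "g \<in> L2_fun"
      "AE x in leb_pi. (f has_vector_derivative g x) (at x within {0..pi})"
    using assms by (auto simp: H1_fun_def)
  have "AE x in leb_pi. x \<in> {0..pi}"
    by (rule AE_I2) simp
  with g(2) have "AE x in leb_pi. g x = vector_derivative f (at x within {0..pi})"
    by eventually_elim (simp add: vector_derivative_within_closed_interval)
  with g(1) show ?thesis by (rule L2_fun_cong_AE)
qed

lemma dirac_expr_L2:
  assumes "y1 \<in> H1_fun" "y2 \<in> H1_fun"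
  shows "P \<in> L2_fun \<Longrightarrow> dirac_expr1 P y1 y2 \<in> L2_fun"
    and "Q \<in> L2_fun \<Longrightarrow> dirac_expr2 Q y1 y2 \<in> L2_fun"
  unfolding dirac_expr1_def dirac_expr2_def
  by (intro L2_fun_add L2_fun_scale L2_fun_mult_continuous H1_fun_vector_derivative
      H1_fun_continuous assms; assumption)+

lemma abs_l2_eq_iff:
  assumes "f \<in> L2_fun" "g \<in> L2_fun"
  shows "abs_l2 f = abs_l2 g \<longleftrightarrow> (AE x in leb_pi. f x = g x)"
  using assms Quotient3_rel[OF Quotient3_l2, of f g] by (auto simp: l2_rel_def)

lemma H1_fun_unique:
  assumes "f \<in> H1_fun" "g \<in> H1_fun" "abs_l2 f = abs_l2 g" "x \<in> {0..pi}"
  shows "f x = g x"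
proof -
  have ae: "AE x in leb_pi. cmod (f x - g x) = 0"
    using assms by (simp add: abs_l2_eq_iff H1_fun_L2)
  have c: "continuous_on {0..pi} (\<lambda>x. cmod (f x - g x))"
    using assms by (intro continuous_intros H1_fun_continuous)
  have "(LINT x|leb_pi. cmod (f x - g x)) = 0"
    by (rule integral_eq_zero_AE[OF ae])
  then show ?thesis
    using integralL_eq_0_iff[OF c pi_gt_zero] assms(4) by simp
qed

lemma H1_fun_vector_derivative_unique:
  assumes "f \<in> H1_fun" "g \<in> H1_fun" "abs_l2 f = abs_l2 g" "x \<in> {0..pi}"
  shows "vector_derivative f (at x within {0..pi}) = vector_derivative g (at x within {0..pi})"
proof -
  have "(f has_vector_derivative d) (at x within {0..pi}) \<longleftrightarrow>
        (g has_vector_derivative d) (at x within {0..pi})" for d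
    using assms H1_fun_unique[OF assms(1-3)]
    by (metis has_vector_derivative_transform)
  then show ?thesis
    by (simp add: vector_derivative_def)
qed

text \<open>The definite description in \<open>dirac_op_def\<close> is proper on every \<open>dirac_dom bc\<close>.\<close>

lemma dirac_op_eq:
  assumes "P \<in> L2_fun" "Q \<in> L2_fun" and y: "y1 \<in> H1_fun" "y2 \<in> H1_fun"
  shows "dirac_op P Q (abs_l2 y1, abs_l2 y2) =
         (abs_l2 (dirac_expr1 P y1 y2), abs_l2 (dirac_expr2 Q y1 y2))"
  unfolding dirac_op_def
proof (rule the_equality)
  fix w
  assume "\<exists>z1\<in>H1_fun. \<exists>z2\<in>H1_fun. (abs_l2 y1, abs_l2 y2) = (abs_l2 z1, abs_l2 z2) \<and>
            w = (abs_l2 (dirac_expr1 P z1 z2), abs_l2 (dirac_expr2 Q z1 z2))"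
  then obtain z1 z2 where z: "z1 \<in> H1_fun" "z2 \<in> H1_fun"
      and eq: "abs_l2 z1 = abs_l2 y1" "abs_l2 z2 = abs_l2 y2"
      and w: "w = (abs_l2 (dirac_expr1 P z1 z2), abs_l2 (dirac_expr2 Q z1 z2))"
    by auto
  have "dirac_expr1 P z1 z2 x = dirac_expr1 P y1 y2 x"
       "dirac_expr2 Q z1 z2 x = dirac_expr2 Q y1 y2 x" if "x \<in> {0..pi}" for x
    using H1_fun_unique[OF z(1) y(1) eq(1) that] H1_fun_unique[OF z(2) y(2) eq(2) that]
      H1_fun_vector_derivative_unique[OF z(1) y(1) eq(1) that]
      H1_fun_vector_derivative_unique[OF z(2) y(2) eq(2) that]
    by (simp_all add: dirac_expr1_def dirac_expr2_def)
  then have "AE x in leb_pi. dirac_expr1 P z1 z2 x = dirac_expr1 P y1 y2 x"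
            "AE x in leb_pi. dirac_expr2 Q z1 z2 x = dirac_expr2 Q y1 y2 x"
    by (auto intro!: AE_I2)
  then show "w = (abs_l2 (dirac_expr1 P y1 y2), abs_l2 (dirac_expr2 Q y1 y2))"
    using assms z y by (simp add: w abs_l2_eq_iff dirac_expr_L2)
qed (use y in blast)

end

theory Submission
  imports Defs
begin

text \<open>The free resolvent \<open>R0 z\<close> is diagonal in an orthonormal basis of exponentials, in which the potential
  \<open>V\<close> has entries bounded by \<open>w (j + k)\<close> with \<open>w \<in> \<ell>\<^sup>2(\<int>)\<close>. The operator \<open>T z = V R0 z\<close> is Hilbert--Schmidt, and
  although it does not become small, its square does as \<open>z\<close> tends to infinity away from the free spectrum.
  Hence \<open>R z = R0 z (1 - T z)\<^sup>-\<^sup>1\<close> exists there, and \<open>R - R0 = R0 V R0 (1 - T)\<^sup>-\<^sup>1\<close>. The Hilbert--Schmidt norms of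
  \<open>R0 V R0\<close> on the circles about \<open>n\<close> are square summable in \<open>n\<close>, so the Riesz projections are quadratically
  close to the orthogonal projections of the free operator (the Bari--Markus property), and the series
  \<open>\<Sum> P\<^sub>n f\<close> converges unconditionally.

  Deforming contours, its partial sums together with \<open>S\<^sub>N f\<close> are integrals over \<open>\<bar>z\<bar> = M + 1 / 2\<close>. For \<open>f\<close> in the domain,
  \<open>R z f = f / z + R z (L f) / z\<close>, and the second term contributes nothing in the limit since \<open>R z\<close> is bounded
  by a multiple of \<open>min 1 (1 / \<bar>Im z\<bar>)\<close> on these circles. So the sum is \<open>f\<close> on a dense set, hence everywhere;
  no counting of dimensions is needed.\<close>

section \<open>Complex scalar products and orthonormal families\<close>

text \<open>The potential is only square integrable, so multiplication by it is in general
  unbounded. It exchanges the two components, whose exponentials have opposite frequencies; this is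
  why its entries are governed by \<open>j + k\<close>. Along an antidiagonal
  \<open>j + k = m\<close> they need not decay, and \<open>T z\<close> contains a single factor
  \<open>1 / (z - k)\<close>, so for \<open>k\<close> near \<open>z\<close> its entries can be of
  order \<open>w m\<close> however large \<open>z\<close> is. In the square of \<open>T z\<close> a
  second factor \<open>1 / (z - j)\<close> stands between the two copies of \<open>V\<close>. If
  \<open>j + k\<close> is bounded, then \<open>j\<close> and \<open>k\<close> cannot both be near a
  large \<open>z\<close>; the remaining pairs fall into the small tail of \<open>w\<close>.

  On the circle about \<open>n\<close> put \<open>j = n + a\<close> and \<open>k = n + b\<close>.
  The squared entries of R0 V R0 are at most a constant times the square of
  \<open>w (2 * n + a + b)\<close> divided by the squares of \<open>1 + \<bar>a\<bar>\<close> and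
  \<open>1 + \<bar>b\<bar>\<close>. For fixed \<open>a\<close> and \<open>b\<close> the sum over
  \<open>n\<close> is at most the square sum of \<open>w\<close>, and the sum over \<open>a\<close>
  and \<open>b\<close> converges.\<close>

lemma scaleC_minus_one: "(- 1) *\<^sub>C x = - (x :: 'a::complex_normed_vector)"
  using scaleC_of_real[of "-1" x] by simp

lemma scaleC_zero_left [simp]: "0 *\<^sub>C x = (0 :: 'a::complex_normed_vector)"
  using scaleC_of_real[of 0 x] by simp

lemma scaleC_diff_right: "a *\<^sub>C (x - y) = a *\<^sub>C x - a *\<^sub>C (y :: 'a::complex_normed_vector)"
  using bounded_linear.linear[OF bounded_linear_scaleC, of a] by (rule linear_diff)

lemma scaleC_diff_left: "(a - b) *\<^sub>C x = a *\<^sub>C x - b *\<^sub>C (x :: 'a::complex_normed_vector)"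
  using scaleC_add_left[of "a - b" b x] by (simp add: algebra_simps)

lemma scaleC_Complex: "a *\<^sub>C x = Re a *\<^sub>R x + Im a *\<^sub>R (\<i> *\<^sub>C (x :: 'a::complex_normed_vector))"
proof -
  have "a = of_real (Re a) + of_real (Im a) * \<i>" by (simp add: complex_eq_iff)
  then have "a *\<^sub>C x = (of_real (Re a) + of_real (Im a) * \<i>) *\<^sub>C x" by simp
  also have "\<dots> = Re a *\<^sub>R x + Im a *\<^sub>R (\<i> *\<^sub>C x)"
    by (simp only: scaleC_add_left scaleC_of_real flip: scaleC_scaleC)
  finally show ?thesis .
qed

text \<open>The type class provides only the real part of the Hermitian product. The imaginary part
  is recovered from Im <u, v> = Re <u, i v>, which makes \<open>cin\<close> linear in its first
  argument.\<close>

definition cin :: "'a::{complex_normed_vector, real_inner} \<Rightarrow> 'a \<Rightarrow> complex" where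
  "cin u v = Complex (inner u v) (inner u (\<i> *\<^sub>C v))"

text \<open>The two type classes share only the norm, so compatibility of \<open>inner\<close> with
  multiplication by \<open>\<i>\<close> comes from polarization of the isometry
  \<open>norm_scaleC\<close>.\<close>

lemma inner_ii: "inner (\<i> *\<^sub>C u) (\<i> *\<^sub>C v) = inner u (v :: 'a::{complex_normed_vector, real_inner})"
proof -
  have "(norm (\<i> *\<^sub>C (u + v)))\<^sup>2 = (norm (u + v))\<^sup>2" by (simp add: norm_scaleC)
  moreover have "(norm (\<i> *\<^sub>C u))\<^sup>2 = (norm u)\<^sup>2" "(norm (\<i> *\<^sub>C v))\<^sup>2 = (norm v)\<^sup>2"
    by (simp_all add: norm_scaleC)
  ultimately show ?thesis
    by (simp add: power2_norm_eq_inner scaleC_add_right inner_add_left inner_add_right inner_commute)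
qed

lemma inner_i_left: "inner (\<i> *\<^sub>C u) v = - inner u (\<i> *\<^sub>C (v :: 'a::{complex_normed_vector, real_inner}))"
proof -
  have "\<i> *\<^sub>C \<i> *\<^sub>C v = - v" by (simp add: scaleC_scaleC scaleC_minus_one)
  then show ?thesis using inner_ii[of u "\<i> *\<^sub>C v"] by simp
qed

lemma cin_add_left: "cin (u + u') v = cin u v + cin u' v"
  by (simp add: cin_def inner_add_left complex_eq_iff)

lemma cin_diff_left: "cin (u - u') v = cin u v - cin u' v"
  by (simp add: cin_def inner_diff_left complex_eq_iff)

lemma cin_zero_left [simp]: "cin 0 v = 0"
  by (simp add: cin_def complex_eq_iff)

lemma cin_sum_left: "cin (\<Sum>i\<in>A. f i) v = (\<Sum>i\<in>A. cin (f i) v)"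
  by (induction A rule: infinite_finite_induct) (simp_all add: cin_add_left)

lemma cin_scaleC_left: "cin (a *\<^sub>C u) v = a * cin u v"
  unfolding cin_def scaleC_Complex[of a u]
  by (simp add: complex_eq_iff inner_add_left inner_i_left scaleC_scaleC scaleC_minus_one)

lemma cin_commute: "cin v u = cnj (cin u v)"
  using inner_commute[of v u] inner_commute[of "\<i> *\<^sub>C u" v] inner_i_left[of u v]
  by (simp add: cin_def complex_eq_iff)

lemma cin_scaleC_right: "cin u (a *\<^sub>C v) = cnj a * cin u v"
  using cin_commute[of u "a *\<^sub>C v"] cin_commute[of u v] by (simp add: cin_scaleC_left)

lemma cin_self: "cin u u = of_real ((norm u)\<^sup>2)"
proof -
  have "inner u (\<i> *\<^sub>C u) = 0" using inner_i_left[of u u] by (simp add: inner_commute)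
  then show ?thesis by (simp add: cin_def complex_eq_iff power2_norm_eq_inner)
qed

lemma cin_bound: "cmod (cin u v) \<le> norm u * norm v"
proof (cases "cin u v = 0")
  case False
  \<comment> \<open>Multiplying \<open>u\<close> by the conjugate of \<open>cin u v\<close> makes
    the product real and nonnegative, so the real Cauchy-Schwarz inequality applies.\<close>
  have "(cmod (cin u v))\<^sup>2 = Re (cin (cnj (cin u v) *\<^sub>C u) v)"
    by (simp add: cin_scaleC_left mult.commute[of "cnj _"] flip: complex_norm_square of_real_power)
  also have "\<dots> = inner (cnj (cin u v) *\<^sub>C u) v" by (simp add: cin_def)
  also have "\<dots> \<le> norm (cnj (cin u v) *\<^sub>C u) * norm v" by (rule norm_cauchy_schwarz)
  also have "\<dots> = cmod (cin u v) * (norm u * norm v)" by (simp add: norm_scaleC)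
  finally show ?thesis using False by (simp add: power2_eq_square)
qed simp

lemma bounded_linear_cin: "bounded_linear (\<lambda>u. cin u v)"
proof (rule bounded_linear_intro)
  show "cin (r *\<^sub>R x) v = r *\<^sub>R cin x v" for r x
    by (simp add: cin_scaleC_left scaleR_conv_of_real flip: scaleC_of_real)
  show "norm (cin x v) \<le> norm x * norm v" for x by (rule cin_bound)
qed (rule cin_add_left)

lemma cin_eq_zero_imp: "(\<And>v. cin u v = 0) \<Longrightarrow> u = 0"
  using cin_self[of u] by simp

lemma cin_eqI: "(\<And>v. cin u v = cin u' v) \<Longrightarrow> u = u'"
  using cin_eq_zero_imp[of "u - u'"] by (simp add: cin_diff_left)

lemma norm_le_cinI:
  assumes "\<And>v. cmod (cin u v) \<le> C * norm v" "C \<ge> 0"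
  shows "norm u \<le> C"
proof (cases "norm u = 0")
  case False
  have "norm u * norm u \<le> C * norm u"
    using assms(1)[of u] by (simp add: cin_self power2_eq_square norm_mult)
  then show ?thesis using False by simp
qed (use assms in simp)

text \<open>Made for orthogonal series, which can converge unconditionally without converging
  absolutely: the hypothesis on \<open>F\<close> is what Pythagoras provides. Applied to differences
  of finite sets, it makes the net of partial sums Cauchy once the tail of \<open>b\<close> is
  small.\<close>

lemma summable_on_if_norm_sum_sq_le:
  fixes f :: "'i \<Rightarrow> 'a::banach" and b :: "'i \<Rightarrow> real"
  assumes b: "b summable_on A" "\<And>i. i \<in> A \<Longrightarrow> 0 \<le> b i"
    and le: "\<And>F. finite F \<Longrightarrow> F \<subseteq> A \<Longrightarrow> (norm (sum f F))\<^sup>2 \<le> sum b F"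
  shows "f summable_on A"
proof -
  have "\<exists>P. eventually P (finite_subsets_at_top A) \<and>
              (\<forall>F F'. P F \<and> P F' \<longrightarrow> dist (sum f F) (sum f F') < e)" if "e > 0" for e
  proof -
    have "(e / 3)\<^sup>2 > 0" using that by simp
    then obtain F0 where F0: "finite F0" "F0 \<subseteq> A" "dist (sum b F0) (infsum b A) \<le> (e / 3)\<^sup>2"
      using infsum_finite_approximation[OF b(1)] by blast
    define P where "P = (\<lambda>F. finite F \<and> F0 \<subseteq> F \<and> F \<subseteq> A)"
    have near: "norm (sum f F - sum f F0) \<le> e / 3" if "P F" for F
    proof -
      have F: "finite F" "F0 \<subseteq> F" "F \<subseteq> A" using that by (auto simp: P_def)
      have "(norm (sum f (F - F0)))\<^sup>2 \<le> sum b (F - F0)" using F by (intro le) auto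
      also have "\<dots> = sum b F - sum b F0" using F F0 by (simp add: sum_diff)
      also have "\<dots> \<le> infsum b A - sum b F0"
        using finite_sum_le_infsum[OF b(1), of F] F b(2) by auto
      also have "\<dots> \<le> (e / 3)\<^sup>2" using F0(3) by (simp add: dist_real_def)
      finally have "norm (sum f (F - F0)) \<le> e / 3"
        by (rule power2_le_imp_le) (use \<open>e > 0\<close> in simp)
      then show ?thesis using F F0 by (simp add: sum_diff)
    qed
    have "dist (sum f F) (sum f F') < e" if "P F" "P F'" for F F'
    proof -
      have "dist (sum f F) (sum f F') \<le> dist (sum f F) (sum f F0) + dist (sum f F') (sum f F0)"
        by (rule dist_triangle2)
      also have "\<dots> \<le> e / 3 + e / 3" using near[OF that(1)] near[OF that(2)] by (simp add: dist_norm)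
      finally show ?thesis using \<open>e > 0\<close> by simp
    qed
    moreover have "eventually P (finite_subsets_at_top A)"
      unfolding eventually_finite_subsets_at_top P_def using F0 by auto
    ultimately show ?thesis by blast
  qed
  then have "cauchy_filter (filtermap (sum f) (finite_subsets_at_top A))"
    by (simp add: cauchy_filter_metric_filtermap)
  moreover have "complete (UNIV::'a set)"
    by (meson Cauchy_convergent UNIV_I complete_def convergent_def)
  ultimately obtain L' where "(sum f \<longlongrightarrow> L') (finite_subsets_at_top A)"
    using complete_uniform[where S=UNIV] by (force simp add: filterlim_def)
  then show ?thesis
    using summable_on_def has_sum_def by blast
qed

section \<open>Orthonormal families, expansions and Hilbert-Schmidt bounds\<close>

lemma norm_sum_mult_sq_le:
  fixes a b :: "'i \<Rightarrow> complex"
  shows "(cmod (\<Sum>i\<in>F. a i * b i))\<^sup>2 \<le> (\<Sum>i\<in>F. (cmod (a i))\<^sup>2) * (\<Sum>i\<in>F. (cmod (b i))\<^sup>2)"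
proof -
  have "cmod (\<Sum>i\<in>F. a i * b i) \<le> (\<Sum>i\<in>F. cmod (a i) * cmod (b i))"
    by (rule order_trans[OF norm_sum]) (simp add: norm_mult)
  then have "(cmod (\<Sum>i\<in>F. a i * b i))\<^sup>2 \<le> (\<Sum>i\<in>F. cmod (a i) * cmod (b i))\<^sup>2"
    by (intro power_mono) auto
  also have "\<dots> \<le> (\<Sum>i\<in>F. (cmod (a i))\<^sup>2) * (\<Sum>i\<in>F. (cmod (b i))\<^sup>2)"
    by (rule Cauchy_Schwarz_ineq_sum)
  finally show ?thesis .
qed

locale orthonormal =
  fixes e :: "'j \<Rightarrow> 'a::{complex_normed_vector, real_inner}" and J :: "'j set"
  assumes orth: "i \<in> J \<Longrightarrow> j \<in> J \<Longrightarrow> cin (e i) (e j) = of_bool (i = j)"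
begin

lemma cin_lincomb:
  assumes "finite F" "F \<subseteq> J" "j \<in> J"
  shows "cin (\<Sum>i\<in>F. c i *\<^sub>C e i) (e j) = (if j \<in> F then c j else 0)"
proof -
  have "cin (\<Sum>i\<in>F. c i *\<^sub>C e i) (e j) = (\<Sum>i\<in>F. c i * of_bool (i = j))"
    using assms by (auto simp: cin_sum_left cin_scaleC_left orth subset_iff intro!: sum.cong)
  also have "\<dots> = (\<Sum>i\<in>F. if i = j then c i else 0)" by (intro sum.cong) auto
  finally show ?thesis using assms by simp
qed

lemma norm_lincomb_sq:
  assumes "finite F" "F \<subseteq> J"
  shows "(norm (\<Sum>i\<in>F. c i *\<^sub>C e i))\<^sup>2 = (\<Sum>i\<in>F. (cmod (c i))\<^sup>2)"
proof -
  let ?x = "\<Sum>i\<in>F. c i *\<^sub>C e i"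
  have "cin ?x ?x = (\<Sum>i\<in>F. c i * cin (e i) ?x)"
    by (subst (1) cin_sum_left) (simp add: cin_scaleC_left)
  also have "\<dots> = (\<Sum>i\<in>F. c i * cnj (c i))"
  proof (intro sum.cong refl)
    fix i assume "i \<in> F"
    then show "c i * cin (e i) ?x = c i * cnj (c i)"
      using assms cin_commute[of "e i" ?x] cin_lincomb[OF assms, of i c] by auto
  qed
  finally have "complex_of_real ((norm ?x)\<^sup>2) = of_real (\<Sum>i\<in>F. (cmod (c i))\<^sup>2)"
    by (simp add: cin_self flip: complex_norm_square)
  then show ?thesis by (simp only: of_real_eq_iff)
qed

lemma bessel:
  assumes "finite F" "F \<subseteq> J"
  shows "(\<Sum>j\<in>F. (cmod (cin u (e j)))\<^sup>2) \<le> (norm u)\<^sup>2"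
proof -
  let ?p = "\<Sum>j\<in>F. cin u (e j) *\<^sub>C e j"
  let ?s = "\<Sum>j\<in>F. (cmod (cin u (e j)))\<^sup>2"
  have "cin ?p u = (\<Sum>j\<in>F. cin u (e j) * cnj (cin u (e j)))"
    using cin_commute[of "e _" u] by (simp add: cin_sum_left cin_scaleC_left)
  also have "\<dots> = of_real ?s" by (simp flip: complex_norm_square)
  finally have 1: "inner ?p u = ?s" by (simp add: cin_def complex_eq_iff)
  have 2: "(norm ?p)\<^sup>2 = ?s" by (rule norm_lincomb_sq[OF assms])
  have "0 \<le> (norm (u - ?p))\<^sup>2" by simp
  also have "\<dots> = (norm u)\<^sup>2 - 2 * inner ?p u + (norm ?p)\<^sup>2"
    by (simp add: power2_norm_eq_inner inner_diff_left inner_diff_right inner_commute)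
  finally show ?thesis using 1 2 by simp
qed

lemma coef_sq_summable: "(\<lambda>j. (cmod (cin u (e j)))\<^sup>2) summable_on J"
  by (rule nonneg_bounded_partial_sums_imp_summable_on[where C = "(norm u)\<^sup>2"])
    (auto simp: bessel)

end

locale orthonormal_basis = orthonormal e J
  for e :: "'j \<Rightarrow> 'a::{complex_normed_vector, real_inner, banach}" and J +
  assumes total: "(\<And>j. j \<in> J \<Longrightarrow> cin u (e j) = 0) \<Longrightarrow> u = 0"
begin

lemma coef_eqI: "(\<And>j. j \<in> J \<Longrightarrow> cin u (e j) = cin v (e j)) \<Longrightarrow> u = v"
  using total[of "u - v"] by (simp add: cin_diff_left)

text \<open>Pythagoras and Bessel's inequality give convergence to some vector; it has the same
  coefficients as \<open>u\<close>, and totality identifies the two.\<close>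

lemma expansion: "((\<lambda>j. cin u (e j) *\<^sub>C e j) has_sum u) J"
proof -
  have s: "(\<lambda>j. cin u (e j) *\<^sub>C e j) summable_on J"
    by (rule summable_on_if_norm_sum_sq_le[OF coef_sq_summable[of u]])
      (auto simp: norm_lincomb_sq)
  define v where "v = infsum (\<lambda>j. cin u (e j) *\<^sub>C e j) J"
  have hs: "((\<lambda>j. cin u (e j) *\<^sub>C e j) has_sum v) J" using s by (simp add: v_def)
  have "cin v (e i) = cin u (e i)" if i: "i \<in> J" for i
  proof -
    have "((\<lambda>j. cin (cin u (e j) *\<^sub>C e j) (e i)) has_sum cin v (e i)) J"
      using has_sum_bounded_linear[OF bounded_linear_cin hs, of "e i"] by (simp add: o_def)
    moreover have "((\<lambda>j. cin (cin u (e j) *\<^sub>C e j) (e i)) has_sum cin u (e i)) J"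
    proof (rule has_sum_finite_neutralI[where B = "{i}"])
      show "{i} \<subseteq> J" using i by simp
    qed (use i orth in \<open>auto simp: cin_scaleC_left\<close>)
    ultimately show ?thesis by (rule has_sum_unique)
  qed
  then have "v = u" by (rule coef_eqI)
  with hs show ?thesis by simp
qed

lemma cin_expansion: "((\<lambda>j. cin u (e j) * cin (e j) h) has_sum cin u h) J"
  using has_sum_bounded_linear[OF bounded_linear_cin expansion, of u h]
  by (simp add: o_def cin_scaleC_left)

lemma norm_le_coefI:
  assumes "\<And>F. finite F \<Longrightarrow> F \<subseteq> J \<Longrightarrow> (\<Sum>j\<in>F. (cmod (cin u (e j)))\<^sup>2) \<le> C\<^sup>2" "C \<ge> 0"
  shows "norm u \<le> C"
proof -
  have "((\<lambda>F. norm (\<Sum>j\<in>F. cin u (e j) *\<^sub>C e j)) \<longlongrightarrow> norm u) (finite_subsets_at_top J)"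
    using expansion[of u] unfolding has_sum_def by (rule tendsto_norm)
  moreover have "\<forall>\<^sub>F F in finite_subsets_at_top J. norm (\<Sum>j\<in>F. cin u (e j) *\<^sub>C e j) \<le> C"
    by (rule eventually_finite_subsets_at_top_weakI)
      (rule power2_le_imp_le, simp_all add: norm_lincomb_sq assms)
  ultimately show ?thesis
    by (rule tendsto_upperbound) simp
qed

text \<open>The operator is known only through the coordinates of its values, so \<open>x\<close>
  stands for the image of \<open>f\<close>, and the matrix \<open>m\<close> is bounded on finite
  rectangles. Cauchy-Schwarz on a rectangle and Bessel's inequality for \<open>f\<close> give the
  estimate, which passes to the limit in \<open>K\<close>.\<close>

lemma hilbert_schmidt_bound:
  assumes X: "\<And>j. j \<in> J \<Longrightarrow> ((\<lambda>k. m j k * cin f (e k)) has_sum cin x (e j)) J"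
    and m: "\<And>F K. finite F \<Longrightarrow> F \<subseteq> J \<Longrightarrow> finite K \<Longrightarrow> K \<subseteq> J \<Longrightarrow>
              (\<Sum>j\<in>F. \<Sum>k\<in>K. (cmod (m j k))\<^sup>2) \<le> C\<^sup>2" and "C \<ge> 0"
  shows "norm x \<le> C * norm f"
proof (rule norm_le_coefI)
  fix F assume F: "finite F" "F \<subseteq> J"
  have "((\<lambda>K. \<Sum>j\<in>F. (cmod (\<Sum>k\<in>K. m j k * cin f (e k)))\<^sup>2) \<longlongrightarrow> (\<Sum>j\<in>F. (cmod (cin x (e j)))\<^sup>2))
          (finite_subsets_at_top J)"
  proof (intro tendsto_sum tendsto_power tendsto_norm)
    fix j assume "j \<in> F"
    with F X[of j] show "((\<lambda>K. \<Sum>k\<in>K. m j k * cin f (e k)) \<longlongrightarrow> cin x (e j)) (finite_subsets_at_top J)"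
      unfolding has_sum_def by blast
  qed
  moreover have "\<forall>\<^sub>F K in finite_subsets_at_top J.
      (\<Sum>j\<in>F. (cmod (\<Sum>k\<in>K. m j k * cin f (e k)))\<^sup>2) \<le> (C * norm f)\<^sup>2"
  proof (rule eventually_finite_subsets_at_top_weakI)
    fix K assume K: "finite K" "K \<subseteq> J"
    have "(\<Sum>j\<in>F. (cmod (\<Sum>k\<in>K. m j k * cin f (e k)))\<^sup>2)
        \<le> (\<Sum>j\<in>F. (\<Sum>k\<in>K. (cmod (m j k))\<^sup>2) * (\<Sum>k\<in>K. (cmod (cin f (e k)))\<^sup>2))"
      by (intro sum_mono norm_sum_mult_sq_le)
    also have "\<dots> = (\<Sum>j\<in>F. \<Sum>k\<in>K. (cmod (m j k))\<^sup>2) * (\<Sum>k\<in>K. (cmod (cin f (e k)))\<^sup>2)"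
      by (simp only: sum_distrib_right)
    also have "\<dots> \<le> C\<^sup>2 * (norm f)\<^sup>2"
      by (rule mult_mono[OF m[OF F K] bessel[OF K]]) (simp_all add: sum_nonneg)
    finally show "(\<Sum>j\<in>F. (cmod (\<Sum>k\<in>K. m j k * cin f (e k)))\<^sup>2) \<le> (C * norm f)\<^sup>2"
      by (simp add: power_mult_distrib)
  qed
  ultimately show "(\<Sum>j\<in>F. (cmod (cin x (e j)))\<^sup>2) \<le> (C * norm f)\<^sup>2"
    by (rule tendsto_upperbound) simp
qed (use \<open>C \<ge> 0\<close> in simp)

end

section \<open>Perturbations of diagonal operators\<close>

lemma nonneg_summable_onI:
  fixes f :: "'i \<Rightarrow> real"
  assumes "\<And>i. i \<in> A \<Longrightarrow> 0 \<le> f i" "\<And>F. finite F \<Longrightarrow> F \<subseteq> A \<Longrightarrow> sum f F \<le> C"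
  shows "f summable_on A"
  by (rule nonneg_bounded_partial_sums_imp_summable_on[where C = C]) (use assms in auto)

text \<open>The factor 2 counts the two possible branches of a frequency.\<close>

lemma sum_fst_le:
  fixes g :: "int \<Rightarrow> real" and F :: "(int \<times> bool) set"
  assumes "finite F" "\<And>n. 0 \<le> g n"
  shows "(\<Sum>j\<in>F. g (fst j)) \<le> 2 * (\<Sum>n\<in>fst ` F. g n)"
proof -
  have "(\<Sum>j\<in>F. g (fst j)) \<le> (\<Sum>j\<in>fst ` F \<times> (UNIV :: bool set). g (fst j))"
    using assms by (intro sum_mono2) (auto intro: rev_image_eqI)
  also have "\<dots> = 2 * (\<Sum>n\<in>fst ` F. g n)"
    by (simp add: sum.cartesian_product' sum_distrib_left UNIV_bool)
  finally show ?thesis .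
qed

text \<open>Up to a constant, a majorant for inverse square distances to the integers; the summand 1
  keeps it finite at \<open>i = 0\<close>.\<close>

definition inv_sq :: "int \<Rightarrow> real" where "inv_sq i = 1 / (1 + real_of_int \<bar>i\<bar>)\<^sup>2"

lemma inv_sq_nonneg: "0 \<le> inv_sq i" by (simp add: inv_sq_def)

lemma inv_sq_summable: "inv_sq summable_on UNIV"
proof -
  have s: "(\<lambda>n. 1 / (1 + real n)\<^sup>2) summable_on UNIV"
    using inverse_squares_sums by (intro summable_nonneg_imp_summable_on) (auto simp: sums_iff add.commute)
  have "inv_sq summable_on (range int)"
    by (subst summable_on_reindex) (use s in \<open>auto simp: o_def inv_sq_def\<close>)
  moreover have "inv_sq summable_on (range (\<lambda>n. - int n - 1))"
  proof (subst summable_on_reindex)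
    show "inv_sq \<circ> (\<lambda>n. - int n - 1) summable_on UNIV"
    proof (rule summable_on_comparison_test[OF s])
      fix n :: nat
      have "(1 + real n)\<^sup>2 \<le> (1 + (real n + 1))\<^sup>2" by (rule power_mono) auto
      then show "(inv_sq \<circ> (\<lambda>n. - int n - 1)) n \<le> 1 / (1 + real n)\<^sup>2"
        by (auto simp: inv_sq_def intro!: divide_left_mono mult_pos_pos)
    qed (auto simp: inv_sq_nonneg)
  qed (auto simp: inj_on_def)
  moreover have "range int \<inter> range (\<lambda>n. - int n - 1) = {}" by auto
  ultimately have "inv_sq summable_on (range int \<union> range (\<lambda>n. - int n - 1))"
    by (rule summable_on_Un_disjoint)
  moreover have "range int \<union> range (\<lambda>n. - int n - 1) = UNIV"
  proof -
    have "i \<in> range int \<union> range (\<lambda>n. - int n - 1)" for i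
    proof (cases "i \<ge> 0")
      case False
      then have "i = - int (nat (- i - 1)) - 1" by simp
      then show ?thesis by blast
    qed (metis UnI1 nonneg_int_cases rangeI)
    then show ?thesis by blast
  qed
  ultimately show ?thesis by simp
qed

definition inv_sq_sum :: real where "inv_sq_sum = infsum inv_sq UNIV"

lemma inv_sq_sum_nonneg: "0 \<le> inv_sq_sum"
  unfolding inv_sq_sum_def by (rule infsum_nonneg) (rule inv_sq_nonneg)

lemma sum_shift_le_infsum:
  fixes f :: "int \<Rightarrow> real"
  assumes "f summable_on UNIV" "\<And>i. 0 \<le> f i" "finite F" "inj_on g F"
  shows "(\<Sum>i\<in>F. f (g i)) \<le> infsum f UNIV"
proof -
  have "(\<Sum>i\<in>F. f (g i)) = sum f (g ` F)" using assms by (simp add: sum.reindex)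
  also have "\<dots> \<le> infsum f UNIV" using assms by (intro finite_sum_le_infsum) auto
  finally show ?thesis .
qed

lemma tail_sum_le:
  fixes f :: "int \<Rightarrow> real"
  assumes "f summable_on UNIV" "\<And>i. 0 \<le> f i" "\<delta> > 0"
  obtains K :: nat where "\<And>F. finite F \<Longrightarrow> (\<And>m. m \<in> F \<Longrightarrow> \<bar>m\<bar> > int K) \<Longrightarrow> sum f F \<le> \<delta>"
proof -
  obtain M where M: "finite M" "dist (sum f M) (infsum f UNIV) \<le> \<delta>"
    using infsum_finite_approximation[OF assms(1,3)] by blast
  define K where "K = Max (insert 0 ((\<lambda>m. nat \<bar>m\<bar>) ` M))"
  have K: "\<bar>m\<bar> \<le> int K" if "m \<in> M" for m
  proof -
    have "nat \<bar>m\<bar> \<le> K" unfolding K_def using M(1) that by (intro Max_ge) auto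
    then show ?thesis by simp
  qed
  show thesis
  proof
    fix F :: "int set" assume F: "finite F" "\<And>m. m \<in> F \<Longrightarrow> \<bar>m\<bar> > int K"
    then have "F \<inter> M = {}" using K by force
    then have "sum f F + sum f M = sum f (F \<union> M)" using F M by (simp add: sum.union_disjoint)
    also have "\<dots> \<le> infsum f UNIV" using F M assms by (intro finite_sum_le_infsum) auto
    finally show "sum f F \<le> \<delta>" using M(2) by (simp add: dist_real_def)
  qed
qed

text \<open>An index is a pair of a frequency in \<open>G\<close> and a branch in \<open>B\<close>.
  The vector \<open>h j\<close> acts as the adjoint perturbation applied to \<open>e j\<close>, so
  that \<open>L - L0\<close>, meaningful on \<open>D\<close> only, can be tested against basis
  vectors. The assumption on the coefficients of \<open>L0 y\<close> expresses that boundary terms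
  vanish; together with \<open>free_solvable\<close> it determines the free resolvent. Symmetry of
  \<open>G\<close> lets circles about 0 enclose frequencies in opposite pairs.\<close>

locale perturbed_diagonal = orthonormal_basis e "G \<times> B"
  for e :: "int \<times> bool \<Rightarrow> 'a::{complex_normed_vector, real_inner, banach}"
    and G :: "int set" and B :: "bool set" +
  fixes D :: "'a set" and L0 L :: "'a \<Rightarrow> 'a" and h :: "int \<times> bool \<Rightarrow> 'a" and w :: "int \<Rightarrow> real"
  assumes D_add: "x \<in> D \<Longrightarrow> y \<in> D \<Longrightarrow> x + y \<in> D"
    and D_scaleC: "x \<in> D \<Longrightarrow> a *\<^sub>C x \<in> D"
    and L_add: "x \<in> D \<Longrightarrow> y \<in> D \<Longrightarrow> L (x + y) = L x + L y"
    and L_scaleC: "x \<in> D \<Longrightarrow> L (a *\<^sub>C x) = a *\<^sub>C L x"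
    and L0_coef: "y \<in> D \<Longrightarrow> j \<in> G \<times> B \<Longrightarrow> cin (L0 y) (e j) = of_int (fst j) * cin y (e j)"
    and pert_coef: "y \<in> D \<Longrightarrow> j \<in> G \<times> B \<Longrightarrow> cin (L y - L0 y) (e j) = cin y (h j)"
    and h_bound: "j \<in> G \<times> B \<Longrightarrow> k \<in> G \<times> B \<Longrightarrow> cmod (cin (e k) (h j)) \<le> w (fst j + fst k)"
    and w_nonneg: "0 \<le> w m"
    and w_sq: "(\<lambda>m. (w m)\<^sup>2) summable_on UNIV"
    and free_solvable: "z \<notin> of_int ` G \<Longrightarrow> \<exists>y\<in>D. z *\<^sub>C y - L0 y = f"
    and G_sym: "n \<in> G \<Longrightarrow> - n \<in> G"
    and G_nonempty: "G \<noteq> {}"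
begin

abbreviation "J \<equiv> G \<times> B"

text \<open>Off the free spectrum the choice is unique, by \<open>R0_unique\<close>.\<close>

definition R0 :: "complex \<Rightarrow> 'a \<Rightarrow> 'a" where
  "R0 z f = (SOME y. y \<in> D \<and> z *\<^sub>C y - L0 y = f)"

lemma R0:
  assumes "z \<notin> of_int ` G"
  shows "R0 z f \<in> D" "z *\<^sub>C R0 z f - L0 (R0 z f) = f"
  using someI_ex[of "\<lambda>y. y \<in> D \<and> z *\<^sub>C y - L0 y = f"] free_solvable[OF assms, of f]
  unfolding R0_def by blast+

lemma free_coef:
  assumes "y \<in> D" "j \<in> J"
  shows "cin (z *\<^sub>C y - L0 y) (e j) = (z - of_int (fst j)) * cin y (e j)"
  using assms by (simp add: cin_diff_left cin_scaleC_left L0_coef algebra_simps)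

lemma R0_coef:
  assumes "z \<notin> of_int ` G" "j \<in> J"
  shows "cin (R0 z f) (e j) = cin f (e j) / (z - of_int (fst j))"
proof -
  have "z - of_int (fst j) \<noteq> 0" using assms by auto
  then show ?thesis using free_coef[OF R0(1), of z j z f] R0(2)[of z f] assms by (simp add: field_simps)
qed

lemma R0_unique:
  assumes "z \<notin> of_int ` G" "y \<in> D"
  shows "R0 z (z *\<^sub>C y - L0 y) = y"
proof (rule coef_eqI)
  fix j assume j: "j \<in> J"
  then have "z - of_int (fst j) \<noteq> 0" using assms by auto
  then show "cin (R0 z (z *\<^sub>C y - L0 y)) (e j) = cin y (e j)"
    using assms j by (simp add: R0_coef free_coef)
qed

lemma R0_add: "z \<notin> of_int ` G \<Longrightarrow> R0 z (f + g) = R0 z f + R0 z g"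
  by (rule coef_eqI) (simp add: R0_coef cin_add_left add_divide_distrib)

lemma R0_scaleC: "z \<notin> of_int ` G \<Longrightarrow> R0 z (a *\<^sub>C f) = a *\<^sub>C R0 z f"
  by (rule coef_eqI) (simp add: R0_coef cin_scaleC_left)

lemma L0_add: "x \<in> D \<Longrightarrow> y \<in> D \<Longrightarrow> L0 (x + y) = L0 x + L0 y"
  by (rule coef_eqI) (simp add: L0_coef cin_add_left D_add distrib_left)

lemma L0_scaleC: "x \<in> D \<Longrightarrow> L0 (a *\<^sub>C x) = a *\<^sub>C L0 x"
  by (rule coef_eqI) (simp add: L0_coef cin_scaleC_left D_scaleC)

text \<open>The domain is abstract here, so membership is obtained from the range of the free
  resolvent at the nonreal point \<open>\<i>\<close>.\<close>

lemma e_in_D: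
  assumes "j \<in> J"
  shows "e j \<in> D"
proof -
  have z: "\<i> \<notin> of_int ` G" by (auto simp: complex_eq_iff)
  define c where "c = \<i> - of_int (fst j)"
  have "c \<noteq> 0" using z assms unfolding c_def by auto
  have "R0 \<i> (c *\<^sub>C e j) = e j"
  proof (rule coef_eqI)
    fix i assume i: "i \<in> J"
    show "cin (R0 \<i> (c *\<^sub>C e j)) (e i) = cin (e j) (e i)"
      using i z assms \<open>c \<noteq> 0\<close> by (auto simp: R0_coef cin_scaleC_left orth c_def)
  qed
  then show ?thesis using R0(1)[OF z, of "c *\<^sub>C e j"] by simp
qed

definition T :: "complex \<Rightarrow> 'a \<Rightarrow> 'a" where "T z f = L (R0 z f) - L0 (R0 z f)"

lemma T_add: "z \<notin> of_int ` G \<Longrightarrow> T z (f + g) = T z f + T z g"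
  by (simp add: T_def R0_add R0 L_add L0_add)

lemma T_scaleC: "z \<notin> of_int ` G \<Longrightarrow> T z (a *\<^sub>C f) = a *\<^sub>C T z f"
  by (simp add: T_def R0_scaleC R0 L_scaleC L0_scaleC scaleC_diff_right)

text \<open>Move the perturbation onto \<open>h j\<close> and expand the product of
  \<open>R0 z f\<close> with \<open>h j\<close> in the basis.\<close>

lemma T_coef:
  assumes "z \<notin> of_int ` G" "j \<in> J"
  shows "((\<lambda>k. cin (e k) (h j) / (z - of_int (fst k)) * cin f (e k)) has_sum cin (T z f) (e j)) J"
proof -
  have "((\<lambda>k. cin (R0 z f) (e k) * cin (e k) (h j)) has_sum cin (R0 z f) (h j)) J"
    by (rule cin_expansion)
  also have "cin (R0 z f) (h j) = cin (T z f) (e j)"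
    using assms by (simp add: T_def pert_coef R0)
  also have "((\<lambda>k. cin (R0 z f) (e k) * cin (e k) (h j)) has_sum cin (T z f) (e j)) J \<longleftrightarrow>
      ((\<lambda>k. cin (e k) (h j) / (z - of_int (fst k)) * cin f (e k)) has_sum cin (T z f) (e j)) J"
    by (rule has_sum_cong) (use assms in \<open>simp add: R0_coef\<close>)
  finally show ?thesis .
qed

lemma R0_T_coef:
  assumes "z \<notin> of_int ` G" "j \<in> J"
  shows "((\<lambda>k. cin (e k) (h j) / ((z - of_int (fst j)) * (z - of_int (fst k))) * cin f (e k))
           has_sum cin (R0 z (T z f)) (e j)) J"
  using has_sum_cmult_right[OF T_coef[OF assms, of f], of "1 / (z - of_int (fst j))"] assms
  by (simp add: R0_coef mult.assoc)

text \<open>The margin 1/8 is below the radius 1/4 of the small contours, which leaves room around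
  them.\<close>

definition far :: "complex \<Rightarrow> bool" where
  "far z \<longleftrightarrow> (\<forall>n\<in>G. 1 / 8 \<le> cmod (z - of_int n))"

lemma far_not_in: "far z \<Longrightarrow> z \<notin> of_int ` G"
  by (fastforce simp: far_def)

text \<open>\<open>U\<close> bounds the sum of the inverse square distances from a far
  \<open>z\<close> to the frequencies, and \<open>W\<close> the square sum of any row or column of
  the perturbation. Each factor 2 counts the branches; 24 comes from
  \<open>far_dist\<close>.\<close>

definition U :: real where "U = 2 * 24\<^sup>2 * inv_sq_sum"
definition W :: real where "W = 2 * infsum (\<lambda>m. (w m)\<^sup>2) UNIV"

lemma U_nonneg: "0 \<le> U" by (simp add: U_def inv_sq_sum_nonneg)
lemma W_nonneg: "0 \<le> W" by (simp add: W_def infsum_nonneg)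

lemma far_dist:
  assumes "far z" "n \<in> G"
  shows "(1 + real_of_int \<bar>n - \<lfloor>Re z\<rfloor>\<bar>) / 24 \<le> cmod (z - of_int n)"
proof -
  have 1: "1 / 8 \<le> cmod (z - of_int n)" using assms by (auto simp: far_def)
  have "\<bar>Re z - of_int n\<bar> \<le> cmod (z - of_int n)" using abs_Re_le_cmod[of "z - of_int n"] by simp
  then have 2: "real_of_int \<bar>n - \<lfloor>Re z\<rfloor>\<bar> - 1 \<le> cmod (z - of_int n)" by linarith
  \<comment> \<open>For \<open>x \<le> 2\<close> the left side is at most 1/8, with equality at 2,
    and beyond that it is below \<open>x - 1\<close>; this fixes 24.\<close>
  have "(1 + x) / 24 \<le> y" if "1 / 8 \<le> y" "x - 1 \<le> y" for x y :: real
    using that by (cases "x \<le> 2") (simp_all add: field_simps)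
  from this[OF 1 2] show ?thesis .
qed

lemma U_bound:
  assumes "far z" "finite F" "F \<subseteq> J"
  shows "(\<Sum>k\<in>F. (1 / cmod (z - of_int (fst k)))\<^sup>2) \<le> U"
proof -
  let ?m = "\<lfloor>Re z\<rfloor>"
  have "(1 / cmod (z - of_int n))\<^sup>2 \<le> 24\<^sup>2 * inv_sq (n - ?m)" if "n \<in> G" for n
  proof -
    have "1 / cmod (z - of_int n) \<le> 1 / ((1 + real_of_int \<bar>n - ?m\<bar>) / 24)"
      using far_dist[OF assms(1) that] by (intro divide_left_mono mult_pos_pos) (auto intro: less_le_trans[rotated])
    then have "(1 / cmod (z - of_int n))\<^sup>2 \<le> (24 / (1 + real_of_int \<bar>n - ?m\<bar>))\<^sup>2"
      by (intro power_mono) auto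
    then show ?thesis by (simp add: inv_sq_def power_divide)
  qed
  then have "(\<Sum>k\<in>F. (1 / cmod (z - of_int (fst k)))\<^sup>2) \<le> (\<Sum>k\<in>F. 24\<^sup>2 * inv_sq (fst k - ?m))"
    using assms by (intro sum_mono) auto
  also have "\<dots> = 24\<^sup>2 * (\<Sum>k\<in>F. inv_sq (fst k - ?m))" by (simp add: sum_distrib_left)
  also have "(\<Sum>k\<in>F. inv_sq (fst k - ?m)) \<le> 2 * (\<Sum>n\<in>fst ` F. inv_sq (n - ?m))"
    by (rule sum_fst_le[where g = "\<lambda>n. inv_sq (n - ?m)"]) (use assms in \<open>auto simp: inv_sq_nonneg\<close>)
  also have "(\<Sum>n\<in>fst ` F. inv_sq (n - ?m)) \<le> inv_sq_sum" unfolding inv_sq_sum_def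
    by (rule sum_shift_le_infsum) (use assms in \<open>auto simp: inv_sq_nonneg inv_sq_summable inj_on_def\<close>)
  finally show ?thesis by (simp add: U_def)
qed

lemma W_bound:
  fixes F :: "(int \<times> bool) set"
  assumes "finite F"
  shows "(\<Sum>k\<in>F. (w (fst k + m))\<^sup>2) \<le> W"
proof -
  have "(\<Sum>k\<in>F. (w (fst k + m))\<^sup>2) \<le> 2 * (\<Sum>n\<in>fst ` F. (w (n + m))\<^sup>2)"
    by (rule sum_fst_le[where g = "\<lambda>n. (w (n + m))\<^sup>2"]) (use assms in auto)
  also have "(\<Sum>n\<in>fst ` F. (w (n + m))\<^sup>2) \<le> infsum (\<lambda>m. (w m)\<^sup>2) UNIV"
    by (rule sum_shift_le_infsum[OF w_sq]) (use assms in \<open>auto simp: inj_on_def\<close>)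
  finally show ?thesis by (simp add: W_def)
qed

lemma R0_norm:
  assumes "z \<notin> of_int ` G" "s \<ge> 0" "\<And>n. n \<in> G \<Longrightarrow> 1 / cmod (z - of_int n) \<le> s"
  shows "norm (R0 z f) \<le> s * norm f"
proof (rule norm_le_coefI)
  fix F assume F: "finite F" "F \<subseteq> J"
  have "(\<Sum>j\<in>F. (cmod (cin (R0 z f) (e j)))\<^sup>2)
      = (\<Sum>j\<in>F. (1 / cmod (z - of_int (fst j)))\<^sup>2 * (cmod (cin f (e j)))\<^sup>2)"
    using F assms by (intro sum.cong) (auto simp: R0_coef subset_iff norm_divide power_divide)
  also have "\<dots> \<le> (\<Sum>j\<in>F. s\<^sup>2 * (cmod (cin f (e j)))\<^sup>2)"
    using F assms by (intro sum_mono mult_right_mono power_mono) auto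
  also have "\<dots> = s\<^sup>2 * (\<Sum>j\<in>F. (cmod (cin f (e j)))\<^sup>2)" by (simp add: sum_distrib_left)
  also have "\<dots> \<le> s\<^sup>2 * (norm f)\<^sup>2" using F by (intro mult_left_mono bessel) auto
  finally show "(\<Sum>j\<in>F. (cmod (cin (R0 z f) (e j)))\<^sup>2) \<le> (s * norm f)\<^sup>2"
    by (simp add: power_mult_distrib)
qed (use assms in auto)

lemma T_norm:
  assumes "far z"
  shows "norm (T z f) \<le> sqrt (W * U) * norm f"
proof (rule hilbert_schmidt_bound[OF T_coef])
  fix F K assume F: "finite F" "F \<subseteq> J" and K: "finite K" "K \<subseteq> J"
  let ?u = "\<lambda>k. (1 / cmod (z - of_int (fst k)))\<^sup>2"
  have "(\<Sum>j\<in>F. \<Sum>k\<in>K. (cmod (cin (e k) (h j) / (z - of_int (fst k))))\<^sup>2)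
      \<le> (\<Sum>j\<in>F. \<Sum>k\<in>K. (w (fst j + fst k))\<^sup>2 * ?u k)"
  proof (intro sum_mono)
    fix j k assume "j \<in> F" "k \<in> K"
    then have "(cmod (cin (e k) (h j)))\<^sup>2 \<le> (w (fst j + fst k))\<^sup>2"
      using F K by (intro power_mono h_bound) auto
    then have "(cmod (cin (e k) (h j)))\<^sup>2 * ?u k \<le> (w (fst j + fst k))\<^sup>2 * ?u k"
      by (rule mult_right_mono) simp
    then show "(cmod (cin (e k) (h j) / (z - of_int (fst k))))\<^sup>2 \<le> (w (fst j + fst k))\<^sup>2 * ?u k"
      by (simp add: norm_divide power_divide)
  qed
  \<comment> \<open>For fixed \<open>k\<close> the sum over \<open>j\<close> runs over a shift of
    \<open>w\<close>, which gives \<open>W\<close> uniformly in \<open>k\<close>; the inverse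
    distances are summed afterwards.\<close>
  also have "\<dots> = (\<Sum>k\<in>K. (\<Sum>j\<in>F. (w (fst j + fst k))\<^sup>2) * ?u k)"
    by (subst sum.swap) (simp add: sum_distrib_right)
  also have "\<dots> \<le> (\<Sum>k\<in>K. W * ?u k)"
    using F by (intro sum_mono mult_right_mono W_bound) auto
  also have "\<dots> = W * (\<Sum>k\<in>K. ?u k)" by (simp add: sum_distrib_left)
  also have "\<dots> \<le> W * U" using assms K by (intro mult_left_mono U_bound W_nonneg)
  finally show "(\<Sum>j\<in>F. \<Sum>k\<in>K. (cmod (cin (e k) (h j) / (z - of_int (fst k))))\<^sup>2) \<le> (sqrt (W * U))\<^sup>2"
    using W_nonneg U_nonneg by simp
qed (use assms far_not_in W_nonneg U_nonneg in auto)

text \<open>Every column of the matrix of the perturbation has norm at most \<open>sqrt W\<close>,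
  so the absolute sum of the coefficients of \<open>y\<close> controls its image. The square roots
  of \<open>?a k\<close> in the proof distribute the weight between the two factors of
  Cauchy-Schwarz.\<close>

lemma pert_norm:
  assumes y: "y \<in> D" and s: "\<And>K. finite K \<Longrightarrow> K \<subseteq> J \<Longrightarrow> (\<Sum>k\<in>K. cmod (cin y (e k))) \<le> s"
  shows "norm (L y - L0 y) \<le> sqrt W * s"
proof -
  have s0: "0 \<le> s" using s[of "{}"] by simp
  show ?thesis
  proof (rule norm_le_coefI)
    fix F assume F: "finite F" "F \<subseteq> J"
    have "((\<lambda>K. \<Sum>j\<in>F. (cmod (\<Sum>k\<in>K. cin y (e k) * cin (e k) (h j)))\<^sup>2)
        \<longlongrightarrow> (\<Sum>j\<in>F. (cmod (cin (L y - L0 y) (e j)))\<^sup>2)) (finite_subsets_at_top J)"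
    proof (intro tendsto_sum tendsto_power tendsto_norm)
      fix j assume "j \<in> F"
      then have "cin (L y - L0 y) (e j) = cin y (h j)" using F y by (intro pert_coef) auto
      then show "((\<lambda>K. \<Sum>k\<in>K. cin y (e k) * cin (e k) (h j)) \<longlongrightarrow> cin (L y - L0 y) (e j))
          (finite_subsets_at_top J)"
        using cin_expansion[of y "h j"] unfolding has_sum_def by simp
    qed
    moreover have "\<forall>\<^sub>F K in finite_subsets_at_top J.
        (\<Sum>j\<in>F. (cmod (\<Sum>k\<in>K. cin y (e k) * cin (e k) (h j)))\<^sup>2) \<le> (sqrt W * s)\<^sup>2"
    proof (rule eventually_finite_subsets_at_top_weakI)
      fix K assume K: "finite K" "K \<subseteq> J"
      let ?a = "\<lambda>k. cmod (cin y (e k))"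
      have "(\<Sum>j\<in>F. (cmod (\<Sum>k\<in>K. cin y (e k) * cin (e k) (h j)))\<^sup>2)
          \<le> (\<Sum>j\<in>F. (\<Sum>k\<in>K. sqrt (?a k) * (sqrt (?a k) * w (fst j + fst k)))\<^sup>2)"
      proof (intro sum_mono power_mono)
        fix j assume "j \<in> F"
        have "cmod (\<Sum>k\<in>K. cin y (e k) * cin (e k) (h j)) \<le> (\<Sum>k\<in>K. ?a k * w (fst j + fst k))"
          by (rule order_trans[OF norm_sum])
            (use F K \<open>j \<in> F\<close> in \<open>auto simp: norm_mult intro!: sum_mono mult_left_mono h_bound\<close>)
        then show "cmod (\<Sum>k\<in>K. cin y (e k) * cin (e k) (h j))
            \<le> (\<Sum>k\<in>K. sqrt (?a k) * (sqrt (?a k) * w (fst j + fst k)))"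
          by (simp flip: mult.assoc)
      qed simp
      also have "\<dots> \<le> (\<Sum>j\<in>F. (\<Sum>k\<in>K. (sqrt (?a k))\<^sup>2) * (\<Sum>k\<in>K. (sqrt (?a k) * w (fst j + fst k))\<^sup>2))"
        by (intro sum_mono Cauchy_Schwarz_ineq_sum)
      also have "\<dots> = (\<Sum>k\<in>K. ?a k) * (\<Sum>j\<in>F. \<Sum>k\<in>K. ?a k * (w (fst j + fst k))\<^sup>2)"
        by (simp add: sum_distrib_left power_mult_distrib)
      also have "(\<Sum>j\<in>F. \<Sum>k\<in>K. ?a k * (w (fst j + fst k))\<^sup>2)
          = (\<Sum>k\<in>K. ?a k * (\<Sum>j\<in>F. (w (fst j + fst k))\<^sup>2))"
        by (subst sum.swap) (simp add: sum_distrib_left)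
      also have "(\<Sum>k\<in>K. ?a k) * \<dots> \<le> (\<Sum>k\<in>K. ?a k) * (\<Sum>k\<in>K. ?a k * W)"
        using F by (intro mult_left_mono sum_mono W_bound sum_nonneg) auto
      also have "\<dots> = (\<Sum>k\<in>K. ?a k)\<^sup>2 * W"
        by (subst sum_distrib_right[symmetric]) (simp add: power2_eq_square)
      also have "\<dots> \<le> s\<^sup>2 * W"
        using s[OF K] W_nonneg by (intro mult_right_mono power_mono sum_nonneg) auto
      finally show "(\<Sum>j\<in>F. (cmod (\<Sum>k\<in>K. cin y (e k) * cin (e k) (h j)))\<^sup>2) \<le> (sqrt W * s)\<^sup>2"
        using W_nonneg by (simp add: power_mult_distrib mult.commute)
    qed
    ultimately show "(\<Sum>j\<in>F. (cmod (cin (L y - L0 y) (e j)))\<^sup>2) \<le> (sqrt W * s)\<^sup>2"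
      by (rule tendsto_upperbound) simp
  qed (use s0 W_nonneg in simp)
qed

end

text \<open>Only the square of \<open>S\<close> is a contraction. The fixed point \<open>g\<close>
  of \<open>g = f + S (S g)\<close> satisfies (1 - S)(1 + S) g = f, so \<open>x = g + S g\<close> is
  the solution.\<close>

lemma one_minus_invertible:
  fixes S :: "'a::banach \<Rightarrow> 'a"
  assumes S: "bounded_linear S" and half: "\<And>f. norm (S (S f)) \<le> 1 / 2 * norm f"
  shows "\<exists>x. x - S x = f"
proof -
  interpret bounded_linear S by (rule S)
  have "\<exists>!g. f + S (S g) = g"
  proof (rule banach_fix_type[where c = "1 / 2"])
    show "\<forall>x y. dist (f + S (S x)) (f + S (S y)) \<le> 1 / 2 * dist x y"
    proof (intro allI)
      fix x y
      have "S (S x) - S (S y) = S (S (x - y))" by (simp add: diff)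
      then show "dist (f + S (S x)) (f + S (S y)) \<le> 1 / 2 * dist x y"
        using half[of "x - y"] by (simp add: dist_norm)
    qed
  qed auto
  then obtain g where "f + S (S g) = g" by blast
  then have "(g + S g) - S (g + S g) = f" by (simp add: add algebra_simps)
  then show ?thesis by blast
qed

text \<open>Substituting \<open>x = f + S x\<close> into itself gives
  \<open>x = f + S f + S (S x)\<close>, and the last term is absorbed on the left.\<close>

lemma one_minus_inverse_bound:
  fixes S :: "'a::real_normed_vector \<Rightarrow> 'a"
  assumes S: "bounded_linear S" and half: "norm (S (S x)) \<le> 1 / 2 * norm x"
    and c: "\<And>f. norm (S f) \<le> c * norm f"
  shows "norm x \<le> 2 * (1 + c) * norm (x - S x)"
proof -
  interpret bounded_linear S by (rule S)
  let ?f = "x - S x"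
  have "x = ?f + S ?f + S (S x)" by (simp add: diff)
  then have "norm x \<le> norm ?f + norm (S ?f) + norm (S (S x))"
    by (metis norm_triangle_ineq norm_triangle_le add_mono order_refl)
  also have "\<dots> \<le> norm ?f + c * norm ?f + 1 / 2 * norm x" using half c by (intro add_mono) auto
  finally show ?thesis by (simp add: algebra_simps)
qed

lemma resolvent_apply:
  "z \<in> resolvent_set D L \<Longrightarrow> blinfun_apply (resolvent D L z) = resolvent_map D L z"
  by (simp add: resolvent_def resolvent_set_def bounded_linear_Blinfun_apply)

lemma resolvent_mem:
  assumes "z \<in> resolvent_set D L"
  shows "blinfun_apply (resolvent D L z) f \<in> D"
    and "z *\<^sub>C blinfun_apply (resolvent D L z) f - L (blinfun_apply (resolvent D L z) f) = f"
proof -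
  have b: "bij_betw (\<lambda>u. z *\<^sub>C u - L u) D UNIV" using assms by (simp add: resolvent_set_def)
  then have f: "f \<in> (\<lambda>u. z *\<^sub>C u - L u) ` D" by (simp add: bij_betw_def)
  show "blinfun_apply (resolvent D L z) f \<in> D"
    unfolding resolvent_apply[OF assms] resolvent_map_def by (rule inv_into_into[OF f])
  show "z *\<^sub>C blinfun_apply (resolvent D L z) f - L (blinfun_apply (resolvent D L z) f) = f"
    unfolding resolvent_apply[OF assms] resolvent_map_def using f_inv_into_f[OF f] .
qed

lemma resolvent_left_inverse:
  assumes "z \<in> resolvent_set D L" "u \<in> D"
  shows "blinfun_apply (resolvent D L z) (z *\<^sub>C u - L u) = u"
  using assms unfolding resolvent_apply[OF assms(1)] resolvent_map_def
  by (intro inv_into_f_f) (auto simp: resolvent_set_def bij_betw_def)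

text \<open>Once one distance is at least \<open>X\<close>, its factor is bounded by a constant and
  the other factor remains available for summation. The symmetric sum on the right serves whichever
  of the two distances is large.\<close>

lemma pair_weight_le:
  fixes a b X :: real
  assumes "X > 0" "0 < a" "0 < b" "X \<le> a \<or> X \<le> b"
  shows "(1 / a)\<^sup>2 * (1 / b)\<^sup>2 \<le> ((1 / a)\<^sup>2 + (1 / b)\<^sup>2) / X\<^sup>2"
proof -
  have *: "(1 / a)\<^sup>2 * (1 / b)\<^sup>2 \<le> (1 / b)\<^sup>2 / X\<^sup>2" if "X \<le> a" "0 < a" for a b :: real
  proof -
    have "(1 / a)\<^sup>2 \<le> (1 / X)\<^sup>2" using that \<open>X > 0\<close> by (intro power_mono divide_left_mono) auto
    then have "(1 / a)\<^sup>2 * (1 / b)\<^sup>2 \<le> (1 / X)\<^sup>2 * (1 / b)\<^sup>2" by (rule mult_right_mono) simp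
    then show ?thesis by (simp add: power_divide mult.commute)
  qed
  have pos: "0 \<le> (1 / b)\<^sup>2 / X\<^sup>2" "0 \<le> (1 / a)\<^sup>2 / X\<^sup>2" by simp_all
  from assms(4) show ?thesis
  proof
    assume "X \<le> a"
    from *[OF this assms(2), of b] pos show ?thesis unfolding add_divide_distrib by linarith
  next
    assume "X \<le> b"
    from *[OF this assms(3), of a] pos show ?thesis
      unfolding add_divide_distrib mult.commute[of "(1 / a)\<^sup>2"] by linarith
  qed
qed

lemma card_near_le:
  fixes F :: "(int \<times> bool) set"
  assumes "finite F" "\<And>j. j \<in> F \<Longrightarrow> \<bar>fst j + m\<bar> \<le> int K"
  shows "real (card F) \<le> 2 * (2 * real K + 1)"
proof -
  have "F \<subseteq> {- int K - m..int K - m} \<times> UNIV" using assms(2) by force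
  then have "card F \<le> card ({- int K - m..int K - m} \<times> (UNIV :: bool set))"
    by (intro card_mono) auto
  also have "\<dots> = 2 * (2 * K + 1)" by (simp add: card_cartesian_product nat_add_distrib)
  finally have "real (card F) \<le> real (2 * (2 * K + 1))" by (rule of_nat_mono)
  then show ?thesis by simp
qed

section \<open>Smallness of the square of T and existence of the resolvent\<close>

context perturbed_diagonal
begin

text \<open>Splitting \<open>w\<close> into a finite head and a small tail: on the head \<open>\<bar>j + k\<bar> \<le> K\<close>, one of
  \<open>\<bar>z - j\<bar>\<close>, \<open>\<bar>z - k\<bar>\<close> is at least \<open>\<bar>z\<bar> - K\<close>.\<close>

lemma off_diagonal_small:
  assumes "\<epsilon> > 0"
  obtains N :: nat where "\<And>z K K'. far z \<Longrightarrow> cmod z > real N \<Longrightarrow> finite K \<Longrightarrow> K \<subseteq> J \<Longrightarrow> finite K' \<Longrightarrow> K' \<subseteq> J \<Longrightarrow>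
     (\<Sum>k\<in>K'. (1 / cmod (z - of_int (fst k)))\<^sup>2 *
        (\<Sum>j\<in>K. 1 / cmod (z - of_int (fst j)) * w (fst j + fst k))\<^sup>2) \<le> \<epsilon>"
proof -
  \<comment> \<open>The tail of \<open>w\<close> will contribute at most
    \<open>4 * U * \<delta> * U\<close>, which has to stay below half of
    \<open>\<epsilon>\<close>.\<close>
  define \<delta> where "\<delta> = \<epsilon> / (8 * (U\<^sup>2 + 1))"
  have \<delta>: "\<delta> > 0" using assms by (auto simp: \<delta>_def intro!: divide_pos_pos mult_pos_pos add_nonneg_pos)
  obtain K0 :: nat where K0: "\<And>F. finite F \<Longrightarrow> (\<And>m. m \<in> F \<Longrightarrow> \<bar>m\<bar> > int K0) \<Longrightarrow> (\<Sum>m\<in>F. (w m)\<^sup>2) \<le> \<delta>"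
    using tail_sum_le[OF w_sq _ \<delta>] by auto
  \<comment> \<open>\<open>c\<close> bounds the number of indices in a row of the band
    \<open>\<bar>j + k\<bar> \<le> K0\<close>. \<open>X\<close> makes the share of the band,
    \<open>4 * W * c * U / X\<^sup>2\<close>, at most half of \<open>\<epsilon>\<close>; the summand
    1 keeps \<open>X\<close> positive.\<close>
  define c where "c = 2 * (2 * real K0 + 1)"
  define X where "X = sqrt (8 * W * c * U / \<epsilon> + 1)"
  have c: "c > 0" by (simp add: c_def)
  have X2: "X\<^sup>2 = 8 * W * c * U / \<epsilon> + 1" unfolding X_def
    using W_nonneg U_nonneg c assms by (intro real_sqrt_pow2 add_nonneg_nonneg divide_nonneg_pos mult_nonneg_nonneg) auto
  have X: "X > 0" unfolding X_def
    using W_nonneg U_nonneg c assms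
    by (intro real_sqrt_gt_zero add_nonneg_pos divide_nonneg_pos mult_nonneg_nonneg) auto
  show thesis
  proof
    fix z K K'
    assume z: "far z" "cmod z > real (K0 + nat \<lceil>X\<rceil>)" and K: "finite K" "K \<subseteq> J" and K': "finite K'" "K' \<subseteq> J"
    define u where "u = (\<lambda>k :: int \<times> bool. 1 / cmod (z - of_int (fst k)))"
    have u: "u k \<ge> 0" for k by (simp add: u_def)
    have uU: "(\<Sum>k\<in>F. (u k)\<^sup>2) \<le> U" if "finite F" "F \<subseteq> J" for F
      unfolding u_def by (rule U_bound[OF z(1) that])
    have X_le: "cmod z \<ge> real K0 + X" using z(2) X by (simp add: le_nat_iff) linarith
    define near where "near = (\<lambda>k :: int \<times> bool. {j\<in>K. \<bar>fst j + fst k\<bar> \<le> int K0})"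
    define tail where "tail = (\<lambda>k :: int \<times> bool. {j\<in>K. \<bar>fst j + fst k\<bar> > int K0})"
    have tail_w: "(\<Sum>j\<in>tail k. (w (fst j + fst k))\<^sup>2) \<le> 2 * \<delta>" for k :: "int \<times> bool"
    proof -
      have "(\<Sum>j\<in>tail k. (w (fst j + fst k))\<^sup>2) \<le> 2 * (\<Sum>n\<in>fst ` tail k. (w (n + fst k))\<^sup>2)"
        by (rule sum_fst_le[where g = "\<lambda>n. (w (n + fst k))\<^sup>2"]) (use K in \<open>auto simp: tail_def\<close>)
      also have "(\<Sum>n\<in>fst ` tail k. (w (n + fst k))\<^sup>2) = (\<Sum>m\<in>(\<lambda>n. n + fst k) ` fst ` tail k. (w m)\<^sup>2)"
        by (subst sum.reindex) (auto simp: inj_on_def)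
      also have "\<dots> \<le> \<delta>" by (rule K0) (use K in \<open>auto simp: tail_def\<close>)
      finally show ?thesis by simp
    qed
    have split: "(\<Sum>j\<in>K. u j * w (fst j + fst k))\<^sup>2 \<le> 2 * W * (\<Sum>j\<in>near k. (u j)\<^sup>2) + 4 * U * \<delta>"
      for k :: "int \<times> bool"
    proof -
      let ?s = "\<lambda>A. \<Sum>j\<in>A. u j * w (fst j + fst k)"
      have K_eq: "K = near k \<union> tail k" by (auto simp: near_def tail_def)
      have "?s (near k \<union> tail k) = ?s (near k) + ?s (tail k)"
        by (rule sum.union_disjoint) (use K in \<open>auto simp: near_def tail_def\<close>)
      then have "?s K = ?s (near k) + ?s (tail k)" by (simp only: flip: K_eq)
      then have "(?s K)\<^sup>2 \<le> 2 * (?s (near k))\<^sup>2 + 2 * (?s (tail k))\<^sup>2"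
        using sum_squares_bound[of "?s (near k)" "?s (tail k)"] by (simp add: power2_sum)
      moreover have "(?s (near k))\<^sup>2 \<le> (\<Sum>j\<in>near k. (u j)\<^sup>2) * W"
        by (rule order_trans[OF Cauchy_Schwarz_ineq_sum])
          (use K in \<open>auto intro!: mult_left_mono W_bound sum_nonneg simp: near_def\<close>)
      moreover have "(?s (tail k))\<^sup>2 \<le> U * (2 * \<delta>)"
        by (rule order_trans[OF Cauchy_Schwarz_ineq_sum])
          (use K tail_w[of k] \<delta> U_nonneg in \<open>auto intro!: mult_mono uU sum_nonneg simp: tail_def\<close>)
      ultimately show ?thesis by (simp add: algebra_simps)
    qed
    have pos: "0 < cmod (z - of_int (fst j))" if "j \<in> J" for j
      using far_not_in[OF z(1)] that by auto
    have pair: "(u k)\<^sup>2 * (u j)\<^sup>2 \<le> ((u k)\<^sup>2 + (u j)\<^sup>2) / X\<^sup>2" if "k \<in> K'" "j \<in> near k" for j k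
      unfolding u_def
    proof (rule pair_weight_le[OF X])
      show "0 < cmod (z - of_int (fst k))" "0 < cmod (z - of_int (fst j))"
        using that K K' pos by (auto simp only: near_def)
      \<comment> \<open>Both distances below \<open>X\<close> would force
        \<open>2 * cmod z < 2 * X + K0\<close>, against \<open>cmod z \<ge> K0 + X\<close>.\<close>
      have "2 * cmod z = cmod ((z - of_int (fst k)) + (z - of_int (fst j)) + of_int (fst j + fst k))"
      proof -
        have "(z - of_int (fst k)) + (z - of_int (fst j)) + of_int (fst j + fst k) = 2 * z" by simp
        then show ?thesis by (simp only: norm_mult) simp
      qed
      also have "\<dots> \<le> cmod (z - of_int (fst k)) + cmod (z - of_int (fst j)) + cmod (of_int (fst j + fst k))"
        by (intro order_trans[OF norm_triangle_ineq] add_mono norm_triangle_ineq order_refl)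
      also have "cmod (of_int (fst j + fst k)) \<le> real K0" 
      proof -
        have "\<bar>fst j + fst k\<bar> \<le> int K0" using that by (simp add: near_def)
        then have "real_of_int \<bar>fst j + fst k\<bar> \<le> real K0" by linarith
        then show ?thesis by (simp only: norm_of_int of_int_abs)
      qed
      finally show "X \<le> cmod (z - of_int (fst k)) \<or> X \<le> cmod (z - of_int (fst j))"
        using X_le by linarith
    qed
    have "(\<Sum>k\<in>K'. (u k)\<^sup>2 * (\<Sum>j\<in>K. u j * w (fst j + fst k))\<^sup>2)
        \<le> (\<Sum>k\<in>K'. (u k)\<^sup>2 * (2 * W * (\<Sum>j\<in>near k. (u j)\<^sup>2) + 4 * U * \<delta>))"
      by (intro sum_mono mult_left_mono split) auto
    also have "\<dots> = 2 * W * (\<Sum>k\<in>K'. \<Sum>j\<in>near k. (u k)\<^sup>2 * (u j)\<^sup>2) + 4 * U * \<delta> * (\<Sum>k\<in>K'. (u k)\<^sup>2)"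
      by (simp add: distrib_left sum.distrib sum_distrib_left mult_ac)
    also have "\<dots> \<le> 2 * W * (2 * c * U / X\<^sup>2) + 4 * U * \<delta> * U"
    proof (intro add_mono mult_left_mono)
      have "(\<Sum>k\<in>K'. \<Sum>j\<in>near k. (u k)\<^sup>2 * (u j)\<^sup>2) \<le> (\<Sum>k\<in>K'. \<Sum>j\<in>near k. ((u k)\<^sup>2 + (u j)\<^sup>2) / X\<^sup>2)"
        by (intro sum_mono pair)
      also have "\<dots> = ((\<Sum>k\<in>K'. real (card (near k)) * (u k)\<^sup>2) + (\<Sum>k\<in>K'. \<Sum>j\<in>near k. (u j)\<^sup>2)) / X\<^sup>2"
        by (simp add: sum.distrib flip: sum_divide_distrib)
      \<comment> \<open>The half of the sum that is weighted by \<open>u j\<close> is counted by the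
        other index; the band condition is symmetric.\<close>
      also have "(\<Sum>k\<in>K'. \<Sum>j\<in>near k. (u j)\<^sup>2) = (\<Sum>j\<in>K. \<Sum>k\<in>{k\<in>K'. \<bar>fst j + fst k\<bar> \<le> int K0}. (u j)\<^sup>2)"
        unfolding near_def by (rule sum.swap_restrict) (use K K' in auto)
      also have "\<dots> = (\<Sum>j\<in>K. real (card {k\<in>K'. \<bar>fst j + fst k\<bar> \<le> int K0}) * (u j)\<^sup>2)" by simp
      also have "((\<Sum>k\<in>K'. real (card (near k)) * (u k)\<^sup>2) + \<dots>) / X\<^sup>2
          \<le> ((\<Sum>k\<in>K'. c * (u k)\<^sup>2) + (\<Sum>j\<in>K. c * (u j)\<^sup>2)) / X\<^sup>2"
      proof (intro divide_right_mono add_mono sum_mono mult_right_mono)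
        fix k show "real (card (near k)) \<le> c" unfolding c_def near_def
          by (rule card_near_le[where m = "fst k"]) (use K in auto)
        show "real (card {j\<in>K'. \<bar>fst k + fst j\<bar> \<le> int K0}) \<le> c" unfolding c_def
          by (rule card_near_le[where m = "fst k"]) (use K' in \<open>auto simp: add.commute\<close>)
      qed auto
      also have "\<dots> = c * ((\<Sum>k\<in>K'. (u k)\<^sup>2) + (\<Sum>j\<in>K. (u j)\<^sup>2)) / X\<^sup>2"
        by (simp add: distrib_left sum_distrib_left)
      also have "\<dots> \<le> c * (U + U) / X\<^sup>2"
        using K K' c by (intro divide_right_mono mult_left_mono add_mono uU) auto
      finally show "(\<Sum>k\<in>K'. \<Sum>j\<in>near k. (u k)\<^sup>2 * (u j)\<^sup>2) \<le> 2 * c * U / X\<^sup>2" by (simp add: mult_ac)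
      show "(\<Sum>k\<in>K'. (u k)\<^sup>2) \<le> U" by (rule uU[OF K'])
    qed (use W_nonneg U_nonneg \<delta> in auto)
    also have "2 * W * (2 * c * U / X\<^sup>2) \<le> \<epsilon> / 2"
    proof -
      have "8 * W * c * U / \<epsilon> \<le> X\<^sup>2" using X2 by simp
      then have "8 * W * c * U \<le> \<epsilon> * X\<^sup>2" using assms by (simp add: field_simps)
      then show ?thesis using X by (simp add: field_simps)
    qed
    also have "4 * U * \<delta> * U \<le> \<epsilon> / 2"
    proof -
      have p: "U\<^sup>2 + 1 > 0" by (intro add_nonneg_pos) auto
      have "\<epsilon> * U\<^sup>2 \<le> \<epsilon> * (U\<^sup>2 + 1)" using assms by simp
      then show ?thesis using p by (simp add: \<delta>_def field_simps power2_eq_square)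
    qed
    finally show "(\<Sum>k\<in>K'. (1 / cmod (z - of_int (fst k)))\<^sup>2 *
        (\<Sum>j\<in>K. 1 / cmod (z - of_int (fst j)) * w (fst j + fst k))\<^sup>2) \<le> \<epsilon>"
      by (simp add: u_def)
  qed
qed

text \<open>\<open>T z (T z f)\<close> is the perturbation applied to \<open>R0 z (T z f)\<close>,
  and \<open>pert_norm\<close> asks for the absolute sum of the coefficients of that vector. Summing
  over \<open>j\<close> before \<open>k\<close> and applying Cauchy-Schwarz in \<open>k\<close>
  produces the double sum in the hypothesis.\<close>

lemma T_square_norm:
  assumes z: "far z" and "\<epsilon> \<ge> 0"
    and small: "\<And>K K'. finite K \<Longrightarrow> K \<subseteq> J \<Longrightarrow> finite K' \<Longrightarrow> K' \<subseteq> J \<Longrightarrow>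
     (\<Sum>k\<in>K'. (1 / cmod (z - of_int (fst k)))\<^sup>2 *
        (\<Sum>j\<in>K. 1 / cmod (z - of_int (fst j)) * w (fst j + fst k))\<^sup>2) \<le> \<epsilon>"
  shows "norm (T z (T z f)) \<le> sqrt W * (sqrt \<epsilon> * norm f)"
  unfolding T_def[of z "T z f"]
proof (rule pert_norm)
  show "R0 z (T z f) \<in> D" by (rule R0(1)[OF far_not_in[OF z]])
next
  fix K assume K: "finite K" "K \<subseteq> J"
  let ?u = "\<lambda>k :: int \<times> bool. 1 / cmod (z - of_int (fst k))"
  let ?m = "\<lambda>j k. cin (e k) (h j) / (z - of_int (fst k))"
  have "((\<lambda>K'. \<Sum>j\<in>K. ?u j * cmod (\<Sum>k\<in>K'. ?m j k * cin f (e k))) \<longlongrightarrow> (\<Sum>j\<in>K. ?u j * cmod (cin (T z f) (e j))))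
      (finite_subsets_at_top J)"
  proof (intro tendsto_sum tendsto_mult_left tendsto_norm)
    fix j assume "j \<in> K"
    with K T_coef[OF far_not_in[OF z], of j f]
    show "((\<lambda>K'. \<Sum>k\<in>K'. ?m j k * cin f (e k)) \<longlongrightarrow> cin (T z f) (e j)) (finite_subsets_at_top J)"
      unfolding has_sum_def by blast
  qed
  moreover have "\<forall>\<^sub>F K' in finite_subsets_at_top J.
      (\<Sum>j\<in>K. ?u j * cmod (\<Sum>k\<in>K'. ?m j k * cin f (e k))) \<le> sqrt \<epsilon> * norm f"
  proof (rule eventually_finite_subsets_at_top_weakI)
    fix K' assume K': "finite K'" "K' \<subseteq> J"
    let ?r = "\<lambda>k. ?u k * (\<Sum>j\<in>K. ?u j * w (fst j + fst k))"
    have "(\<Sum>j\<in>K. ?u j * cmod (\<Sum>k\<in>K'. ?m j k * cin f (e k)))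
        \<le> (\<Sum>j\<in>K. ?u j * (\<Sum>k\<in>K'. w (fst j + fst k) * ?u k * cmod (cin f (e k))))"
    proof (intro sum_mono mult_left_mono)
      fix j assume j: "j \<in> K"
      show "cmod (\<Sum>k\<in>K'. ?m j k * cin f (e k)) \<le> (\<Sum>k\<in>K'. w (fst j + fst k) * ?u k * cmod (cin f (e k)))"
      proof (rule order_trans[OF norm_sum], rule sum_mono)
        fix k assume k: "k \<in> K'"
        have "cmod (cin (e k) (h j)) * ?u k \<le> w (fst j + fst k) * ?u k"
          using j k K K' by (intro mult_right_mono h_bound) auto
        then have "cmod (cin (e k) (h j)) * ?u k * cmod (cin f (e k)) \<le> w (fst j + fst k) * ?u k * cmod (cin f (e k))"
          by (rule mult_right_mono) simp
        then show "cmod (?m j k * cin f (e k)) \<le> w (fst j + fst k) * ?u k * cmod (cin f (e k))"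
          by (simp add: norm_mult norm_divide)
      qed
    qed simp
    also have "\<dots> = (\<Sum>k\<in>K'. \<Sum>j\<in>K. ?u j * (w (fst j + fst k) * ?u k * cmod (cin f (e k))))"
      by (subst sum.swap) (simp add: sum_distrib_left)
    also have "\<dots> = (\<Sum>k\<in>K'. ?r k * cmod (cin f (e k)))"
      by (simp add: sum_distrib_left sum_distrib_right mult_ac)
    also have "\<dots> \<le> sqrt \<epsilon> * norm f"
    proof (rule power2_le_imp_le)
      have "(\<Sum>k\<in>K'. ?r k * cmod (cin f (e k)))\<^sup>2 \<le> (\<Sum>k\<in>K'. (?r k)\<^sup>2) * (\<Sum>k\<in>K'. (cmod (cin f (e k)))\<^sup>2)"
        by (rule Cauchy_Schwarz_ineq_sum)
      also have "\<dots> \<le> \<epsilon> * (norm f)\<^sup>2"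
        using small[OF K K'] \<open>\<epsilon> \<ge> 0\<close> bessel[OF K', of f]
        by (intro mult_mono) (simp_all only: power_mult_distrib, auto intro!: sum_nonneg)
      finally show "(\<Sum>k\<in>K'. ?r k * cmod (cin f (e k)))\<^sup>2 \<le> (sqrt \<epsilon> * norm f)\<^sup>2"
        using \<open>\<epsilon> \<ge> 0\<close> by (simp add: power_mult_distrib)
    qed (use \<open>\<epsilon> \<ge> 0\<close> in simp)
    finally show "(\<Sum>j\<in>K. ?u j * cmod (\<Sum>k\<in>K'. ?m j k * cin f (e k))) \<le> sqrt \<epsilon> * norm f" .
  qed
  ultimately have "(\<Sum>j\<in>K. ?u j * cmod (cin (T z f) (e j))) \<le> sqrt \<epsilon> * norm f"
    by (rule tendsto_upperbound) simp
  also have "(\<Sum>j\<in>K. ?u j * cmod (cin (T z f) (e j))) = (\<Sum>j\<in>K. cmod (cin (R0 z (T z f)) (e j)))"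
    by (intro sum.cong refl, subst R0_coef[OF far_not_in[OF z]]) (use K in \<open>auto simp: norm_divide\<close>)
  finally show "(\<Sum>j\<in>K. cmod (cin (R0 z (T z f)) (e j))) \<le> sqrt \<epsilon> * norm f" .
qed

lemma T_square_half: "\<exists>N::nat. \<forall>z f. far z \<and> cmod z > real N \<longrightarrow> norm (T z (T z f)) \<le> 1 / 2 * norm f"
proof -
  \<comment> \<open>Chosen so that \<open>sqrt W * sqrt \<epsilon> \<le> 1 / 2\<close>; the summand
    1 covers \<open>W = 0\<close>.\<close>
  define \<epsilon> where "\<epsilon> = 1 / (4 * (W + 1))"
  have \<epsilon>: "\<epsilon> > 0" using W_nonneg by (simp add: \<epsilon>_def)
  have "W * \<epsilon> \<le> (1 / 2)\<^sup>2" using W_nonneg by (simp add: \<epsilon>_def field_simps power2_eq_square)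
  then have half: "sqrt W * sqrt \<epsilon> \<le> 1 / 2" by (metis real_le_lsqrt real_sqrt_mult real_sqrt_le_iff real_sqrt_unique zero_le_divide_1_iff zero_le_numeral)
  obtain N :: nat where N: "\<And>z K K'. far z \<Longrightarrow> cmod z > real N \<Longrightarrow> finite K \<Longrightarrow> K \<subseteq> J \<Longrightarrow> finite K' \<Longrightarrow> K' \<subseteq> J \<Longrightarrow>
     (\<Sum>k\<in>K'. (1 / cmod (z - of_int (fst k)))\<^sup>2 *
        (\<Sum>j\<in>K. 1 / cmod (z - of_int (fst j)) * w (fst j + fst k))\<^sup>2) \<le> \<epsilon>"
    by (rule off_diagonal_small[OF \<epsilon>]) blast
  have "norm (T z (T z f)) \<le> 1 / 2 * norm f" if "far z" "cmod z > real N" for z f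
  proof -
    have "norm (T z (T z f)) \<le> sqrt W * (sqrt \<epsilon> * norm f)"
      using that \<epsilon> by (intro T_square_norm N) auto
    also have "\<dots> \<le> 1 / 2 * norm f" using mult_right_mono[OF half, of "norm f"] by (simp add: mult.assoc)
    finally show ?thesis .
  qed
  then show ?thesis by blast
qed

definition N0 :: nat where
  "N0 = (SOME N. \<forall>z f. far z \<and> cmod z > real N \<longrightarrow> norm (T z (T z f)) \<le> 1 / 2 * norm f)"

lemma T_square_le: "far z \<Longrightarrow> cmod z > real N0 \<Longrightarrow> norm (T z (T z f)) \<le> 1 / 2 * norm f"
  using someI_ex[OF T_square_half] unfolding N0_def by blast

text \<open>The bound of \<open>one_minus_inverse_bound\<close> for the inverse of 1 - T, uniform
  over all far \<open>z\<close> with \<open>cmod z > real N0\<close>.\<close>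

definition C :: real where "C = 2 * (1 + sqrt (W * U))"

lemma C_pos: "C > 0" using W_nonneg U_nonneg by (simp add: C_def add_pos_nonneg)

lemma bounded_linear_T:
  assumes "far z"
  shows "bounded_linear (T z)"
proof (rule bounded_linear_intro)
  show "T z (r *\<^sub>R x) = r *\<^sub>R T z x" for r x
    using T_scaleC[OF far_not_in[OF assms], of "of_real r" x] by (simp add: scaleC_of_real)
  show "norm (T z x) \<le> norm x * sqrt (W * U)" for x
    using T_norm[OF assms, of x] by (simp only: mult.commute)
qed (rule T_add[OF far_not_in[OF assms]])

abbreviation R :: "complex \<Rightarrow> 'a \<Rightarrow>\<^sub>L 'a" where "R \<equiv> resolvent D L"

text \<open>On \<open>D\<close> the operator z - L factors as (1 - T z)(z - L0). The second claim
  keeps the intermediate vector \<open>x\<close> explicit; later estimates use its norm and its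
  equation in place of an operator inverse.\<close>

lemma resolvent_R0:
  assumes z: "far z" "cmod z > real N0"
  shows "z \<in> resolvent_set D L"
    and "\<exists>x. R z f = R0 z x \<and> x - T z x = f \<and> norm x \<le> C * norm f"
proof -
  note zG = far_not_in[OF z(1)]
  have T: "bounded_linear (T z)" by (rule bounded_linear_T[OF z(1)])
  note half = T_square_le[OF z]
  have bound: "norm x \<le> C * norm (x - T z x)" for x
    unfolding C_def by (rule one_minus_inverse_bound[OF T half T_norm[OF z(1)]])
  have val: "z *\<^sub>C R0 z x - L (R0 z x) = x - T z x" for x
    using R0(2)[OF zG, of x] by (simp add: T_def algebra_simps)
  have surj: "\<exists>x. x - T z x = f \<and> norm x \<le> C * norm f" for f
    using one_minus_invertible[OF T half] bound by metis
  have inj: "inj_on (\<lambda>u. z *\<^sub>C u - L u) D"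
  proof (rule inj_onI)
    fix u v assume uv: "u \<in> D" "v \<in> D" "z *\<^sub>C u - L u = z *\<^sub>C v - L v"
    \<comment> \<open>The difference is written with the scalar -1 because the locale closes
      \<open>D\<close> under sums and complex multiples.\<close>
    define y where "y = u + (- 1) *\<^sub>C v"
    have y: "y \<in> D" using uv by (simp add: y_def D_add D_scaleC)
    have "L y = L u - L v"
      unfolding y_def using uv by (simp only: L_add L_scaleC D_scaleC) (simp add: scaleC_minus_one)
    moreover have "z *\<^sub>C y = z *\<^sub>C u - z *\<^sub>C v"
      by (simp add: y_def scaleC_minus_one scaleC_diff_right)
    ultimately have "z *\<^sub>C y - L y = (z *\<^sub>C u - L u) - (z *\<^sub>C v - L v)" by simp
    then have "z *\<^sub>C y - L y = 0" using uv(3) by simp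
    moreover define x where "x = z *\<^sub>C y - L0 y"
    moreover have "R0 z x = y" unfolding x_def by (rule R0_unique[OF zG y])
    ultimately have "x - T z x = 0" using val[of x] by simp
    then have "x = 0" using bound[of x] by simp
    then have "R0 z x = 0" using zG R0_scaleC[of z 0 x] by simp
    then have "y = 0" using \<open>R0 z x = y\<close> by simp
    then show "u = v" by (simp add: y_def scaleC_minus_one)
  qed
  have img: "(\<lambda>u. z *\<^sub>C u - L u) ` D = UNIV"
  proof -
    have "f \<in> (\<lambda>u. z *\<^sub>C u - L u) ` D" for f
    proof -
      obtain x where "x - T z x = f" using surj by blast
      then have "f = z *\<^sub>C R0 z x - L (R0 z x)" by (simp add: val)
      then show ?thesis using R0(1)[OF zG] by blast
    qed
    then show ?thesis by blast
  qed
  have map_eq: "resolvent_map D L z (x - T z x) = R0 z x" for x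
    unfolding resolvent_map_def val[symmetric] by (rule inv_into_f_f[OF inj R0(1)[OF zG]])
  have R0n: "norm (R0 z x) \<le> 8 * norm x" for x
  proof (rule R0_norm[OF zG])
    fix n assume "n \<in> G"
    then have "1 / 8 \<le> cmod (z - of_int n)" using z by (auto simp: far_def)
    then show "1 / cmod (z - of_int n) \<le> 8" by (simp add: field_simps divide_le_eq)
  qed simp
  have bl: "bounded_linear (resolvent_map D L z)"
  proof (rule bounded_linear_intro[where K = "8 * C"])
    fix f g and r :: real
    obtain x where x: "x - T z x = f" "norm x \<le> C * norm f" using surj by blast
    obtain y where y: "y - T z y = g" using surj by blast
    have "T z (x + y) = T z x + T z y" using zG by (rule T_add)
    then have "f + g = (x + y) - T z (x + y)" by (simp add: x(1)[symmetric] y[symmetric])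
    then show "resolvent_map D L z (f + g) = resolvent_map D L z f + resolvent_map D L z g"
      using map_eq x y zG by (metis R0_add)
    have "r *\<^sub>R f = (of_real r *\<^sub>C x) - T z (of_real r *\<^sub>C x)"
      using x zG by (simp add: T_scaleC flip: scaleC_of_real scaleC_diff_right)
    then show "resolvent_map D L z (r *\<^sub>R f) = r *\<^sub>R resolvent_map D L z f"
      using map_eq x zG by (metis R0_scaleC scaleC_of_real)
    have "norm (resolvent_map D L z f) = norm (R0 z x)" using map_eq[of x] x by simp
    also have "\<dots> \<le> 8 * (C * norm f)" using R0n[of x] x(2) by linarith
    finally show "norm (resolvent_map D L z f) \<le> norm f * (8 * C)" by (simp add: mult_ac)
  qed
  show mem: "z \<in> resolvent_set D L"
    using inj img bl by (simp add: resolvent_set_def bij_betw_def)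
  show "\<exists>x. R z f = R0 z x \<and> x - T z x = f \<and> norm x \<le> C * norm f"
    using surj[of f] map_eq by (metis resolvent_apply[OF mem])
qed

end

section \<open>Contour integrals around holes on the real axis\<close>

text \<open>Pushing a loop upwards contracts it inside a half plane.\<close>


lemma simply_connected_upward_closed:
  fixes S :: "complex set" and \<sigma> h :: real
  assumes up: "\<And>z s. z \<in> S \<Longrightarrow> 0 \<le> s \<Longrightarrow> z + of_real (\<sigma> * s) * \<i> \<in> S"
    and half: "\<And>z. \<sigma> * Im z > h \<Longrightarrow> z \<in> S" and \<sigma>: "\<bar>\<sigma>\<bar> = 1"
  shows "simply_connected S"
  unfolding simply_connected_eq_contractible_loop_some
proof (intro conjI allI impI)
  define H where "H = {z. \<sigma> * Im z > h}"
  have HS: "H \<subseteq> S" using half by (auto simp: H_def)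
  have "convex H"
  proof -
    have "H = {z. (of_real \<sigma> * \<i>) \<bullet> z > h}" by (simp add: H_def inner_complex_def)
    then show ?thesis by (simp add: convex_halfspace_gt)
  qed
  have \<sigma>2: "\<sigma> * \<sigma> = 1" using \<sigma> by (metis abs_mult_self_eq mult_1)
  have seg: "z + of_real (\<sigma> * s) * \<i> \<in> H" if "s > h - \<sigma> * Im z" for z s
  proof -
    have "\<sigma> * (Im z + \<sigma> * s) = \<sigma> * Im z + (\<sigma> * \<sigma>) * s" by (simp only: distrib_left mult.assoc)
    then show ?thesis using that \<sigma>2 by (simp add: H_def)
  qed
  show pc: "path_connected S"
    unfolding path_connected_component
  proof (intro ballI)
    fix x y assume xy: "x \<in> S" "y \<in> S"
    define s where "s = max 0 (max (h - \<sigma> * Im x) (h - \<sigma> * Im y) + 1)"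
    have s: "s \<ge> 0" "s > h - \<sigma> * Im x" "s > h - \<sigma> * Im y" by (auto simp: s_def)
    have vert: "path_component S z (z + of_real (\<sigma> * s) * \<i>)" if "z \<in> S" for z
    proof (rule path_component_of_subset)
      show "closed_segment z (z + of_real (\<sigma> * s) * \<i>) \<subseteq> S"
      proof
        fix x assume "x \<in> closed_segment z (z + of_real (\<sigma> * s) * \<i>)"
        then obtain u where u: "0 \<le> u" "x = (1 - u) *\<^sub>R z + u *\<^sub>R (z + of_real (\<sigma> * s) * \<i>)"
          by (auto simp: closed_segment_def)
        then have "x = z + of_real (\<sigma> * (u * s)) * \<i>"
          by (simp add: scaleR_conv_of_real algebra_simps)
        then show "x \<in> S" using up[OF that, of "u * s"] u s by simp
      qed
      show "path_component (closed_segment z (z + of_real (\<sigma> * s) * \<i>)) z (z + of_real (\<sigma> * s) * \<i>)"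
        using convex_imp_path_connected[OF convex_closed_segment, of z "z + of_real (\<sigma> * s) * \<i>"]
        unfolding path_connected_component by auto
    qed
    have "path_component H (x + of_real (\<sigma> * s) * \<i>) (y + of_real (\<sigma> * s) * \<i>)"
      using convex_imp_path_connected[OF \<open>convex H\<close>] seg s unfolding path_connected_component by blast
    then have "path_component S (x + of_real (\<sigma> * s) * \<i>) (y + of_real (\<sigma> * s) * \<i>)"
      by (rule path_component_of_subset[OF HS])
    then show "path_component S x y"
      using vert xy by (meson path_component_sym path_component_trans)
  qed
  fix p assume p: "path p \<and> path_image p \<subseteq> S \<and> pathfinish p = pathstart p"
  have "bounded (path_image p)" using p by (simp add: bounded_path_image)
  then obtain M where M: "\<And>z. z \<in> path_image p \<Longrightarrow> cmod z \<le> M" unfolding bounded_iff by blast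
  \<comment> \<open>High enough to lift the whole loop into the half plane \<open>H\<close>.\<close>
  define s where "s = \<bar>h\<bar> + \<bar>M\<bar> + 1"
  have s: "s > h - \<sigma> * Im z" if "z \<in> path_image p" for z
  proof -
    have "\<bar>\<sigma> * Im z\<bar> \<le> M" using abs_Im_le_cmod[of z] M[OF that] \<sigma> by (simp add: abs_mult)
    then show ?thesis by (simp add: s_def)
  qed
  define q where "q = (\<lambda>t. p t + of_real (\<sigma> * s) * \<i>)"
  have cp: "continuous_on {0..1} p" using p by (simp add: path_def)
  have pq: "path q" unfolding q_def path_def by (intro continuous_intros cp)
  have ploop: "p 0 = p 1" using p by (simp add: pathstart_def pathfinish_def)
  have qH: "path_image q \<subseteq> H" using seg s by (auto simp: path_image_def q_def)
  have "homotopic_loops S p q"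
  proof (rule homotopic_loops_linear)
    show "path p" "path q" "pathfinish p = pathstart p" "pathfinish q = pathstart q"
      using p pq ploop by (auto simp: q_def pathstart_def pathfinish_def)
    fix t :: real assume t: "t \<in> {0..1}"
    show "closed_segment (p t) (q t) \<subseteq> S"
    proof
      fix x assume "x \<in> closed_segment (p t) (q t)"
      then obtain u where u: "0 \<le> u" "x = (1 - u) *\<^sub>R p t + u *\<^sub>R q t" by (auto simp: closed_segment_def)
      then have "x = p t + of_real (\<sigma> * (u * s)) * \<i>"
        by (simp add: q_def scaleR_conv_of_real algebra_simps)
      moreover have "p t \<in> S" using p t by (auto simp: path_image_def)
      moreover have "s \<ge> 0" by (simp add: s_def)
      ultimately show "x \<in> S" using up[of "p t" "u * s"] u by simp
    qed
  qed
  moreover have "homotopic_loops H q (linepath (pathstart q) (pathstart q))"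
    using convex_imp_simply_connected[OF \<open>convex H\<close>] pq qH ploop
    unfolding simply_connected_eq_contractible_loop_any
    by (metis (no_types, lifting) path_image_def pathfinish_def pathstart_def pathstart_in_path_image q_def subsetD)
  ultimately show "\<exists>a. a \<in> S \<and> homotopic_loops S p (linepath a a)"
    using HS by (meson homotopic_loops_subset homotopic_loops_trans pathstart_in_path_image qH subsetD)
qed

text \<open>A strict bound on \<open>infdist\<close> makes the region open by continuity. By
  convention \<open>infdist\<close> to the empty set is 0, so for \<open>G = {}\<close> the region
  is empty whatever \<open>N\<close> is; hence the assumption \<open>G \<noteq> {}\<close>
  below.\<close>

definition perforated :: "int set \<Rightarrow> real \<Rightarrow> complex set" where
  "perforated G N = {z. N < cmod z \<and> 1 / 8 < infdist z (of_int ` G)}"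

lemma open_perforated: "open (perforated G N)"
proof -
  have "perforated G N = {z. N < cmod z} \<inter> {z. 1 / 8 < infdist z (of_int ` G)}"
    by (auto simp: perforated_def)
  then show ?thesis
    by (auto intro!: open_Int open_Collect_less continuous_intros)
qed

lemma perforated_dist: "z \<in> perforated G N \<Longrightarrow> n \<in> G \<Longrightarrow> 1 / 8 < cmod (z - of_int n)"
  using infdist_le[of "of_int n" "of_int ` G" z] by (auto simp: perforated_def dist_norm)

lemma perforatedI:
  assumes "G \<noteq> {}" "N < cmod z" "r > 1 / 8" "\<And>n. n \<in> G \<Longrightarrow> r \<le> cmod (z - of_int n)"
  shows "z \<in> perforated G N"
proof -
  have "r \<le> infdist z (of_int ` G)"
    unfolding infdist_def using assms by (auto intro!: cINF_greatest simp: dist_norm)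
  then show ?thesis using assms by (simp add: perforated_def)
qed

lemma cmod_add_imag_ge:
  assumes "\<sigma> * Im z \<ge> 0" "s \<ge> 0"
  shows "cmod (z - of_real c) \<le> cmod (z + of_real (\<sigma> * s) * \<i> - of_real c)"
proof -
  have "2 * (\<sigma> * Im z) * s \<ge> 0" using assms by simp
  then have "(Im z)\<^sup>2 \<le> (Im z + \<sigma> * s)\<^sup>2" by (simp add: power2_sum)
  then show ?thesis by (simp add: cmod_def)
qed

text \<open>All holes and the excluded disc are centred on the real axis, so moving away from the
  axis does not decrease any distance concerned.\<close>

lemma perforated_up:
  assumes "z \<in> perforated G N" "\<sigma> * Im z \<ge> 0" "s \<ge> 0"
  shows "z + of_real (\<sigma> * s) * \<i> \<in> perforated G N"
proof (cases "G = {}")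
  case True
  then show ?thesis using assms by (simp add: perforated_def infdist_def)
next
  case False
  have "infdist z (of_int ` G) \<le> cmod (z + of_real (\<sigma> * s) * \<i> - of_int n)" if "n \<in> G" for n
    using infdist_le[of "of_int n" "of_int ` G" z] that
      cmod_add_imag_ge[OF assms(2,3), of "of_int n"] by (simp add: dist_norm)
  then have "infdist z (of_int ` G) \<le> infdist (z + of_real (\<sigma> * s) * \<i>) (of_int ` G)"
    unfolding infdist_def[of "z + _"] using False by (auto intro!: cINF_greatest simp: dist_norm)
  moreover have "cmod z \<le> cmod (z + of_real (\<sigma> * s) * \<i>)"
    using cmod_add_imag_ge[OF assms(2,3), of 0] by simp
  ultimately show ?thesis using assms(1) by (simp add: perforated_def)
qed

text \<open>The domain of the primitive is one open half of the region together with the full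
  vertical lines through the real points of the gaps. These lines belong to the domains for both
  signs of \<open>\<sigma>\<close>, so the two primitives can be compared on the gaps.\<close>

lemma primitive_above:
  assumes hol: "\<phi> holomorphic_on perforated G N" and "G \<noteq> {}" "N \<ge> 0" and \<sigma>: "\<bar>\<sigma>\<bar> = 1"
  shows "\<exists>g. \<forall>z. z \<in> perforated G N \<and> \<sigma> * Im z > 0 \<or> of_real (Re z) \<in> perforated G N
             \<longrightarrow> (g has_field_derivative \<phi> z) (at z)"
proof -
  define S where "S = (perforated G N \<inter> {z. \<sigma> * Im z > 0}) \<union> {z. of_real (Re z) \<in> perforated G N}"
  have "open {z. complex_of_real (Re z) \<in> perforated G N}"
    using open_vimage[OF open_perforated[of G N], of "\<lambda>z. complex_of_real (Re z)"]
    by (simp add: vimage_def continuous_on_of_real continuous_on_Re continuous_on_id)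
  then have "open S" unfolding S_def
    by (auto intro!: open_Un open_Int open_perforated open_Collect_less continuous_intros)
  have vert: "z \<in> perforated G N" if "of_real (Re z) \<in> perforated G N" for z
  proof -
    define \<tau> where "\<tau> = (if Im z \<ge> 0 then 1 else - 1 :: real)"
    have "of_real (Re z) + of_real (\<tau> * \<bar>Im z\<bar>) * \<i> \<in> perforated G N"
      using that by (intro perforated_up) auto
    also have "of_real (Re z) + of_real (\<tau> * \<bar>Im z\<bar>) * \<i> = z" by (simp add: \<tau>_def complex_eq_iff)
    finally show ?thesis .
  qed
  have \<sigma>2: "\<sigma> * \<sigma> = 1" using \<sigma> by (metis abs_mult_self_eq mult_1)
  \<comment> \<open>Beyond height \<open>N + 1\<close> neither the disc nor a hole is left, which
    supplies the half plane.\<close>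
  have "simply_connected S"
  proof (rule simply_connected_upward_closed[where \<sigma> = \<sigma> and h = "N + 1"])
    fix z s assume z: "z \<in> S" and s: "(0::real) \<le> s"
    show "z + of_real (\<sigma> * s) * \<i> \<in> S"
    proof (cases "of_real (Re z) \<in> perforated G N")
      case False
      with z have z': "z \<in> perforated G N" "\<sigma> * Im z > 0" by (auto simp: S_def)
      have "\<sigma> * (Im z + \<sigma> * s) = \<sigma> * Im z + (\<sigma> * \<sigma>) * s" by (simp only: distrib_left mult.assoc)
      then have "\<sigma> * (Im z + \<sigma> * s) > 0" using z' s \<sigma>2 by simp
      moreover have "z + of_real (\<sigma> * s) * \<i> \<in> perforated G N" using z' s by (intro perforated_up) auto
      ultimately show ?thesis by (simp add: S_def)
    qed (simp add: S_def)
  next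
    fix z assume z: "\<sigma> * Im z > N + 1"
    have "\<bar>\<sigma> * Im z\<bar> = \<bar>Im z\<bar>" using \<sigma> by (simp add: abs_mult)
    then have I: "\<bar>Im z\<bar> > N + 1" using z by linarith
    have "1 \<le> cmod (z - of_int n)" for n
      using abs_Im_le_cmod[of "z - of_int n"] I assms(3) by simp
    moreover have "N < cmod z" using abs_Im_le_cmod[of z] I by simp
    ultimately have "z \<in> perforated G N" using assms(2) by (intro perforatedI[where r = 1]) auto
    then show "z \<in> S" using z assms(3) by (simp add: S_def)
  qed (rule \<sigma>)
  moreover have "\<phi> holomorphic_on S"
    by (rule holomorphic_on_subset[OF hol]) (auto simp: S_def vert)
  ultimately obtain g where "\<And>z. z \<in> S \<Longrightarrow> (g has_field_derivative \<phi> z) (at z)"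
    using simply_connected_eq_global_primitive[OF \<open>open S\<close>] by blast
  then show ?thesis by (intro exI[of _ g]) (auto simp: S_def)
qed

text \<open>\<open>d\<close> is the jump between primitives in the upper and in the lower half plane; it is locally
  constant on the gaps between the holes.\<close>

lemma circle_integral_jump:
  assumes hol: "\<phi> holomorphic_on perforated G N" and "G \<noteq> {}" "N \<ge> 0"
  obtains d :: "real \<Rightarrow> complex" where
    "\<And>c r. r > 0 \<Longrightarrow> sphere (of_real c) r \<subseteq> perforated G N \<Longrightarrow>
        contour_integral (circlepath (of_real c) r) \<phi> = d (c - r) - d (c + r)"
    "\<And>a b. a \<le> b \<Longrightarrow> (\<And>x. a \<le> x \<Longrightarrow> x \<le> b \<Longrightarrow> of_real x \<in> perforated G N) \<Longrightarrow> d a = d b"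
proof -
  obtain g1 where g1: "\<And>z. z \<in> perforated G N \<and> Im z > 0 \<or> of_real (Re z) \<in> perforated G N
             \<Longrightarrow> (g1 has_field_derivative \<phi> z) (at z)"
    using primitive_above[OF assms, of 1] by auto
  obtain g2 where g2: "\<And>z. z \<in> perforated G N \<and> Im z < 0 \<or> of_real (Re z) \<in> perforated G N
             \<Longrightarrow> (g2 has_field_derivative \<phi> z) (at z)"
    using primitive_above[OF assms, of "-1"] by auto
  define d where "d = (\<lambda>x. g1 (of_real x) - g2 (of_real x))"
  show thesis
  proof
    fix c r :: real assume r: "r > 0" and sub: "sphere (of_real c) r \<subseteq> perforated G N"
    let ?\<gamma> = "circlepath (of_real c) r"
    have im: "?\<gamma> t = of_real c + of_real r * exp (2 * of_real pi * \<i> * of_real t)" for t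
      by (simp add: circlepath)
    have Im_\<gamma>: "Im (?\<gamma> t) = r * sin (2 * pi * t)" for t
      by (simp add: im Im_exp)
    have vals: "?\<gamma> 0 = of_real (c + r)" "?\<gamma> (1/2) = of_real (c - r)" "?\<gamma> 1 = of_real (c + r)"
      by (simp_all add: im exp_Euler flip: of_real_mult)
    have in_sph: "?\<gamma> t \<in> perforated G N" if "t \<in> {0..1}" for t
    proof -
      have "?\<gamma> t \<in> path_image ?\<gamma>" using that by (auto simp: path_image_def)
      then show ?thesis using sub r by auto
    qed
    have ends: "of_real (c + r) \<in> perforated G N" "of_real (c - r) \<in> perforated G N"
      using in_sph[of 0] in_sph[of "1/2"] by (simp_all only: vals) auto
    have ci: "\<phi> contour_integrable_on ?\<gamma>"
      by (rule contour_integrable_holomorphic_simple[OF hol open_perforated]) (use sub r in auto)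
    \<comment> \<open>On the upper semicircle the points lie above the axis, except for the two
      ends, which lie in gaps; either way \<open>g1\<close> is a primitive there.\<close>
    have d1: "(g1 has_field_derivative \<phi> (?\<gamma> t)) (at (?\<gamma> t))" if t: "t \<in> {0..1/2}" for t
    proof (cases "t = 0 \<or> t = 1/2")
      case True
      then have "of_real (Re (?\<gamma> t)) \<in> perforated G N"
        by (elim disjE) (simp_all only: vals Re_complex_of_real ends)
      then show ?thesis by (intro g1) auto
    next
      case False
      then have "sin (2 * pi * t) > 0" using t by (intro sin_gt_zero) auto
      then show ?thesis using t r in_sph[of t] by (intro g1) (auto simp: Im_\<gamma>)
    qed
    have d2: "(g2 has_field_derivative \<phi> (?\<gamma> t)) (at (?\<gamma> t))" if t: "t \<in> {1/2..1}" for t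
    proof (cases "t = 1 \<or> t = 1/2")
      case True
      then have "of_real (Re (?\<gamma> t)) \<in> perforated G N"
        by (elim disjE) (simp_all only: vals Re_complex_of_real ends)
      then show ?thesis by (intro g2) auto
    next
      case False
      have "pi * 1 < pi * (2 * t)" using t False by (intro mult_strict_left_mono) auto
      moreover have "pi * (2 * t) < pi * 2" using t False by (intro mult_strict_left_mono) auto
      ultimately have "sin (2 * pi * t) < 0" by (intro sin_lt_zero) (simp_all add: mult_ac)
      then show ?thesis using t r in_sph[of t] by (intro g2) (auto simp: Im_\<gamma> mult_pos_neg)
    qed
    have part: "contour_integral (subpath u v ?\<gamma>) \<phi> = g (?\<gamma> v) - g (?\<gamma> u)"
      if uv: "0 \<le> u" "u \<le> v" "v \<le> 1" and prim: "\<And>t. t \<in> {u..v} \<Longrightarrow> (g has_field_derivative \<phi> (?\<gamma> t)) (at (?\<gamma> t))"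
      for g u v
    proof -
      have "(\<phi> has_contour_integral (g (pathfinish (subpath u v ?\<gamma>)) - g (pathstart (subpath u v ?\<gamma>)))) (subpath u v ?\<gamma>)"
      proof (rule contour_integral_primitive[where S = "path_image (subpath u v ?\<gamma>)"])
        show "valid_path (subpath u v ?\<gamma>)" using uv by (intro valid_path_subpath) auto
        fix x assume "x \<in> path_image (subpath u v ?\<gamma>)"
        then obtain t where "t \<in> {u..v}" "x = ?\<gamma> t" using uv path_image_subpath[of u v ?\<gamma>] by auto
        then show "(g has_field_derivative \<phi> x) (at x within path_image (subpath u v ?\<gamma>))"
          using prim by (auto intro: has_field_derivative_at_within)
      qed auto
      then show ?thesis by (simp add: contour_integral_unique)
    qed
    have "contour_integral ?\<gamma> \<phi> = contour_integral (subpath 0 1 ?\<gamma>) \<phi>" by simp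
    also have "\<dots> = contour_integral (subpath 0 (1/2) ?\<gamma>) \<phi> + contour_integral (subpath (1/2) 1 ?\<gamma>) \<phi>"
      by (rule contour_integral_subpath_combine[symmetric]) (use ci in auto)
    also have "\<dots> = (g1 (?\<gamma> (1/2)) - g1 (?\<gamma> 0)) + (g2 (?\<gamma> 1) - g2 (?\<gamma> (1/2)))"
      using d1 d2 by (subst part[where g = g1], simp_all, subst part[where g = g2], simp_all)
    also have "\<dots> = d (c - r) - d (c + r)" unfolding vals d_def by simp
    finally show "contour_integral ?\<gamma> \<phi> = d (c - r) - d (c + r)" .
  next
    fix a b :: real assume ab: "a \<le> b" and sub: "\<And>x. a \<le> x \<Longrightarrow> x \<le> b \<Longrightarrow> of_real x \<in> perforated G N"
    have "\<exists>k. \<forall>z\<in>complex_of_real ` {a..b}. g1 z - g2 z = k"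
    proof (rule has_field_derivative_zero_constant)
      have "convex {a..b}" by simp
      then show "convex (complex_of_real ` {a..b})"
        by (rule convex_linear_image[rotated]) (simp add: linear_of_real)
      fix z assume "z \<in> complex_of_real ` {a..b}"
      then have "of_real (Re z) \<in> perforated G N" using sub by auto
      then have "((\<lambda>z. g1 z - g2 z) has_field_derivative \<phi> z - \<phi> z) (at z)"
        by (intro derivative_intros g1 g2) auto
      then show "((\<lambda>z. g1 z - g2 z) has_field_derivative 0) (at z within complex_of_real ` {a..b})"
        by (auto intro: has_field_derivative_at_within)
    qed
    then obtain k where k: "\<And>x. x \<in> {a..b} \<Longrightarrow> g1 (of_real x) - g2 (of_real x) = k" by blast
    show "d a = d b" using k[of a] k[of b] ab by (simp add: d_def)
  qed
qed

text \<open>The circle keeps distance \<open>r\<close> from its own centre and at least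
  \<open>1 - r\<close> from every other integer; both exceed 1/8.\<close>

lemma sphere_perforated_int:
  assumes "G \<noteq> {}" "n \<in> G" "\<bar>n\<bar> > int N" "1 / 8 < r" "r < 7 / 8"
  shows "sphere (of_int n) r \<subseteq> perforated G (real N)"
proof
  fix z assume "z \<in> sphere (of_int n :: complex) r"
  then have z: "cmod (z - of_int n) = r" by (simp add: dist_norm norm_minus_commute)
  show "z \<in> perforated G (real N)"
  proof (rule perforatedI[where r = "min r (1 - r)"])
    have "cmod (of_int n) \<le> cmod z + r" using z norm_triangle_ineq4[of z "z - of_int n"] by simp
    moreover have "cmod (of_int n) \<ge> real N + 1" using assms(3) by simp
    ultimately show "real N < cmod z" using assms(5) by linarith
    fix m :: int
    show "min r (1 - r) \<le> cmod (z - of_int m)"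
    proof (cases "m = n")
      case False
      then have "1 \<le> \<bar>n - m\<bar>" by simp
      then have "1 \<le> cmod (of_int (n - m) :: complex)" by (simp only: norm_of_int)
      also have "of_int (n - m) = (z - of_int m) - (z - of_int n :: complex)" by simp
      also have "cmod \<dots> \<le> cmod (z - of_int m) + r"
        using norm_triangle_ineq4[of "z - of_int m" "z - of_int n"] z by simp
      finally show ?thesis by simp
    qed (use z in simp)
  qed (use assms in auto)
qed

lemma sphere_perforated_zero:
  assumes "G \<noteq> {}" "M \<ge> N"
  shows "sphere 0 (real M + 1 / 2) \<subseteq> perforated G (real N)"
proof
  fix z assume "z \<in> sphere (0 :: complex) (real M + 1 / 2)"
  then have z: "cmod z = real M + 1 / 2" by simp
  show "z \<in> perforated G (real N)"
  proof (rule perforatedI[where r = "1 / 2"])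
    fix n :: int
    have "cmod z \<le> cmod (z - of_int n) + of_int \<bar>n\<bar>" "of_int \<bar>n\<bar> \<le> cmod (z - of_int n) + cmod z"
      using norm_triangle_ineq[of "z - of_int n" "of_int n"] norm_triangle_ineq4[of z "z - of_int n"] by simp_all
    moreover have "\<bar>n\<bar> \<le> int M \<or> \<bar>n\<bar> \<ge> int M + 1" by linarith
    then have "real_of_int \<bar>n\<bar> \<le> real M \<or> real_of_int \<bar>n\<bar> \<ge> real M + 1"
      by (metis of_int_1 of_int_add of_int_le_iff of_int_of_nat_eq)
    ultimately show "1 / 2 \<le> cmod (z - of_int n)" using z by linarith
  qed (use assms z in auto)
qed

lemma real_perforated:
  assumes "G \<noteq> {}" "\<bar>x\<bar> > real N" "\<And>n. n \<in> G \<Longrightarrow> 1 / 4 \<le> \<bar>x - of_int n\<bar>"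
  shows "complex_of_real x \<in> perforated G (real N)"
proof (rule perforatedI[where r = "1 / 4"])
  fix n assume "n \<in> G"
  have "cmod (complex_of_real x - of_int n) = \<bar>x - of_int n\<bar>"
    by (metis norm_of_real of_real_diff of_real_of_int_eq)
  then show "1 / 4 \<le> cmod (complex_of_real x - of_int n)" using assms(3)[OF \<open>n \<in> G\<close>] by simp
qed (use assms in auto)

text \<open>The jump is constant on the two real segments that separate the circles. The larger
  circle serves to nest contours in \<open>P_idem\<close>.\<close>

lemma circle_integral_radius:
  assumes hol: "\<phi> holomorphic_on perforated G (real N)" and G: "G \<noteq> {}" "n \<in> G" "\<bar>n\<bar> > int N"
  shows "contour_integral (circlepath (of_int n) (1 / 2)) \<phi> = contour_integral (circlepath (of_int n) (1 / 4)) \<phi>"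
proof -
  obtain d :: "real \<Rightarrow> complex" where
    d: "\<And>c r. r > 0 \<Longrightarrow> sphere (of_real c) r \<subseteq> perforated G (real N) \<Longrightarrow>
        contour_integral (circlepath (of_real c) r) \<phi> = d (c - r) - d (c + r)" and
    const: "\<And>a b. a \<le> b \<Longrightarrow> (\<And>x. a \<le> x \<Longrightarrow> x \<le> b \<Longrightarrow> of_real x \<in> perforated G (real N)) \<Longrightarrow> d a = d b"
    using circle_integral_jump[OF hol G(1)] by (metis of_nat_0_le_iff)
  have near: "complex_of_real x \<in> perforated G (real N)" if "1 / 4 \<le> \<bar>x - of_int n\<bar>" "\<bar>x - of_int n\<bar> \<le> 1 / 2" for x
  proof (rule real_perforated[OF G(1)])
    show "real N < \<bar>x\<bar>" using G(3) that by linarith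
    fix m :: int show "1 / 4 \<le> \<bar>x - of_int m\<bar>"
    proof (cases "m = n")
      case False
      then have "1 \<le> \<bar>real_of_int (n - m)\<bar>" by linarith
      moreover have "\<bar>real_of_int (n - m)\<bar> \<le> \<bar>x - of_int m\<bar> + \<bar>x - of_int n\<bar>"
        using abs_triangle_ineq4[of "x - of_int m" "x - of_int n"] by simp
      ultimately show ?thesis using that by linarith
    qed (use that in simp)
  qed
  have "d (of_int n - 1/2) = d (of_int n - 1/4)" by (rule const) (auto intro!: near)
  moreover have "d (of_int n + 1/4) = d (of_int n + 1/2)" by (rule const) (auto intro!: near)
  moreover have "contour_integral (circlepath (of_int n) r) \<phi> = d (of_int n - r) - d (of_int n + r)"
    if "1 / 8 < r" "r < 7 / 8" for r
    using d[of r "of_int n"] sphere_perforated_int[OF G that] that by simp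
  ultimately show ?thesis by simp
qed

text \<open>Enlarging the radius from \<open>M + 1 / 2\<close> to \<open>M + 3 / 2\<close> passes
  only the integers \<open>M + 1\<close> and \<open>- (M + 1)\<close>, and by symmetry
  \<open>G\<close> contains both or neither. The jump values on the gaps between the circles agree
  and cancel.\<close>

lemma circle_integral_telescope:
  assumes hol: "\<phi> holomorphic_on perforated G (real N)" and G: "G \<noteq> {}" "\<And>n. n \<in> G \<Longrightarrow> - n \<in> G"
  shows "M \<ge> N \<Longrightarrow> contour_integral (circlepath 0 (real M + 1 / 2)) \<phi> =
      contour_integral (circlepath 0 (real N + 1 / 2)) \<phi> +
      (\<Sum>n\<in>{n\<in>G. int N < \<bar>n\<bar> \<and> \<bar>n\<bar> \<le> int M}. contour_integral (circlepath (of_int n) (1 / 4)) \<phi>)"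
proof -
  obtain d :: "real \<Rightarrow> complex" where
    d: "\<And>c r. r > 0 \<Longrightarrow> sphere (of_real c) r \<subseteq> perforated G (real N) \<Longrightarrow>
        contour_integral (circlepath (of_real c) r) \<phi> = d (c - r) - d (c + r)" and
    const: "\<And>a b. a \<le> b \<Longrightarrow> (\<And>x. a \<le> x \<Longrightarrow> x \<le> b \<Longrightarrow> of_real x \<in> perforated G (real N)) \<Longrightarrow> d a = d b"
    using circle_integral_jump[OF hol G(1)] by (metis of_nat_0_le_iff)
  have big: "contour_integral (circlepath 0 (real M + 1 / 2)) \<phi> = d (- real M - 1/2) - d (real M + 1/2)"
    if "M \<ge> N" for M
    using d[of "real M + 1/2" 0] sphere_perforated_zero[OF G(1) that] by simp
  have small: "contour_integral (circlepath (of_int n) (1 / 4)) \<phi> = d (of_int n - 1/4) - d (of_int n + 1/4)"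
    if "n \<in> G" "int N < \<bar>n\<bar>" for n
    using d[of "1/4" "of_int n"] sphere_perforated_int[OF G(1) that, of "1/4"] by simp
  show "M \<ge> N \<Longrightarrow> ?thesis"
  proof (induction M rule: dec_induct)
    case base
    have "{n\<in>G. int N < \<bar>n\<bar> \<and> \<bar>n\<bar> \<le> int N} = {}" by auto
    then show ?case by (simp only: sum.empty add_0_right)
  next
    case (step M)
    let ?S = "\<lambda>M. {n\<in>G. int N < \<bar>n\<bar> \<and> \<bar>n\<bar> \<le> int M}"
    let ?c = "\<lambda>n. contour_integral (circlepath (of_int n) (1 / 4)) \<phi>"
    let ?k = "int M + 1"
    have fin: "finite (?S M)" by (rule finite_subset[of _ "{- int M..int M}"]) auto
    have gap: "complex_of_real x \<in> perforated G (real N)"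
      if x: "real M + 1 / 2 \<le> \<bar>x\<bar>" "\<bar>x\<bar> \<le> real M + 3 / 2" "?k \<in> G \<Longrightarrow> 1 / 4 \<le> \<bar>\<bar>x\<bar> - (real M + 1)\<bar>" for x
    proof (rule real_perforated[OF G(1)])
      show "real N < \<bar>x\<bar>" using x(1) step.hyps by simp
      fix n assume n: "n \<in> G"
      have ge: "\<bar>\<bar>x\<bar> - real_of_int \<bar>n\<bar>\<bar> \<le> \<bar>x - of_int n\<bar>" by simp
      have "1 / 4 \<le> \<bar>\<bar>x\<bar> - real_of_int \<bar>n\<bar>\<bar>"
      proof (cases "\<bar>n\<bar> = ?k")
        case True
        then have "?k \<in> G" using n G(2)[OF n] by (auto simp: abs_if split: if_splits)
        then show ?thesis using x(3) True by simp
      next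
        case False
        then have "\<bar>n\<bar> \<le> int M \<or> \<bar>n\<bar> \<ge> int M + 2" by linarith
        then have "real_of_int \<bar>n\<bar> \<le> real M \<or> real_of_int \<bar>n\<bar> \<ge> real M + 2"
          by (metis of_int_add of_int_le_iff of_int_numeral of_int_of_nat_eq)
        then show ?thesis using x by linarith
      qed
      with ge show "1 / 4 \<le> \<bar>x - of_int n\<bar>" by linarith
    qed
    have "real (Suc M) + 1 / 2 = real M + 3 / 2" "- real (Suc M) - 1 / 2 = - real M - 3 / 2" by simp_all
    moreover have "N \<le> Suc M" using step.hyps by simp
    ultimately have next_c: "contour_integral (circlepath 0 (real (Suc M) + 1 / 2)) \<phi> = d (- real M - 3/2) - d (real M + 3/2)"
      using big[of "Suc M"] by (simp only:)
    have this_c: "contour_integral (circlepath 0 (real N + 1 / 2)) \<phi> =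
        d (- real M - 1/2) - d (real M + 1/2) - (\<Sum>n\<in>?S M. ?c n)"
      using step.IH big[of M] step.hyps by (simp add: algebra_simps)
    show ?case
    proof (cases "?k \<in> G")
      case True
      then have mk: "- ?k \<in> G" by (rule G(2))
      have S: "?S (Suc M) = insert ?k (insert (- ?k) (?S M))"
        using True mk step.hyps by (auto simp: abs_if split: if_splits)
      have "(\<Sum>n\<in>?S (Suc M). ?c n) = ?c ?k + (?c (- ?k) + (\<Sum>n\<in>?S M. ?c n))"
        unfolding S using fin by (subst sum.insert, simp, simp, subst sum.insert) auto
      moreover have "?c ?k = d (real M + 3/4) - d (real M + 5/4)"
      proof -
        have "?c ?k = d (of_int ?k - 1/4) - d (of_int ?k + 1/4)" using step.hyps by (intro small True) auto
        also have "of_int ?k - 1/4 = real M + 3/4" by simp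
        also have "of_int ?k + 1/4 = real M + 5/4" by simp
        finally show ?thesis .
      qed
      moreover have "?c (- ?k) = d (- real M - 5/4) - d (- real M - 3/4)"
      proof -
        have "?c (- ?k) = d (of_int (- ?k) - 1/4) - d (of_int (- ?k) + 1/4)" using step.hyps by (intro small mk) auto
        also have "of_int (- ?k) - 1/4 = - real M - 5/4" by simp
        also have "of_int (- ?k) + 1/4 = - real M - 3/4" by simp
        finally show ?thesis .
      qed
      moreover have "d (real M + 1/2) = d (real M + 3/4)" by (rule const) (auto intro!: gap)
      moreover have "d (real M + 5/4) = d (real M + 3/2)" by (rule const) (auto intro!: gap)
      moreover have "d (- real M - 3/4) = d (- real M - 1/2)" by (rule const) (auto intro!: gap)
      moreover have "d (- real M - 3/2) = d (- real M - 5/4)" by (rule const) (auto intro!: gap)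
      ultimately show ?thesis unfolding next_c this_c by simp
    next
      case False
      have mk: "- ?k \<notin> G"
      proof
        assume "- ?k \<in> G"
        then have "- (- ?k) \<in> G" by (rule G(2))
        with False show False by (simp only: minus_minus)
      qed
      have S: "?S (Suc M) = ?S M"
      proof -
        have "\<bar>n\<bar> \<le> int M" if "n \<in> G" "\<bar>n\<bar> \<le> int (Suc M)" for n
          using that False mk by (cases "n = ?k \<or> n = - ?k") auto
        then show ?thesis by fastforce
      qed
      moreover have "d (real M + 1/2) = d (real M + 3/2)" by (rule const) (use False in \<open>auto intro!: gap\<close>)
      moreover have "d (- real M - 3/2) = d (- real M - 1/2)" by (rule const) (use False in \<open>auto intro!: gap\<close>)
      ultimately show ?thesis unfolding next_c this_c by simp
    qed
  qed
qed

section \<open>Riesz projections as scalar contour integrals\<close>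

lemma bounded_bilinear_scaleC:
  "bounded_bilinear (\<lambda>(a::complex) (x::'a::complex_normed_vector). a *\<^sub>C x)"
proof
  fix a b :: complex and r :: real and x y :: 'a
  have "(r *\<^sub>R a) *\<^sub>C x = (of_real r * a) *\<^sub>C x" by (simp add: scaleR_conv_of_real)
  then show "(r *\<^sub>R a) *\<^sub>C x = r *\<^sub>R (a *\<^sub>C x)" by (metis scaleC_of_real scaleC_scaleC)
  show "a *\<^sub>C (r *\<^sub>R x) = r *\<^sub>R (a *\<^sub>C x)" by (metis scaleC_of_real scaleC_scaleC mult.commute)
  show "\<exists>K. \<forall>(a::complex) (x::'a). norm (a *\<^sub>C x) \<le> norm a * norm x * K"
    by (intro exI[of _ 1]) (simp add: norm_scaleC)
qed (simp_all add: scaleC_add_left scaleC_add_right)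

text \<open>Makes Cauchy theory for complex-valued functions applicable to operator-valued ones: a
  complex-homogeneous functional passes through the parametrised integral.\<close>

lemma vector_contour_integral_functional:
  fixes F :: "complex \<Rightarrow> 'a::{complex_normed_vector, banach}" and \<psi> :: "'a \<Rightarrow> complex"
  assumes F: "continuous_on (sphere c r) F" and r: "r > 0"
    and \<psi>: "bounded_linear \<psi>" "\<And>a x. \<psi> (a *\<^sub>C x) = a * \<psi> x"
  shows "\<psi> (vector_contour_integral (circlepath c r) F) = contour_integral (circlepath c r) (\<lambda>z. \<psi> (F z))"
proof -
  let ?v = "\<lambda>t. 2 * pi * \<i> * r * exp (2 * of_real pi * \<i> * complex_of_real t)"
  have cF: "continuous_on {0..1} (\<lambda>t. F (circlepath c r t))"
  proof (rule continuous_on_compose2[OF F])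
    show "continuous_on {0..1} (circlepath c r)"
      using valid_path_imp_path[OF valid_path_circlepath] by (simp add: path_def)
    have "path_image (circlepath c r) = sphere c r" using r by simp
    then show "circlepath c r ` {0..1} \<subseteq> sphere c r" by (simp add: path_image_def)
  qed
  have "continuous_on {0..1} (\<lambda>t. ?v t *\<^sub>C F (circlepath c r t))"
    by (intro bounded_bilinear.continuous_on[OF bounded_bilinear_scaleC] cF continuous_intros)
  then have int: "(\<lambda>t. ?v t *\<^sub>C F (circlepath c r t)) integrable_on {0..1}"
    by (rule integrable_continuous_real)
  have "vector_contour_integral (circlepath c r) F = integral {0..1} (\<lambda>t. ?v t *\<^sub>C F (circlepath c r t))"
    unfolding vector_contour_integral_def
    by (rule integral_cong) (simp add: vector_derivative_circlepath01)
  then have "\<psi> (vector_contour_integral (circlepath c r) F)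
      = integral {0..1} (\<psi> \<circ> (\<lambda>t. ?v t *\<^sub>C F (circlepath c r t)))"
    using integral_linear[OF int \<psi>(1)] by simp
  also have "\<dots> = integral {0..1} (\<lambda>t. \<psi> (F (circlepath c r t)) * ?v t)"
    by (simp add: o_def \<psi>(2) mult.commute)
  also have "\<dots> = contour_integral (circlepath c r) (\<lambda>z. \<psi> (F z))"
    by (simp add: contour_integral_integral vector_derivative_circlepath)
  finally show ?thesis .
qed

lemma lipschitz_imp_continuous_on:
  fixes F :: "complex \<Rightarrow> 'b::real_normed_vector"
  assumes "\<And>z v. z \<in> S \<Longrightarrow> v \<in> S \<Longrightarrow> norm (F z - F v) \<le> k * cmod (z - v)"
  shows "continuous_on S F"
proof -
  have "\<bar>k\<bar>-lipschitz_on S F"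
  proof (rule lipschitz_onI)
    fix x y assume "x \<in> S" "y \<in> S"
    then have "norm (F x - F y) \<le> k * cmod (x - y)" by (rule assms)
    also have "\<dots> \<le> \<bar>k\<bar> * cmod (x - y)" by (intro mult_right_mono) auto
    finally show "dist (F x) (F y) \<le> \<bar>k\<bar> * dist x y" by (simp add: dist_norm)
  qed simp
  then show ?thesis by (rule lipschitz_on_continuous_on)
qed

section \<open>The resolvent as an analytic function and its Riesz projections\<close>

context perturbed_diagonal
begin

lemma perforated_far: "perforated G (real N0) \<subseteq> {z. far z \<and> cmod z > real N0}"
  using perforated_dist by (fastforce simp: far_def perforated_def)

lemma perforated_in_resolvent_set: "perforated G (real N0) \<subseteq> resolvent_set D L"
  using perforated_far resolvent_R0(1) by blast

lemma R0_norm_far: "far z \<Longrightarrow> norm (R0 z x) \<le> 8 * norm x"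
proof (rule R0_norm)
  fix n assume "far z" "n \<in> G"
  then have "1 / 8 \<le> cmod (z - of_int n)" by (auto simp: far_def)
  then show "1 / cmod (z - of_int n) \<le> 8" by (simp add: field_simps divide_le_eq)
qed (simp_all add: far_not_in)

lemma R_norm_of_R0_norm:
  assumes z: "z \<in> perforated G (real N0)" and s: "\<And>x. norm (R0 z x) \<le> s * norm x" "s \<ge> 0"
  shows "norm (R z f) \<le> s * C * norm f"
proof -
  have "far z" "cmod z > real N0" using z perforated_far by auto
  from resolvent_R0(2)[OF this, of f] obtain x where x: "R z f = R0 z x" "norm x \<le> C * norm f" by blast
  have "norm (R z f) \<le> s * norm x" using x s by simp
  also have "\<dots> \<le> s * (C * norm f)" using x s by (intro mult_left_mono) auto
  finally show ?thesis by (simp add: mult.assoc)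
qed

lemma R_norm: "z \<in> perforated G (real N0) \<Longrightarrow> norm (R z f) \<le> 8 * C * norm f"
  by (rule R_norm_of_R0_norm) (use perforated_far in \<open>auto intro: R0_norm_far\<close>)

text \<open>The free eigenvalues are real, so their distance to \<open>z\<close> is at least
  \<open>\<bar>Im z\<bar>\<close>; the factor \<open>C\<close> accounts for the
  perturbation.\<close>

lemma R_norm_imag:
  assumes z: "z \<in> perforated G (real N0)" "Im z \<noteq> 0"
  shows "norm (R z f) \<le> 1 / \<bar>Im z\<bar> * C * norm f"
proof (rule R_norm_of_R0_norm[OF z(1)])
  show "norm (R0 z x) \<le> 1 / \<bar>Im z\<bar> * norm x" for x
  proof (rule R0_norm)
    show "z \<notin> of_int ` G" using z(2) by auto
    show "1 / cmod (z - of_int n) \<le> 1 / \<bar>Im z\<bar>" for n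
      using abs_Im_le_cmod[of "z - of_int n"] z(2) by (intro divide_left_mono mult_pos_pos) auto
  qed simp
qed simp

lemma R_scaleC:
  assumes "z \<in> resolvent_set D L"
  shows "R z (a *\<^sub>C f) = a *\<^sub>C R z f"
proof -
  let ?u = "R z f"
  have "z *\<^sub>C (a *\<^sub>C ?u) - L (a *\<^sub>C ?u) = a *\<^sub>C (z *\<^sub>C ?u - L ?u)"
    by (simp add: L_scaleC resolvent_mem(1)[OF assms] scaleC_diff_right scaleC_scaleC mult.commute)
  then show ?thesis
    using resolvent_left_inverse[OF assms D_scaleC[OF resolvent_mem(1)[OF assms]], of a f]
      resolvent_mem(2)[OF assms, of f] by simp
qed

lemma resolvent_identity:
  assumes "z \<in> resolvent_set D L" "v \<in> resolvent_set D L"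
  shows "R z f - R v f = (v - z) *\<^sub>C R z (R v f)"
proof -
  let ?u = "R v f"
  have "z *\<^sub>C ?u - L ?u = (z - v) *\<^sub>C ?u + f"
    using resolvent_mem(2)[OF assms(2), of f] by (simp add: scaleC_diff_left algebra_simps)
  then have "?u = R z ((z - v) *\<^sub>C ?u + f)"
    using resolvent_left_inverse[OF assms(1) resolvent_mem(1)[OF assms(2)]] by metis
  also have "\<dots> = (z - v) *\<^sub>C R z ?u + R z f"
    using assms by (simp add: blinfun.add_right R_scaleC)
  finally have "?u = (z - v) *\<^sub>C R z ?u + R z f" .
  then have "R z f - R v f = - ((z - v) *\<^sub>C R z ?u)" by (metis add_diff_cancel_right' diff_minus_eq_add minus_diff_eq)
  then show ?thesis by (simp add: scaleC_diff_left)
qed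

text \<open>Continuity in the operator norm makes the operator-valued integrand of
  \<open>riesz_projection\<close> integrable on the contours.\<close>

lemma R_lipschitz:
  assumes "z \<in> perforated G (real N0)" "v \<in> perforated G (real N0)"
  shows "norm (R z - R v) \<le> (8 * C)\<^sup>2 * cmod (z - v)"
proof (rule norm_blinfun_bound)
  fix f
  have "norm ((R z - R v) f) = cmod (v - z) * norm (R z (R v f))"
    using resolvent_identity[of z v f] assms perforated_in_resolvent_set
    by (simp add: blinfun.diff_left norm_scaleC subset_iff)
  also have "\<dots> \<le> cmod (v - z) * (8 * C * (8 * C * norm f))"
  proof (rule mult_left_mono)
    have "norm (R z (R v f)) \<le> 8 * C * norm (R v f)" by (rule R_norm[OF assms(1)])
    also have "\<dots> \<le> 8 * C * (8 * C * norm f)" using C_pos by (intro mult_left_mono R_norm assms) auto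
    finally show "norm (R z (R v f)) \<le> 8 * C * (8 * C * norm f)" .
  qed simp
  finally show "norm ((R z - R v) f) \<le> (8 * C)\<^sup>2 * cmod (z - v) * norm f"
    by (simp add: norm_minus_commute power2_eq_square mult_ac)
qed simp

lemma R_continuous: "continuous_on (perforated G (real N0)) R"
  by (rule lipschitz_imp_continuous_on[OF R_lipschitz])

lemma R_apply_continuous: "continuous_on (perforated G (real N0)) (\<lambda>z. R z f)"
  by (intro continuous_intros R_continuous)

text \<open>By the resolvent identity the difference quotient is
  \<open>- \<psi> (R v (R z f))\<close>, which converges by continuity of \<open>R\<close>.\<close>

lemma R_functional_holomorphic:
  assumes \<psi>: "bounded_linear \<psi>" "\<And>a x. \<psi> (a *\<^sub>C x) = a * \<psi> x"
  shows "(\<lambda>z. \<psi> (R z f)) holomorphic_on perforated G (real N0)"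
proof -
  have "((\<lambda>z. \<psi> (R z f)) has_field_derivative - \<psi> (R z (R z f))) (at z)"
    if z: "z \<in> perforated G (real N0)" for z
    unfolding has_field_derivative_iff
  proof (rule Lim_transform_eventually)
    have "continuous (at z) (\<lambda>v. R v (R z f))"
      using R_apply_continuous open_perforated z by (metis continuous_on_eq_continuous_at)
    then have "((\<lambda>v. R v (R z f)) \<longlongrightarrow> R z (R z f)) (at z)" by (simp add: continuous_within)
    then show "((\<lambda>v. - \<psi> (R v (R z f))) \<longlongrightarrow> - \<psi> (R z (R z f))) (at z)"
      by (intro tendsto_minus bounded_linear.tendsto[OF \<psi>(1)])
    have "\<forall>\<^sub>F v in at z. v \<in> perforated G (real N0)"
      using z open_perforated by (metis eventually_at_in_open')
    moreover have "\<forall>\<^sub>F v in at z. v \<noteq> z" by (simp add: eventually_at_filter)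
    ultimately show "\<forall>\<^sub>F v in at z. - \<psi> (R v (R z f)) = (\<psi> (R v f) - \<psi> (R z f)) / (v - z)"
    proof eventually_elim
      case (elim v)
      interpret bounded_linear \<psi> by (rule \<psi>(1))
      have "\<psi> (R v f) - \<psi> (R z f) = \<psi> (R v f - R z f)" by (simp add: diff)
      also have "\<dots> = (z - v) * \<psi> (R v (R z f))"
        using resolvent_identity[of v z f] elim z perforated_in_resolvent_set by (simp add: \<psi>(2) subset_iff)
      finally show ?case using elim by (simp add: field_simps)
    qed
  qed
  then show ?thesis
    by (meson field_differentiable_def field_differentiable_at_within holomorphic_on_def)
qed

lemma riesz_functional:
  assumes sph: "sphere c r \<subseteq> perforated G (real N0)" and r: "r > 0"
    and \<psi>: "bounded_linear \<psi>" "\<And>a x. \<psi> (a *\<^sub>C x) = a * \<psi> x"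
  shows "\<psi> (riesz_projection D L (circlepath c r) f) =
     1 / (2 * of_real pi * \<i>) * contour_integral (circlepath c r) (\<lambda>z. \<psi> (R z f))"
proof -
  have bl: "bounded_linear (\<lambda>X. \<psi> (blinfun_apply X f))"
    by (rule bounded_linear_compose[OF \<psi>(1)]) (rule blinfun.bounded_linear_left)
  have "\<psi> (blinfun_apply (vector_contour_integral (circlepath c r) R) f)
      = contour_integral (circlepath c r) (\<lambda>z. \<psi> (R z f))"
    by (rule vector_contour_integral_functional[OF continuous_on_subset[OF R_continuous sph] r bl])
      (simp add: scaleC_blinfun.rep_eq \<psi>(2))
  then show ?thesis by (simp add: riesz_projection_def scaleC_blinfun.rep_eq \<psi>(2))
qed

lemma riesz_cin:
  assumes sph: "sphere c r \<subseteq> perforated G (real N0)" and r: "r > 0"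
  shows "cin (riesz_projection D L (circlepath c r) f) g =
     1 / (2 * of_real pi * \<i>) * contour_integral (circlepath c r) (\<lambda>z. cin (R z f) g)"
  by (rule riesz_functional[OF assms bounded_linear_cin cin_scaleC_left])

abbreviation P :: "int \<Rightarrow> 'a \<Rightarrow>\<^sub>L 'a" where
  "P n \<equiv> riesz_projection D L (circlepath (of_int n) (1 / 4))"

abbreviation S :: "nat \<Rightarrow> 'a \<Rightarrow>\<^sub>L 'a" where
  "S M \<equiv> riesz_projection D L (circlepath 0 (real M + 1 / 2))"

lemma S_telescope:
  assumes "M \<ge> N0"
  shows "S M f = S N0 f + (\<Sum>n\<in>{n\<in>G. int N0 < \<bar>n\<bar> \<and> \<bar>n\<bar> \<le> int M}. P n f)"
proof (rule cin_eqI)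
  fix g
  let ?I = "{n\<in>G. int N0 < \<bar>n\<bar> \<and> \<bar>n\<bar> \<le> int M}"
  have hol: "(\<lambda>z. cin (R z f) g) holomorphic_on perforated G (real N0)"
    by (rule R_functional_holomorphic[OF bounded_linear_cin cin_scaleC_left])
  have "cin (S M f) g = 1 / (2 * of_real pi * \<i>) *
      (contour_integral (circlepath 0 (real N0 + 1 / 2)) (\<lambda>z. cin (R z f) g) +
      (\<Sum>n\<in>?I. contour_integral (circlepath (of_int n) (1 / 4)) (\<lambda>z. cin (R z f) g)))"
    unfolding circle_integral_telescope[OF hol G_nonempty G_sym assms, simplified, symmetric]
    by (rule riesz_cin[OF sphere_perforated_zero[OF G_nonempty assms]]) simp
  also have "\<dots> = cin (S N0 f) g + (\<Sum>n\<in>?I. cin (P n f) g)"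
    using sphere_perforated_zero[OF G_nonempty order_refl, of N0] sphere_perforated_int[OF G_nonempty, of _ N0 "1/4"]
    by (simp add: riesz_cin distrib_left sum_distrib_left)
  also have "\<dots> = cin (S N0 f + (\<Sum>n\<in>?I. P n f)) g"
    by (simp add: cin_add_left cin_sum_left)
  finally show "cin (S M f) g = cin (S N0 f + (\<Sum>n\<in>?I. P n f)) g" .
qed

text \<open>The outer copy of the projection is taken over a circle of radius \<open>1 / 4\<close>, the inner one over
  radius \<open>1 / 2\<close>; the resolvent identity and Cauchy's formula give \<open>P\<^sup>2 = P\<close>.\<close>

lemma P_idem:
  assumes n: "n \<in> G" "\<bar>n\<bar> > int N0"
  shows "P n (P n f) = P n f"
proof (rule cin_eqI)
  fix g
  define k where "k = 1 / (2 * complex_of_real pi * \<i>)"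
  let ?c1 = "circlepath (of_int n) (1 / 4)" and ?c2 = "circlepath (of_int n) (1 / 2)"
  let ?\<phi> = "\<lambda>z. cin (R z f) g"
  note s1 = sphere_perforated_int[OF G_nonempty n, of "1/4", simplified]
  note s2 = sphere_perforated_int[OF G_nonempty n, of "1/2", simplified]
  have im: "path_image ?c1 = sphere (of_int n) (1/4)" "path_image ?c2 = sphere (of_int n) (1/2)" by simp_all
  have P2: "\<psi> (P n x) = k * contour_integral ?c2 (\<lambda>v. \<psi> (R v x))"
    if \<psi>: "bounded_linear \<psi>" "\<And>a x. \<psi> (a *\<^sub>C x) = a * \<psi> x" for \<psi> x
    using riesz_functional[OF s1 _ \<psi>, of x]
      circle_integral_radius[OF R_functional_holomorphic[OF \<psi>, of x] G_nonempty n] by (simp add: k_def)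
  have cont\<phi>: "continuous_on (perforated G (real N0)) ?\<phi>"
    by (intro bounded_linear.continuous_on[OF bounded_linear_cin] R_apply_continuous)
  \<comment> \<open>Resolvent identity under the integral over the larger circle; \<open>z\<close>
    lies inside it, so Cauchy's formula evaluates the first part to
    \<open>?\<phi> z\<close>.\<close>
  have inner: "cin (R z (P n f)) g = ?\<phi> z - k * contour_integral ?c2 (\<lambda>v. ?\<phi> v / (v - z))"
    if z: "z \<in> sphere (of_int n) (1/4)" for z
  proof -
    have zP: "z \<in> perforated G (real N0)" using z s1 by auto
    have zr: "z \<in> resolvent_set D L" using zP perforated_in_resolvent_set by auto
    have zn: "cmod (z - of_int n) < 1 / 2" using z by (simp add: dist_norm norm_minus_commute)
    have "cin (R z (P n f)) g = k * contour_integral ?c2 (\<lambda>v. cin (R z (R v f)) g)"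
    proof (rule P2)
      show "bounded_linear (\<lambda>x. cin (R z x) g)"
        by (rule bounded_linear_compose[OF bounded_linear_cin blinfun.bounded_linear_right])
    qed (simp add: R_scaleC[OF zr] cin_scaleC_left)
    also have "contour_integral ?c2 (\<lambda>v. cin (R z (R v f)) g)
        = contour_integral ?c2 (\<lambda>v. ?\<phi> z / (v - z) - ?\<phi> v / (v - z))"
    proof (rule contour_integral_cong[OF refl])
      fix v assume "v \<in> path_image ?c2"
      then have v: "v \<in> sphere (of_int n) (1/2)" by simp
      then have wr: "v \<in> resolvent_set D L" using s2 perforated_in_resolvent_set by auto
      have "v \<noteq> z" using v zn by (auto simp: dist_norm norm_minus_commute)
      have "?\<phi> z - ?\<phi> v = (v - z) * cin (R z (R v f)) g"
        using resolvent_identity[OF zr wr, of f] by (metis cin_diff_left cin_scaleC_left)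
      then show "cin (R z (R v f)) g = ?\<phi> z / (v - z) - ?\<phi> v / (v - z)"
        using \<open>v \<noteq> z\<close> by (simp add: nonzero_divide_eq_eq[symmetric] mult.commute flip: diff_divide_distrib)
    qed
    also have "\<dots> = contour_integral ?c2 (\<lambda>v. ?\<phi> z / (v - z)) - contour_integral ?c2 (\<lambda>v. ?\<phi> v / (v - z))"
    proof (rule contour_integral_diff)
      have ne: "v - z \<noteq> 0" if "v \<in> sphere (of_int n) (1/2)" for v
        using that zn by (auto simp: dist_norm norm_minus_commute)
      show "(\<lambda>v. ?\<phi> z / (v - z)) contour_integrable_on ?c2"
        by (intro contour_integrable_continuous_circlepath)
          (use ne in \<open>auto intro!: continuous_intros\<close>)
      show "(\<lambda>v. ?\<phi> v / (v - z)) contour_integrable_on ?c2"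
        by (intro contour_integrable_continuous_circlepath)
          (use ne s2 in \<open>auto intro!: continuous_intros continuous_on_subset[OF cont\<phi>]\<close>)
    qed
    also have "contour_integral ?c2 (\<lambda>v. ?\<phi> z / (v - z)) = 2 * of_real pi * \<i> * ?\<phi> z"
      by (rule contour_integral_unique, rule Cauchy_integral_circlepath) (use zn in auto)
    finally show ?thesis by (simp add: k_def field_simps)
  qed
  have "cin (P n (P n f)) g = k * contour_integral ?c1 (\<lambda>z. cin (R z (P n f)) g)"
    using riesz_cin[OF s1, of "P n f" g] by (simp add: k_def)
  also have "contour_integral ?c1 (\<lambda>z. cin (R z (P n f)) g)
      = contour_integral ?c1 (\<lambda>z. ?\<phi> z - k * contour_integral ?c2 (\<lambda>v. ?\<phi> v / (v - z)))"
    by (rule contour_integral_cong[OF refl]) (use inner in simp)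
  also have "\<dots> = contour_integral ?c1 ?\<phi> - contour_integral ?c1 (\<lambda>z. k * contour_integral ?c2 (\<lambda>v. ?\<phi> v / (v - z)))"
  proof (rule contour_integral_diff)
    have c1: "?\<phi> contour_integrable_on ?c1"
      by (intro contour_integrable_continuous_circlepath continuous_on_subset[OF cont\<phi>]) (use s1 in auto)
    then show "?\<phi> contour_integrable_on ?c1" .
    have "continuous_on (perforated G (real N0)) (\<lambda>z. ?\<phi> z - cin (R z (P n f)) g)"
      by (intro continuous_on_diff bounded_linear.continuous_on[OF bounded_linear_cin] R_apply_continuous)
    then have "(\<lambda>z. ?\<phi> z - cin (R z (P n f)) g) contour_integrable_on ?c1"
      by (rule contour_integrable_continuous_circlepath[OF continuous_on_subset]) (use s1 in auto)
    then show "(\<lambda>z. k * contour_integral ?c2 (\<lambda>v. ?\<phi> v / (v - z))) contour_integrable_on ?c1"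
      by (rule contour_integrable_eq) (use inner in simp)
  qed
  \<comment> \<open>After the two integrals are exchanged, the inner integrand is holomorphic in
    \<open>z\<close> inside the larger circle, on which its pole \<open>v\<close> lies; so its
    integral over the smaller one vanishes.\<close>
  also have "contour_integral ?c1 (\<lambda>z. k * contour_integral ?c2 (\<lambda>v. ?\<phi> v / (v - z))) = 0"
  proof -
    have ne: "v - z \<noteq> 0" if "z \<in> sphere (of_int n) (1/4)" "v \<in> sphere (of_int n) (1/2)" for v z
      using that by (auto simp: dist_norm)
    have "contour_integral ?c1 (\<lambda>z. contour_integral ?c2 (\<lambda>v. k * (?\<phi> v / (v - z))))
        = contour_integral ?c2 (\<lambda>v. contour_integral ?c1 (\<lambda>z. k * (?\<phi> v / (v - z))))"
    proof (rule contour_integral_swap)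
      have "continuous_on (sphere (of_int n) (1/4) \<times> sphere (of_int n) (1/2))
          (\<lambda>p. k * (?\<phi> (snd p) / (snd p - fst p)))"
      proof (intro continuous_intros)
        show "continuous_on (sphere (of_int n) (1/4) \<times> sphere (of_int n) (1/2)) (\<lambda>p. ?\<phi> (snd p))"
          by (rule continuous_on_compose2[OF cont\<phi>]) (use s2 in \<open>auto intro: continuous_intros\<close>)
      qed (use ne in auto)
      then show "continuous_on (path_image ?c1 \<times> path_image ?c2) (\<lambda>(z, v). k * (?\<phi> v / (v - z)))"
        unfolding im by (simp add: case_prod_unfold)
    qed (auto simp: vector_derivative_circlepath intro!: continuous_intros)
    also have "\<dots> = contour_integral ?c2 (\<lambda>v. 0)"
    proof (rule contour_integral_cong[OF refl])
      fix v assume "v \<in> path_image ?c2"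
      then have v: "cmod (v - of_int n) = 1/2" by (simp add: dist_norm norm_minus_commute)
      have "((\<lambda>z. k * (?\<phi> v / (v - z))) has_contour_integral 0) ?c1"
      proof (rule Cauchy_theorem_convex_simple[where S = "ball (of_int n) (1/2)"])
        show "(\<lambda>z. k * (?\<phi> v / (v - z))) holomorphic_on ball (of_int n) (1/2)"
          using v by (intro holomorphic_intros) (auto simp: dist_norm norm_minus_commute)
      qed (auto simp: dist_norm)
      then show "contour_integral ?c1 (\<lambda>z. k * (?\<phi> v / (v - z))) = 0" by (rule contour_integral_unique)
    qed
    also have "contour_integral ?c1 (\<lambda>z. contour_integral ?c2 (\<lambda>v. k * (?\<phi> v / (v - z))))
        = contour_integral ?c1 (\<lambda>z. k * contour_integral ?c2 (\<lambda>v. ?\<phi> v / (v - z)))"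
    proof (intro contour_integral_cong[OF refl] contour_integral_lmul)
      fix z assume "z \<in> path_image ?c1"
      then show "(\<lambda>v. ?\<phi> v / (v - z)) contour_integrable_on ?c2"
        by (intro contour_integrable_continuous_circlepath)
          (use ne s2 in \<open>auto intro!: continuous_intros continuous_on_subset[OF cont\<phi>]\<close>)
    qed
    finally show ?thesis by simp
  qed
  also have "k * (contour_integral ?c1 ?\<phi> - 0) = cin (P n f) g"
    using riesz_cin[OF s1, of f g] by (simp add: k_def)
  finally show "cin (P n (P n f)) g = cin (P n f) g" .
qed

end

section \<open>Quadratically close projections\<close>

text \<open>With \<open>A n = P n - P0 n\<close>, idempotence gives
  \<open>P n = P0 n + A n P0 n + P0 n A n + A n A n\<close>. The first and third terms are orthogonal series,
  the second and fourth converge absolutely.\<close>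

lemma quadratically_close_projections:
  fixes P P0 :: "'i \<Rightarrow> 'a::banach \<Rightarrow> 'a" and \<alpha> :: "'i \<Rightarrow> real"
  assumes P_diff: "\<And>n x y. n \<in> I \<Longrightarrow> P n (x - y) = P n x - P n y"
    and P0_diff: "\<And>n x y. n \<in> I \<Longrightarrow> P0 n (x - y) = P0 n x - P0 n y"
    and P_idem: "\<And>n x. n \<in> I \<Longrightarrow> P n (P n x) = P n x"
    and P0_idem: "\<And>n x. n \<in> I \<Longrightarrow> P0 n (P0 n x) = P0 n x"
    and close: "\<And>n x. n \<in> I \<Longrightarrow> norm (P n x - P0 n x) \<le> \<alpha> n * norm x"
    and \<alpha>: "\<And>n. 0 \<le> \<alpha> n" "(\<lambda>n. (\<alpha> n)\<^sup>2) summable_on I"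
    and orth: "\<And>F y. finite F \<Longrightarrow> F \<subseteq> I \<Longrightarrow> (norm (\<Sum>n\<in>F. P0 n (y n)))\<^sup>2 \<le> (\<Sum>n\<in>F. (norm (P0 n (y n)))\<^sup>2)"
    and bessel: "\<And>F x. finite F \<Longrightarrow> F \<subseteq> I \<Longrightarrow> (\<Sum>n\<in>F. (norm (P0 n x))\<^sup>2) \<le> (norm x)\<^sup>2"
  shows "(\<lambda>n. P n x) summable_on I"
    and "\<exists>K. \<forall>x F. finite F \<longrightarrow> F \<subseteq> I \<longrightarrow> norm (\<Sum>n\<in>F. P n x) \<le> K * norm x"
proof -
  define a where "a = sqrt (infsum (\<lambda>n. (\<alpha> n)\<^sup>2) I)"
  have a0: "0 \<le> a" by (simp add: a_def infsum_nonneg)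
  have a2: "(\<Sum>n\<in>F. (\<alpha> n)\<^sup>2) \<le> a\<^sup>2" if "finite F" "F \<subseteq> I" for F
    unfolding a_def using finite_sum_le_infsum[OF \<alpha>(2) that] by (simp add: infsum_nonneg)
  define A where "A = (\<lambda>n x. P n x - P0 n x)"
  have A_diff: "A n (x - y) = A n x - A n y" if "n \<in> I" for n x y
    using that by (simp add: A_def P_diff P0_diff)
  have A_le: "norm (A n x) \<le> \<alpha> n * norm x" if "n \<in> I" for n x using close[OF that] by (simp add: A_def)
  have P0_le: "norm (P0 n x) \<le> norm x" if "n \<in> I" for n x
    using bessel[of "{n}" x] that by (simp add: power2_le_iff_abs_le)
  have split: "P n x = P0 n x + A n (P0 n x) + P0 n (A n x) + A n (A n x)" if n: "n \<in> I" for n x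
  proof -
    have "A n (A n x) = A n (P n x) - A n (P0 n x)" using A_diff[OF n, of "P n x" "P0 n x"] by (simp add: A_def)
    moreover have "A n (P n x) = P n x - P0 n (P n x)" by (simp add: A_def P_idem[OF n])
    moreover have "P0 n (A n x) = P0 n (P n x) - P0 n x" by (simp add: A_def P0_diff[OF n] P0_idem[OF n])
    ultimately show ?thesis by simp
  qed
  have le3: "(norm (\<Sum>n\<in>F. P0 n (A n x)))\<^sup>2 \<le> (\<Sum>n\<in>F. (\<alpha> n)\<^sup>2 * (norm x)\<^sup>2)" if F: "finite F" "F \<subseteq> I" for F x
  proof -
    have "(norm (\<Sum>n\<in>F. P0 n (A n x)))\<^sup>2 \<le> (\<Sum>n\<in>F. (norm (P0 n (A n x)))\<^sup>2)" by (rule orth[OF F])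
    also have "\<dots> \<le> (\<Sum>n\<in>F. (\<alpha> n * norm x)\<^sup>2)"
    proof (intro sum_mono power_mono)
      fix n assume "n \<in> F"
      then have n: "n \<in> I" using F by auto
      show "norm (P0 n (A n x)) \<le> \<alpha> n * norm x" using P0_le[OF n, of "A n x"] A_le[OF n, of x] by linarith
    qed simp
    finally show ?thesis by (simp add: power_mult_distrib)
  qed
  have le2: "norm (A n (P0 n x)) \<le> \<alpha> n * norm (P0 n x)" if "n \<in> I" for n x using that by (rule A_le)
  have le4: "norm (A n (A n x)) \<le> (\<alpha> n)\<^sup>2 * norm x" if n: "n \<in> I" for n x
  proof -
    have "norm (A n (A n x)) \<le> \<alpha> n * norm (A n x)" by (rule A_le[OF n])
    also have "\<dots> \<le> \<alpha> n * (\<alpha> n * norm x)" by (intro mult_left_mono A_le n \<alpha>)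
    finally show ?thesis by (simp add: power2_eq_square mult.assoc)
  qed
  have s_bessel: "(\<lambda>n. (norm (P0 n x))\<^sup>2) summable_on I" for x
    by (rule nonneg_summable_onI[where C = "(norm x)\<^sup>2"]) (auto intro: bessel)
  have s1: "(\<lambda>n. P0 n x) summable_on I" for x
    by (rule summable_on_if_norm_sum_sq_le[OF s_bessel[of x]]) (auto intro: orth)
  have s3: "(\<lambda>n. P0 n (A n x)) summable_on I" for x
    by (rule summable_on_if_norm_sum_sq_le[where b = "\<lambda>n. (\<alpha> n)\<^sup>2 * (norm x)\<^sup>2"])
      (auto intro: le3 summable_on_cmult_left \<alpha>)
  have s2: "(\<lambda>n. A n (P0 n x)) summable_on I" for x
  proof (rule abs_summable_summable, rule summable_on_comparison_test)
    show "(\<lambda>n. (\<alpha> n)\<^sup>2 + (norm (P0 n x))\<^sup>2) summable_on I" by (intro summable_on_add \<alpha> s_bessel)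
    fix n assume n: "n \<in> I"
    have "2 * (\<alpha> n * norm (P0 n x)) \<le> (\<alpha> n)\<^sup>2 + (norm (P0 n x))\<^sup>2"
      using sum_squares_bound[of "\<alpha> n" "norm (P0 n x)"] by (simp add: mult.assoc)
    moreover have "0 \<le> \<alpha> n * norm (P0 n x)" using \<alpha> by simp
    ultimately show "norm (A n (P0 n x)) \<le> (\<alpha> n)\<^sup>2 + (norm (P0 n x))\<^sup>2" using le2[OF n, of x] by linarith
  qed simp
  have s4: "(\<lambda>n. A n (A n x)) summable_on I" for x
    by (rule abs_summable_summable, rule summable_on_comparison_test[where f = "\<lambda>n. (\<alpha> n)\<^sup>2 * norm x"])
      (auto intro: le4 summable_on_cmult_left \<alpha>)
  have "(\<lambda>n. P0 n x + A n (P0 n x) + P0 n (A n x) + A n (A n x)) summable_on I"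
    by (intro summable_on_add s1 s2 s3 s4)
  then show "(\<lambda>n. P n x) summable_on I" using split by (simp cong: summable_on_cong)
  show "\<exists>K. \<forall>x F. finite F \<longrightarrow> F \<subseteq> I \<longrightarrow> norm (\<Sum>n\<in>F. P n x) \<le> K * norm x"
  \<comment> \<open>One summand for each term of the decomposition, where \<open>a\<close> is the
    square-sum norm of \<open>\<alpha>\<close>. The second term pairs \<open>\<alpha>\<close> with
    Bessel's inequality, the third uses orthogonality of the ranges.\<close>
  proof (intro exI[of _ "1 + a + a + a\<^sup>2"] allI impI)
    fix x F assume F: "finite F" "F \<subseteq> I"
    have "(norm (\<Sum>n\<in>F. P0 n x))\<^sup>2 \<le> (norm x)\<^sup>2"
      using orth[OF F, of "\<lambda>_. x"] bessel[OF F, of x] by linarith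
    then have b1: "norm (\<Sum>n\<in>F. P0 n x) \<le> norm x" by simp
    have b2: "norm (\<Sum>n\<in>F. A n (P0 n x)) \<le> a * norm x"
    proof (rule power2_le_imp_le)
      have "norm (\<Sum>n\<in>F. A n (P0 n x)) \<le> (\<Sum>n\<in>F. \<alpha> n * norm (P0 n x))"
        by (rule order_trans[OF norm_sum]) (use F in \<open>auto intro!: sum_mono le2\<close>)
      then have "(norm (\<Sum>n\<in>F. A n (P0 n x)))\<^sup>2 \<le> (\<Sum>n\<in>F. \<alpha> n * norm (P0 n x))\<^sup>2" by (intro power_mono) auto
      also have "\<dots> \<le> (\<Sum>n\<in>F. (\<alpha> n)\<^sup>2) * (\<Sum>n\<in>F. (norm (P0 n x))\<^sup>2)" by (rule Cauchy_Schwarz_ineq_sum)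
      also have "\<dots> \<le> a\<^sup>2 * (norm x)\<^sup>2" by (intro mult_mono a2 bessel F) (auto intro: sum_nonneg)
      finally show "(norm (\<Sum>n\<in>F. A n (P0 n x)))\<^sup>2 \<le> (a * norm x)\<^sup>2" by (simp add: power_mult_distrib)
    qed (use a0 in simp)
    have b3: "norm (\<Sum>n\<in>F. P0 n (A n x)) \<le> a * norm x"
    proof (rule power2_le_imp_le)
      have "(norm (\<Sum>n\<in>F. P0 n (A n x)))\<^sup>2 \<le> (\<Sum>n\<in>F. (\<alpha> n)\<^sup>2) * (norm x)\<^sup>2"
        using le3[OF F, of x] by (simp add: sum_distrib_right)
      also have "\<dots> \<le> a\<^sup>2 * (norm x)\<^sup>2" by (intro mult_right_mono a2 F) auto
      finally show "(norm (\<Sum>n\<in>F. P0 n (A n x)))\<^sup>2 \<le> (a * norm x)\<^sup>2" by (simp add: power_mult_distrib)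
    qed (use a0 in simp)
    have b4: "norm (\<Sum>n\<in>F. A n (A n x)) \<le> a\<^sup>2 * norm x"
    proof -
      have "norm (\<Sum>n\<in>F. A n (A n x)) \<le> (\<Sum>n\<in>F. (\<alpha> n)\<^sup>2 * norm x)"
        by (rule order_trans[OF norm_sum]) (use F in \<open>auto intro!: sum_mono le4\<close>)
      also have "\<dots> = (\<Sum>n\<in>F. (\<alpha> n)\<^sup>2) * norm x" by (simp add: sum_distrib_right)
      also have "\<dots> \<le> a\<^sup>2 * norm x" by (intro mult_right_mono a2 F) auto
      finally show ?thesis .
    qed
    have "(\<Sum>n\<in>F. P n x) = (\<Sum>n\<in>F. P0 n x + A n (P0 n x) + P0 n (A n x) + A n (A n x))"
      using F split by (intro sum.cong) auto
    also have "\<dots> = (\<Sum>n\<in>F. P0 n x) + (\<Sum>n\<in>F. A n (P0 n x)) + (\<Sum>n\<in>F. P0 n (A n x)) + (\<Sum>n\<in>F. A n (A n x))"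
      by (simp add: sum.distrib)
    also have "norm \<dots> \<le> norm x + a * norm x + a * norm x + a\<^sup>2 * norm x"
      by (intro order_trans[OF norm_triangle_ineq] add_mono b1 b2 b3 b4)
    finally show "norm (\<Sum>n\<in>F. P n x) \<le> (1 + a + a + a\<^sup>2) * norm x" by (simp add: algebra_simps)
  qed
qed

section \<open>Square summability of the distances between the projections\<close>

context perturbed_diagonal
begin

text \<open>The pair \<open>p\<close> holds the offsets of the row and the column frequency from
  \<open>n\<close>. Up to a constant, the sum \<open>hs n\<close> of these terms bounds the squared
  Hilbert-Schmidt norm of R0 V R0 on the circle about \<open>n\<close>.\<close>

definition hs_term :: "int \<Rightarrow> int \<times> int \<Rightarrow> real" where
  "hs_term n p = inv_sq (fst p) * inv_sq (snd p) * (w (2 * n + fst p + snd p))\<^sup>2"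

definition hs :: "int \<Rightarrow> real" where "hs n = infsum (hs_term n) UNIV"

lemma hs_term_nonneg: "0 \<le> hs_term n p"
  by (simp add: hs_term_def inv_sq_nonneg)

lemma hs_nonneg: "0 \<le> hs n"
  unfolding hs_def by (rule infsum_nonneg) (rule hs_term_nonneg)

text \<open>\<open>X\<close> is enlarged to a box so that the sum over \<open>n\<close> can be taken
  first; \<open>2 * n + s\<close> is injective in \<open>n\<close>, hence that sum is at most the
  square sum of \<open>w\<close> for all offsets.\<close>

lemma hs_term_sum_le:
  assumes "finite X"
  shows "(\<Sum>x\<in>X. hs_term (fst x) (snd x)) \<le> inv_sq_sum\<^sup>2 * infsum (\<lambda>m. (w m)\<^sup>2) UNIV"
proof -
  let ?A = "fst ` X" and ?B = "fst ` snd ` X" and ?C = "snd ` snd ` X"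
  have fin: "finite ?A" "finite ?B" "finite ?C" using assms by auto
  have "(\<Sum>x\<in>X. hs_term (fst x) (snd x)) \<le> (\<Sum>x\<in>?A \<times> (?B \<times> ?C). hs_term (fst x) (snd x))"
  proof (rule sum_mono2)
    show "X \<subseteq> ?A \<times> (?B \<times> ?C)" by (force simp: image_iff)
  qed (use fin hs_term_nonneg in auto)
  also have "\<dots> = (\<Sum>n\<in>?A. \<Sum>p\<in>?B \<times> ?C. hs_term n p)" by (simp add: sum.cartesian_product case_prod_unfold)
  also have "\<dots> = (\<Sum>p\<in>?B \<times> ?C. inv_sq (fst p) * inv_sq (snd p) * (\<Sum>n\<in>?A. (w (2 * n + (fst p + snd p)))\<^sup>2))"
    by (subst sum.swap) (simp add: hs_term_def sum_distrib_left add.assoc)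
  also have "\<dots> \<le> (\<Sum>p\<in>?B \<times> ?C. inv_sq (fst p) * inv_sq (snd p) * infsum (\<lambda>m. (w m)\<^sup>2) UNIV)"
  proof (intro sum_mono mult_left_mono)
    fix p :: "int \<times> int"
    show "(\<Sum>n\<in>?A. (w (2 * n + (fst p + snd p)))\<^sup>2) \<le> infsum (\<lambda>m. (w m)\<^sup>2) UNIV"
      by (rule sum_shift_le_infsum[OF w_sq]) (use fin in \<open>auto simp: inj_on_def\<close>)
  qed (simp add: inv_sq_nonneg)
  also have "\<dots> = (\<Sum>i\<in>?B. inv_sq i) * (\<Sum>i\<in>?C. inv_sq i) * infsum (\<lambda>m. (w m)\<^sup>2) UNIV"
    by (simp add: sum_product sum.cartesian_product case_prod_unfold flip: sum_distrib_right)
  also have "\<dots> \<le> inv_sq_sum * inv_sq_sum * infsum (\<lambda>m. (w m)\<^sup>2) UNIV"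
    unfolding inv_sq_sum_def using fin inv_sq_nonneg inv_sq_summable
    by (intro mult_right_mono mult_mono finite_sum_le_infsum) (auto intro: sum_nonneg infsum_nonneg)
  finally show ?thesis by (simp add: power2_eq_square)
qed

lemma hs_term_summable: "hs_term n summable_on UNIV"
proof (rule nonneg_summable_onI[where C = "inv_sq_sum\<^sup>2 * infsum (\<lambda>m. (w m)\<^sup>2) UNIV"])
  fix X :: "(int \<times> int) set" assume "finite X"
  then have "(\<Sum>x\<in>Pair n ` X. hs_term (fst x) (snd x)) \<le> inv_sq_sum\<^sup>2 * infsum (\<lambda>m. (w m)\<^sup>2) UNIV"
    by (intro hs_term_sum_le) auto
  then show "sum (hs_term n) X \<le> inv_sq_sum\<^sup>2 * infsum (\<lambda>m. (w m)\<^sup>2) UNIV"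
    by (simp add: sum.reindex inj_on_def)
qed (rule hs_term_nonneg)

lemma hs_summable: "hs summable_on UNIV"
proof -
  have "(\<lambda>x. hs_term (fst x) (snd x)) summable_on UNIV"
    by (rule nonneg_summable_onI[OF hs_term_nonneg hs_term_sum_le])
  then have "(\<lambda>(n, p). hs_term n p) summable_on (UNIV \<times> UNIV)" by (simp add: case_prod_unfold)
  then have "(\<lambda>n. infsum (hs_term n) UNIV) summable_on UNIV" by (rule summable_on_Sigma_banach)
  then show ?thesis by (simp add: hs_def[abs_def])
qed

lemma circle_quarter_far:
  assumes "n \<in> G" "cmod (z - of_int n) = 1 / 4"
  shows "far z" and "(1 / cmod (z - of_int m))\<^sup>2 \<le> 64 * inv_sq (m - n)"
proof -
  \<comment> \<open>On the circle \<open>cmod (z - of_int m)\<close> is at least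
    \<open>\<bar>m - n\<bar> - 1 / 4\<close>, which dominates the claimed eighth as soon as
    \<open>\<bar>m - n\<bar> \<ge> 1\<close>; for \<open>m = n\<close> the claim is 1/8 against
    1/4.\<close>
  have ge: "(1 + real_of_int \<bar>m - n\<bar>) / 8 \<le> cmod (z - of_int m)" for m
  proof (cases "m = n")
    case False
    then have "\<bar>m - n\<bar> \<ge> 1" by simp
    then have 1: "1 \<le> real_of_int \<bar>m - n\<bar>" by linarith
    have "real_of_int \<bar>m - n\<bar> = cmod (of_int (m - n))" by (simp only: norm_of_int of_int_abs)
    also have "of_int (m - n) = (z - of_int n) - (z - of_int m :: complex)" by simp
    also have "cmod \<dots> \<le> 1 / 4 + cmod (z - of_int m)"
      using norm_triangle_ineq4[of "z - of_int n" "z - of_int m"] assms by simp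
    finally have 2: "real_of_int \<bar>m - n\<bar> \<le> 1 / 4 + cmod (z - of_int m)" .
    have "(1 + x) / 8 \<le> y" if "1 \<le> x" "x \<le> 1 / 4 + y" for x y :: real using that by simp
    from this[OF 1 2] show ?thesis .
  qed (use assms in simp)
  show "far z" unfolding far_def
  proof
    fix m
    have "1 / 8 \<le> y" if "0 \<le> x" "(1 + x) / 8 \<le> y" for x y :: real using that by simp
    from this[OF _ ge] show "1 / 8 \<le> cmod (z - of_int m)" by simp
  qed
  have "1 / cmod (z - of_int m) \<le> 1 / ((1 + real_of_int \<bar>m - n\<bar>) / 8)"
    using ge[of m] by (intro divide_left_mono mult_pos_pos) (auto intro: less_le_trans[rotated])
  then have "(1 / cmod (z - of_int m))\<^sup>2 \<le> (8 / (1 + real_of_int \<bar>m - n\<bar>))\<^sup>2" by (intro power_mono) auto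
  then show "(1 / cmod (z - of_int m))\<^sup>2 \<le> 64 * inv_sq (m - n)" by (simp add: inv_sq_def power_divide)
qed

text \<open>The square of 128 is \<open>64\<^sup>2 * 4\<close>: one factor 64 for each of the two
  free resolvents and one factor 2 for the branches of each index.\<close>

lemma R0_T_norm:
  assumes n: "n \<in> G" "cmod (z - of_int n) = 1 / 4"
  shows "norm (R0 z (T z f)) \<le> 128 * sqrt (hs n) * norm f"
proof (rule hilbert_schmidt_bound[OF R0_T_coef[OF far_not_in[OF circle_quarter_far(1)[OF n]]]])
  fix F K assume F: "finite F" "F \<subseteq> J" and K: "finite K" "K \<subseteq> J"
  let ?q = "\<lambda>m. inv_sq (m - n)"
  let ?F = "fst ` F" and ?K = "fst ` K"
  have "(\<Sum>j\<in>F. \<Sum>k\<in>K. (cmod (cin (e k) (h j) / ((z - of_int (fst j)) * (z - of_int (fst k)))))\<^sup>2)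
      \<le> (\<Sum>j\<in>F. \<Sum>k\<in>K. 64\<^sup>2 * (?q (fst j) * (?q (fst k) * (w (fst j + fst k))\<^sup>2)))"
  proof (intro sum_mono)
    fix j k assume "j \<in> F" "k \<in> K"
    then have "(cmod (cin (e k) (h j)))\<^sup>2 \<le> (w (fst j + fst k))\<^sup>2"
      using F K by (intro power_mono h_bound) auto
    moreover have "(1 / cmod (z - of_int (fst j)))\<^sup>2 * (1 / cmod (z - of_int (fst k)))\<^sup>2
        \<le> (64 * ?q (fst j)) * (64 * ?q (fst k))"
      by (rule mult_mono[OF circle_quarter_far(2)[OF n] circle_quarter_far(2)[OF n]]) (simp_all add: inv_sq_nonneg)
    ultimately have "(cmod (cin (e k) (h j)))\<^sup>2 * ((1 / cmod (z - of_int (fst j)))\<^sup>2 * (1 / cmod (z - of_int (fst k)))\<^sup>2)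
        \<le> (w (fst j + fst k))\<^sup>2 * ((64 * ?q (fst j)) * (64 * ?q (fst k)))"
      by (rule mult_mono) simp_all
    then show "(cmod (cin (e k) (h j) / ((z - of_int (fst j)) * (z - of_int (fst k)))))\<^sup>2
        \<le> 64\<^sup>2 * (?q (fst j) * (?q (fst k) * (w (fst j + fst k))\<^sup>2))"
      by (simp add: norm_divide norm_mult power_divide power_mult_distrib mult_ac)
  qed
  also have "\<dots> = 64\<^sup>2 * (\<Sum>j\<in>F. ?q (fst j) * (\<Sum>k\<in>K. ?q (fst k) * (w (fst j + fst k))\<^sup>2))"
    by (simp add: sum_distrib_left)
  also have "(\<Sum>j\<in>F. ?q (fst j) * (\<Sum>k\<in>K. ?q (fst k) * (w (fst j + fst k))\<^sup>2))
      \<le> (\<Sum>j\<in>F. ?q (fst j) * (2 * (\<Sum>k\<in>?K. ?q k * (w (fst j + k))\<^sup>2)))"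
  proof (intro sum_mono mult_left_mono)
    fix j :: "int \<times> bool"
    show "(\<Sum>k\<in>K. ?q (fst k) * (w (fst j + fst k))\<^sup>2) \<le> 2 * (\<Sum>k\<in>?K. ?q k * (w (fst j + k))\<^sup>2)"
      by (rule sum_fst_le[where g = "\<lambda>k. ?q k * (w (fst j + k))\<^sup>2"]) (use K in \<open>auto simp: inv_sq_nonneg\<close>)
  qed (simp add: inv_sq_nonneg)
  also have "\<dots> \<le> 2 * (\<Sum>j\<in>?F. ?q j * (2 * (\<Sum>k\<in>?K. ?q k * (w (j + k))\<^sup>2)))"
    by (rule sum_fst_le[where g = "\<lambda>j. ?q j * (2 * (\<Sum>k\<in>?K. ?q k * (w (j + k))\<^sup>2))"])
      (use F in \<open>auto simp: inv_sq_nonneg intro!: mult_nonneg_nonneg sum_nonneg\<close>)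
  also have "\<dots> = 4 * (\<Sum>p\<in>?F \<times> ?K. ?q (fst p) * (?q (snd p) * (w (fst p + snd p))\<^sup>2))"
    by (simp add: sum_distrib_left sum.cartesian_product case_prod_unfold mult_ac)
  also have "(\<Sum>p\<in>?F \<times> ?K. ?q (fst p) * (?q (snd p) * (w (fst p + snd p))\<^sup>2))
      = (\<Sum>p\<in>(\<lambda>p. (fst p - n, snd p - n)) ` (?F \<times> ?K). hs_term n p)"
    by (subst sum.reindex) (auto simp: inj_on_def hs_term_def mult.assoc intro!: sum.cong)
  also have "\<dots> \<le> hs n"
    unfolding hs_def using F K by (intro finite_sum_le_infsum hs_term_summable) (auto simp: hs_term_nonneg)
  finally show "(\<Sum>j\<in>F. \<Sum>k\<in>K. (cmod (cin (e k) (h j) / ((z - of_int (fst j)) * (z - of_int (fst k)))))\<^sup>2)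
      \<le> (128 * sqrt (hs n))\<^sup>2"
    using hs_nonneg by (simp add: power_mult_distrib)
qed (use hs_nonneg in auto)

definition P0 :: "int \<Rightarrow> 'a \<Rightarrow> 'a" where
  "P0 n f = (\<Sum>j\<in>{n} \<times> B. cin f (e j) *\<^sub>C e j)"

lemma P0_coef:
  assumes "n \<in> G" "j \<in> J"
  shows "cin (P0 n f) (e j) = (if fst j = n then cin f (e j) else 0)"
  unfolding P0_def using assms by (subst cin_lincomb) auto

lemma P0_diff: "P0 n (f - g) = P0 n f - P0 n g"
  by (simp add: P0_def cin_diff_left scaleC_diff_left sum_subtractf)

lemma P0_idem: "n \<in> G \<Longrightarrow> P0 n (P0 n f) = P0 n f"
  by (rule coef_eqI) (auto simp: P0_coef)

lemma P0_sum_lincomb: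
  assumes "finite F" "F \<subseteq> G"
  shows "(\<Sum>n\<in>F. P0 n (y n)) = (\<Sum>j\<in>F \<times> B. cin (y (fst j)) (e j) *\<^sub>C e j)"
  using assms by (simp add: P0_def sum.cartesian_product' )

lemma P0_norm_sq: "n \<in> G \<Longrightarrow> (norm (P0 n f))\<^sup>2 = (\<Sum>j\<in>{n} \<times> B. (cmod (cin f (e j)))\<^sup>2)"
  unfolding P0_def by (subst norm_lincomb_sq) auto

lemma P0_orth:
  assumes "finite F" "F \<subseteq> G"
  shows "(norm (\<Sum>n\<in>F. P0 n (y n)))\<^sup>2 = (\<Sum>n\<in>F. (norm (P0 n (y n)))\<^sup>2)"
proof -
  have "F \<times> B \<subseteq> J" "finite (F \<times> B)" using assms by auto
  then have "(norm (\<Sum>n\<in>F. P0 n (y n)))\<^sup>2 = (\<Sum>j\<in>F \<times> B. (cmod (cin (y (fst j)) (e j)))\<^sup>2)"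
    unfolding P0_sum_lincomb[OF assms] by (intro norm_lincomb_sq)
  also have "\<dots> = (\<Sum>n\<in>F. \<Sum>j\<in>{n} \<times> B. (cmod (cin (y n) (e j)))\<^sup>2)"
    by (simp add: sum.cartesian_product')
  also have "\<dots> = (\<Sum>n\<in>F. (norm (P0 n (y n)))\<^sup>2)"
    using assms by (intro sum.cong) (auto simp: P0_norm_sq)
  finally show ?thesis .
qed

lemma P0_bessel:
  assumes "finite F" "F \<subseteq> G"
  shows "(\<Sum>n\<in>F. (norm (P0 n f))\<^sup>2) \<le> (norm f)\<^sup>2"
proof -
  have "(\<Sum>n\<in>F. (norm (P0 n f))\<^sup>2) = (\<Sum>n\<in>F. \<Sum>j\<in>{n} \<times> B. (cmod (cin f (e j)))\<^sup>2)"
    using assms by (intro sum.cong) (auto simp: P0_norm_sq)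
  also have "\<dots> = (\<Sum>j\<in>F \<times> B. (cmod (cin f (e j)))\<^sup>2)" by (simp add: sum.cartesian_product')
  also have "\<dots> \<le> (norm f)\<^sup>2" using assms by (intro bessel) auto
  finally show ?thesis .
qed

lemma R0_apply_continuous: "continuous_on {z. far z} (\<lambda>z. R0 z f)"
proof (rule lipschitz_imp_continuous_on[where k = "64 * norm f"])
  fix z v assume z: "z \<in> {z. far z}" and v: "v \<in> {z. far z}"
  have "R0 z f - R0 v f = (v - z) *\<^sub>C R0 z (R0 v f)"
  proof (rule coef_eqI)
    fix j assume j: "j \<in> J"
    have "z - of_int (fst j) \<noteq> 0" "v - of_int (fst j) \<noteq> 0"
      using far_not_in[of z] far_not_in[of v] z v j by auto
    then show "cin (R0 z f - R0 v f) (e j) = cin ((v - z) *\<^sub>C R0 z (R0 v f)) (e j)"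
      using far_not_in[of z] far_not_in[of v] z v j
      by (simp add: cin_diff_left cin_scaleC_left R0_coef) (simp add: field_simps)
  qed
  then have "norm (R0 z f - R0 v f) = cmod (z - v) * norm (R0 z (R0 v f))"
    by (simp add: norm_scaleC norm_minus_commute)
  also have "\<dots> \<le> cmod (z - v) * (8 * (8 * norm f))"
    using R0_norm_far[of z "R0 v f"] R0_norm_far[of v f] z v by (intro mult_left_mono) auto
  finally show "norm (R0 z f - R0 v f) \<le> 64 * norm f * cmod (z - v)" by (simp add: mult_ac)
qed

lemma sphere_far:
  assumes "n \<in> G"
  shows "sphere (of_int n) (1 / 4) \<subseteq> {z. far z}"
  using circle_quarter_far(1)[OF assms] by (auto simp: dist_norm norm_minus_commute)

text \<open>Puts \<open>P0 n\<close> into the form of \<open>riesz_cin\<close>, so that the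
  difference of the projections becomes a single integral. The scalar integral is computed for basis
  vectors; the vector \<open>y\<close> carries the identity over to all \<open>g\<close>.\<close>

lemma P0_cin:
  assumes n: "n \<in> G"
  shows "cin (P0 n f) g =
     1 / (2 * of_real pi * \<i>) * contour_integral (circlepath (of_int n) (1 / 4)) (\<lambda>z. cin (R0 z f) g)"
proof -
  let ?c = "circlepath (of_int n) (1 / 4)"
  define y where "y = (1 / (2 * of_real pi * \<i>)) *\<^sub>C vector_contour_integral ?c (\<lambda>z. R0 z f)"
  have y: "cin y u = 1 / (2 * of_real pi * \<i>) * contour_integral ?c (\<lambda>z. cin (R0 z f) u)" for u
    unfolding y_def cin_scaleC_left
    by (subst vector_contour_integral_functional[OF _ _ bounded_linear_cin cin_scaleC_left])
      (use continuous_on_subset[OF R0_apply_continuous sphere_far[OF n]] in auto)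
  have "y = P0 n f"
  proof (rule coef_eqI)
    fix j assume j: "j \<in> J"
    have "contour_integral ?c (\<lambda>z. cin (R0 z f) (e j)) = contour_integral ?c (\<lambda>z. cin f (e j) / (z - of_int (fst j)))"
    proof (rule contour_integral_cong[OF refl])
      fix z assume "z \<in> path_image ?c"
      then have "far z" using sphere_far[OF n] by auto
      then show "cin (R0 z f) (e j) = cin f (e j) / (z - of_int (fst j))"
        using j by (intro R0_coef far_not_in)
    qed
    also have "\<dots> = (if fst j = n then 2 * of_real pi * \<i> * cin f (e j) else 0)"
    proof (cases "fst j = n")
      case True
      then show ?thesis
        using contour_integral_unique[OF Cauchy_integral_circlepath[of "of_int n" "1/4" "\<lambda>_. cin f (e j)" "of_int n"]]
        by simp
    next
      case False
      then have "1 \<le> \<bar>fst j - n\<bar>" by simp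
      then have "1 \<le> cmod (of_int (fst j - n))" by (simp only: norm_of_int)
      then have d: "1 \<le> cmod (of_int (fst j) - of_int n)" by simp
      have "((\<lambda>z. cin f (e j) / (z - of_int (fst j))) has_contour_integral 0) ?c"
      proof (rule Cauchy_theorem_convex_simple[where S = "ball (of_int n) (1/2)"])
        show "(\<lambda>z. cin f (e j) / (z - of_int (fst j))) holomorphic_on ball (of_int n) (1/2)"
          using d by (intro holomorphic_intros) (auto simp: dist_norm norm_minus_commute)
      qed (auto simp: dist_norm)
      then show ?thesis using False by (simp add: contour_integral_unique)
    qed
    finally show "cin y (e j) = cin (P0 n f) (e j)"
      unfolding y using j n by (simp add: P0_coef)
  qed
  then show ?thesis using y by simp
qed

text \<open>32 is a quarter of the 128 in \<open>R0_T_norm\<close>: the circle has length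
  \<open>2 * pi / 4\<close>, and the integral is divided by \<open>2 * pi\<close>. \<open>C\<close>
  bounds the inverse of 1 - T.\<close>

definition \<alpha> :: "int \<Rightarrow> real" where "\<alpha> n = 32 * C * sqrt (hs n)"

lemma \<alpha>_nonneg: "0 \<le> \<alpha> n" using C_pos hs_nonneg by (simp add: \<alpha>_def)

lemma \<alpha>_sq_summable: "(\<lambda>n. (\<alpha> n)\<^sup>2) summable_on I"
proof -
  have "(\<alpha> n)\<^sup>2 = (32 * C)\<^sup>2 * hs n" for n using hs_nonneg by (simp add: \<alpha>_def power_mult_distrib)
  then have "(\<lambda>n. (\<alpha> n)\<^sup>2) summable_on UNIV" using hs_summable by (simp add: summable_on_cmult_right)
  then show ?thesis by (rule summable_on_subset_banach) simp
qed

lemma P_close: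
  assumes n: "n \<in> G" "\<bar>n\<bar> > int N0"
  shows "norm (P n f - P0 n f) \<le> \<alpha> n * norm f"
proof (rule norm_le_cinI)
  fix g
  let ?c = "circlepath (of_int n) (1 / 4)"
  note s = sphere_perforated_int[OF G_nonempty n, of "1/4", simplified]
  have c1: "(\<lambda>z. cin (R z f) g) contour_integrable_on ?c"
    by (rule contour_integrable_continuous_circlepath[OF continuous_on_subset])
      (use s in \<open>auto intro!: bounded_linear.continuous_on[OF bounded_linear_cin] R_apply_continuous\<close>)
  have c2: "(\<lambda>z. cin (R0 z f) g) contour_integrable_on ?c"
    by (rule contour_integrable_continuous_circlepath[OF continuous_on_subset])
      (use sphere_far[OF n(1)] in \<open>auto intro!: bounded_linear.continuous_on[OF bounded_linear_cin] R0_apply_continuous\<close>)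
  have bd: "cmod (cin (R z f) g - cin (R0 z f) g) \<le> 128 * sqrt (hs n) * C * norm f * norm g"
    if z: "cmod (z - of_int n) = 1/4" for z
  proof -
    have "z \<in> perforated G (real N0)" using z s by (auto simp: dist_norm norm_minus_commute)
    then have far: "far z" "cmod z > real N0" using perforated_far by auto
    obtain x where x: "R z f = R0 z x" "x - T z x = f" "norm x \<le> C * norm f"
      using resolvent_R0(2)[OF far, of f] by blast
    have "R0 z x = R0 z (T z x + f)" using x(2) by (simp add: algebra_simps flip: x(2))
    also have "\<dots> = R0 z (T z x) + R0 z f" by (rule R0_add[OF far_not_in[OF far(1)]])
    finally have "R z f - R0 z f = R0 z (T z x)" using x(1) by simp
    then have "cmod (cin (R z f) g - cin (R0 z f) g) \<le> norm (R0 z (T z x)) * norm g"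
      using cin_bound[of "R z f - R0 z f" g] unfolding cin_diff_left[symmetric] by simp
    also have "\<dots> \<le> (128 * sqrt (hs n) * norm x) * norm g"
      by (intro mult_right_mono R0_T_norm n z) auto
    also have "\<dots> \<le> (128 * sqrt (hs n) * (C * norm f)) * norm g"
      using x(3) hs_nonneg by (intro mult_right_mono mult_left_mono) auto
    finally show ?thesis by (simp add: mult.assoc)
  qed
  have "cin (P n f - P0 n f) g = 1 / (2 * of_real pi * \<i>) * contour_integral ?c (\<lambda>z. cin (R z f) g - cin (R0 z f) g)"
    unfolding contour_integral_diff[OF c1 c2] cin_diff_left
    using riesz_cin[OF s, of f g] P0_cin[OF n(1), of f g] by (simp add: right_diff_distrib diff_divide_distrib)
  then have "cmod (cin (P n f - P0 n f) g) = 1 / (2 * pi) * cmod (contour_integral ?c (\<lambda>z. cin (R z f) g - cin (R0 z f) g))"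
    by (simp add: norm_mult norm_divide)
  also have "\<dots> \<le> 1 / (2 * pi) * ((128 * sqrt (hs n) * C * norm f * norm g) * (2 * pi * (1/4)))"
    by (rule mult_left_mono, rule has_contour_integral_bound_circlepath[OF has_contour_integral_integral[OF contour_integrable_diff[OF c1 c2]]])
      (use bd hs_nonneg C_pos in auto)
  finally show "cmod (cin (P n f - P0 n f) g) \<le> \<alpha> n * norm f * norm g" by (simp add: \<alpha>_def mult_ac)
qed (simp add: \<alpha>_nonneg)

abbreviation I :: "int set" where "I \<equiv> {n \<in> G. \<bar>n\<bar> > int N0}"

lemma P_summable: "(\<lambda>n. P n f) summable_on I"
  and P_sums_bounded: "\<exists>K. \<forall>f F. finite F \<longrightarrow> F \<subseteq> I \<longrightarrow> norm (\<Sum>n\<in>F. P n f) \<le> K * norm f"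
proof -
  have "(norm (\<Sum>n\<in>F. P0 n (y n)))\<^sup>2 \<le> (\<Sum>n\<in>F. (norm (P0 n (y n)))\<^sup>2)" if "finite F" "F \<subseteq> I" for F y
  proof -
    have "F \<subseteq> G" using that by blast
    then show ?thesis using P0_orth[of F y] that(1) by simp
  qed
  moreover have "(\<Sum>n\<in>F. (norm (P0 n f))\<^sup>2) \<le> (norm f)\<^sup>2" if "finite F" "F \<subseteq> I" for F f
  proof -
    have "F \<subseteq> G" using that by blast
    then show ?thesis using P0_bessel[of F f] that(1) by simp
  qed
  ultimately show "(\<lambda>n. P n f) summable_on I"
    and "\<exists>K. \<forall>f F. finite F \<longrightarrow> F \<subseteq> I \<longrightarrow> norm (\<Sum>n\<in>F. P n f) \<le> K * norm f"
    using quadratically_close_projections[of I "\<lambda>n. blinfun_apply (P n)" P0 \<alpha>]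
    by (auto simp: blinfun.diff_right P0_diff P_idem P0_idem P_close \<alpha>_nonneg \<alpha>_sq_summable)
qed


section \<open>Large circles and passage to the limit\<close>

lemma R_on_domain:
  assumes z: "z \<in> perforated G (real N0)" and f: "f \<in> D"
  shows "z *\<^sub>C R z f = f + R z (L f)"
proof -
  have zr: "z \<in> resolvent_set D L" using z perforated_in_resolvent_set by auto
  have "R z (z *\<^sub>C f - L f) = f" by (rule resolvent_left_inverse[OF zr f])
  then show ?thesis by (simp add: blinfun.diff_right R_scaleC[OF zr] algebra_simps)
qed

text \<open>In the parametrisation dz = 2 pi i z dt, so the factor \<open>1 / z\<close> in front of
  \<open>R z (L f)\<close> cancels and the remainder is a plain mean over the circle.\<close>

lemma S_on_domain:
  assumes "M \<ge> N0" and f: "f \<in> D"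
  shows "cin (S M f) g = cin f g + integral {0..1} (\<lambda>t. cin (R (circlepath 0 (real M + 1 / 2) t) (L f)) g)"
proof -
  define r where "r = real M + 1 / 2"
  have r: "r > 0" by (simp add: r_def)
  let ?c = "circlepath 0 r"
  define k where "k = 1 / (2 * complex_of_real pi * \<i>)"
  define \<psi> where "\<psi> = (\<lambda>z. cin (R z (L f)) g)"
  have sph: "sphere 0 r \<subseteq> perforated G (real N0)"
    unfolding r_def by (rule sphere_perforated_zero[OF G_nonempty assms(1)])
  have im: "path_image ?c = sphere 0 r" using r by simp
  have cont\<psi>: "continuous_on (sphere 0 r) \<psi>" unfolding \<psi>_def
    by (rule continuous_on_subset[OF _ sph])
      (intro bounded_linear.continuous_on[OF bounded_linear_cin] R_apply_continuous)
  have ne: "z \<noteq> 0" if "z \<in> sphere 0 r" for z :: complex using that r by auto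
  have "cin (S M f) g = k * contour_integral ?c (\<lambda>z. cin (R z f) g)"
    using riesz_cin[OF sph r, of f g] by (simp add: k_def r_def)
  also have "contour_integral ?c (\<lambda>z. cin (R z f) g) = contour_integral ?c (\<lambda>z. cin f g / z + \<psi> z / z)"
  proof (rule contour_integral_cong[OF refl])
    fix z assume "z \<in> path_image ?c"
    then have z: "z \<in> sphere 0 r" by (simp only: im)
    have "z * cin (R z f) g = cin f g + \<psi> z"
      using R_on_domain[OF subsetD[OF sph z] f] unfolding \<psi>_def by (metis cin_add_left cin_scaleC_left)
    then show "cin (R z f) g = cin f g / z + \<psi> z / z" using ne[OF z] by (simp add: field_simps)
  qed
  also have "\<dots> = contour_integral ?c (\<lambda>z. cin f g / z) + contour_integral ?c (\<lambda>z. \<psi> z / z)"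
    by (rule contour_integral_add)
      (rule contour_integrable_continuous_circlepath, unfold im, intro continuous_intros cont\<psi>, auto dest: ne)+
  also have "contour_integral ?c (\<lambda>z. cin f g / z) = 2 * of_real pi * \<i> * cin f g"
    using contour_integral_unique[OF Cauchy_integral_circlepath[of 0 r "\<lambda>_. cin f g" 0]] r by simp
  also have "contour_integral ?c (\<lambda>z. \<psi> z / z) = integral {0..1} (\<lambda>t. 2 * of_real pi * \<i> * \<psi> (?c t))"
    unfolding contour_integral_integral
  proof (rule integral_cong)
    fix t :: real
    have "vector_derivative ?c (at t) = 2 * of_real pi * \<i> * ?c t"
      unfolding vector_derivative_circlepath by (simp add: circlepath)
    moreover have "?c t \<noteq> 0" using r by (simp add: circlepath)
    ultimately show "\<psi> (?c t) / ?c t * vector_derivative ?c (at t) = 2 * of_real pi * \<i> * \<psi> (?c t)"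
      by simp
  qed
  also have "\<dots> = 2 * of_real pi * \<i> * integral {0..1} (\<lambda>t. \<psi> (?c t))" by (rule integral_mult_right)
  finally show ?thesis by (simp add: k_def distrib_left \<psi>_def flip: r_def)
qed

text \<open>Dominated convergence with majorant \<open>8 * K\<close>. The bound by
  \<open>1 / \<bar>Im z\<bar>\<close> fails at the parameters in \<open>E\<close>, where the circle
  meets the real axis; the integrand is set to 0 there. At every other parameter the imaginary part
  grows linearly in \<open>M\<close>.\<close>

lemma S_remainder_tendsto:
  "(\<lambda>M. integral {0..1} (\<lambda>t. cin (R (circlepath 0 (real (M + N0) + 1 / 2) t) u) g)) \<longlonglongrightarrow> 0"
proof -
  define E where "E = {0, 1/2, 1 :: real}"
  define c where "c = (\<lambda>M t. circlepath 0 (real (M + N0) + 1 / 2) t)"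
  define \<psi> where "\<psi> = (\<lambda>z. cin (R z u) g)"
  define f where "f = (\<lambda>M t. if t \<in> E then 0 else \<psi> (c M t))"
  define K where "K = C * norm u * norm g"
  have K: "K \<ge> 0" using C_pos by (simp add: K_def)
  have sph: "sphere 0 (real (M + N0) + 1 / 2) \<subseteq> perforated G (real N0)" for M
    by (rule sphere_perforated_zero[OF G_nonempty]) simp
  have inP: "c M t \<in> perforated G (real N0)" for M t
  proof -
    have "c M t = of_real (real (M + N0) + 1 / 2) * exp (\<i> * of_real (2 * pi * t))"
      unfolding c_def circlepath by (simp add: mult_ac)
    then have "cmod (c M t) = real (M + N0) + 1 / 2" by (simp only: norm_mult norm_of_real norm_exp_i_times) simp
    then show ?thesis using sph[of M] by auto
  qed
  have int: "(\<lambda>t. \<psi> (c M t)) integrable_on {0..1}" for M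
  proof (rule integrable_continuous_real)
    have "continuous_on (perforated G (real N0)) \<psi>" unfolding \<psi>_def
      by (intro bounded_linear.continuous_on[OF bounded_linear_cin] R_apply_continuous)
    moreover have "continuous_on {0..1} (c M)" unfolding c_def circlepath by (intro continuous_intros)
    ultimately show "continuous_on {0..1} (\<lambda>t. \<psi> (c M t))"
      by (rule continuous_on_compose2) (use inP in auto)
  qed
  have bd: "cmod (\<psi> (c M t)) \<le> 8 * K" for M t
  proof -
    have "cmod (\<psi> (c M t)) \<le> norm (R (c M t) u) * norm g" unfolding \<psi>_def by (rule cin_bound)
    also have "\<dots> \<le> (8 * C * norm u) * norm g" by (intro mult_right_mono R_norm inP) auto
    finally show ?thesis by (simp add: K_def mult_ac)
  qed
  have Im_c: "Im (c M t) = (real (M + N0) + 1 / 2) * sin (2 * pi * t)" for M t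
  proof -
    have "Im (of_real x * exp (\<i> * of_real y)) = x * sin y" for x y by (simp add: Im_exp)
    moreover have "c M t = of_real (real (M + N0) + 1 / 2) * exp (\<i> * of_real (2 * pi * t))"
      unfolding c_def circlepath by (simp add: mult_ac)
    ultimately show ?thesis by (simp only:)
  qed
  have "(\<lambda>M. integral {0..1} (f M)) \<longlonglongrightarrow> integral {0..1} (\<lambda>t::real. 0 :: complex)"
  proof (rule dominated_convergence(2))
    show "f M integrable_on {0..1}" for M
      by (rule integrable_spike_finite[where S = E, OF _ _ int[of M]]) (auto simp: E_def f_def)
    show "(\<lambda>t::real. 8 * K) integrable_on {0..1}" by (intro integrable_continuous_real continuous_intros)
    show "norm (f M t) \<le> 8 * K" for M t using bd[of M t] K by (auto simp: f_def)
    fix t :: real assume t: "t \<in> {0..1}"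
    show "(\<lambda>M. f M t) \<longlonglongrightarrow> 0"
    proof (cases "t \<in> E")
      case False
      have s: "sin (2 * pi * t) \<noteq> 0"
      proof (cases "t < 1/2")
        case True
        then have "sin (2 * pi * t) > 0" using t False by (intro sin_gt_zero) (auto simp: E_def)
        then show ?thesis by simp
      next
        case ge: False
        have "pi * 1 < pi * (2 * t)" using t ge False by (intro mult_strict_left_mono) (auto simp: E_def)
        moreover have "pi * (2 * t) < pi * 2" using t False by (intro mult_strict_left_mono) (auto simp: E_def)
        ultimately have "sin (2 * pi * t) < 0" by (intro sin_lt_zero) (simp_all add: mult_ac)
        then show ?thesis by simp
      qed
      have "norm (f M t) \<le> 2 * K / \<bar>sin (2 * pi * t)\<bar> * inverse (real (Suc M))" for M
      proof -
        let ?I = "\<bar>Im (c M t)\<bar>"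
        have "cmod (\<psi> (c M t)) \<le> norm (R (c M t) u) * norm g" unfolding \<psi>_def by (rule cin_bound)
        also have "\<dots> \<le> (1 / ?I * C * norm u) * norm g"
          using s by (intro mult_right_mono R_norm_imag inP) (auto simp: Im_c)
        also have "\<dots> = K / ?I" by (simp add: K_def)
        also have "\<dots> \<le> K / (real (Suc M) / 2 * \<bar>sin (2 * pi * t)\<bar>)"
          using s K by (intro divide_left_mono mult_pos_pos) (auto simp: Im_c abs_mult intro!: mult_right_mono)
        also have "\<dots> = 2 * K / \<bar>sin (2 * pi * t)\<bar> * inverse (real (Suc M))" by (simp add: field_simps)
        finally show ?thesis using False by (simp add: f_def)
      qed
      moreover have "(\<lambda>M. 2 * K / \<bar>sin (2 * pi * t)\<bar> * inverse (real (Suc M))) \<longlonglongrightarrow> 0"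
        by (rule tendsto_mult_right_zero[OF LIMSEQ_inverse_real_of_nat])
      ultimately show ?thesis by (rule Lim_null_comparison[OF always_eventually[OF allI]])
    qed (simp add: f_def)
  qed
  moreover have "integral {0..1} (f M) = integral {0..1} (\<lambda>t. \<psi> (c M t))" for M
    by (rule integral_spike[where S = E]) (auto simp: E_def f_def)
  ultimately show ?thesis by (simp add: \<psi>_def c_def)
qed

lemma S_weak_limit:
  assumes "f \<in> D"
  shows "(\<lambda>M. cin (S (M + N0) f) g) \<longlonglongrightarrow> cin f g"
proof -
  have "(\<lambda>M. cin f g + integral {0..1} (\<lambda>t. cin (R (circlepath 0 (real (M + N0) + 1 / 2) t) (L f)) g))
      \<longlonglongrightarrow> cin f g + 0"
    by (rule tendsto_add[OF tendsto_const S_remainder_tendsto])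
  then show ?thesis by (simp only: S_on_domain[OF le_add2 assms] add_0_right)
qed

text \<open>The symmetric index sets are finite and eventually contain any given finite subset of
  \<open>I\<close>, so the unconditional sum is also the limit along them.\<close>

lemma S_strong_limit: "(\<lambda>M. S (M + N0) f) \<longlonglongrightarrow> S N0 f + (\<Sum>\<^sub>\<infinity>n\<in>I. P n f)"
proof -
  let ?I = "\<lambda>M. {n\<in>G. int N0 < \<bar>n\<bar> \<and> \<bar>n\<bar> \<le> int M}"
  have "filterlim (\<lambda>M. ?I (M + N0)) (finite_subsets_at_top I) sequentially"
    unfolding filterlim_finite_subsets_at_top
  proof (intro allI impI)
    fix X assume X: "finite X \<and> X \<subseteq> I"
    define m where "m = Max (insert 0 ((\<lambda>n. nat \<bar>n\<bar>) ` X))"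
    have m: "\<bar>n\<bar> \<le> int m" if "n \<in> X" for n
    proof -
      have "nat \<bar>n\<bar> \<le> m" unfolding m_def using X that by (intro Max_ge) auto
      then show ?thesis by simp
    qed
    have "finite (?I (M + N0)) \<and> X \<subseteq> ?I (M + N0) \<and> ?I (M + N0) \<subseteq> I" if "M \<ge> m" for M
    proof (intro conjI)
      show "finite (?I (M + N0))" by (rule finite_subset[of _ "{- int (M + N0)..int (M + N0)}"]) auto
      show "X \<subseteq> ?I (M + N0)"
      proof
        fix n assume n: "n \<in> X"
        then have "n \<in> I" "\<bar>n\<bar> \<le> int m" using X m by auto
        then show "n \<in> ?I (M + N0)" using that by auto
      qed
    qed auto
    then show "\<forall>\<^sub>F M in sequentially. finite (?I (M + N0)) \<and> X \<subseteq> ?I (M + N0) \<and> ?I (M + N0) \<subseteq> I"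
      unfolding eventually_sequentially by blast
  qed
  moreover have "(sum (\<lambda>n. P n f) \<longlongrightarrow> (\<Sum>\<^sub>\<infinity>n\<in>I. P n f)) (finite_subsets_at_top I)"
    using has_sum_infsum[OF P_summable[of f]] unfolding has_sum_def .
  ultimately have "(\<lambda>M. \<Sum>n\<in>?I (M + N0). P n f) \<longlonglongrightarrow> (\<Sum>\<^sub>\<infinity>n\<in>I. P n f)"
    by (rule filterlim_compose[rotated])
  then have "(\<lambda>M. S N0 f + (\<Sum>n\<in>?I (M + N0). P n f)) \<longlonglongrightarrow> S N0 f + (\<Sum>\<^sub>\<infinity>n\<in>I. P n f)"
    by (rule tendsto_add[OF tendsto_const])
  then show ?thesis unfolding S_telescope[OF le_add2] .
qed

theorem spectral_decomposition: "f = S N0 f + (\<Sum>\<^sub>\<infinity>n\<in>I. P n f)"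
proof -
  define Y where "Y = (\<lambda>f. S N0 f + (\<Sum>\<^sub>\<infinity>n\<in>I. P n f))"
  obtain K where K: "\<And>f F. finite F \<Longrightarrow> F \<subseteq> I \<Longrightarrow> norm (\<Sum>n\<in>F. P n f) \<le> K * norm f"
    using P_sums_bounded by blast
  \<comment> \<open>The uniform bound on finite partial sums gives boundedness, which allows the
    identity on \<open>D\<close> to be extended.\<close>
  have "bounded_linear Y"
  proof (rule bounded_linear_intro)
    show "Y (f + g) = Y f + Y g" for f g
      unfolding Y_def by (simp add: blinfun.add_right infsum_add[OF P_summable P_summable])
    show "Y (r *\<^sub>R f) = r *\<^sub>R Y f" for r f
      unfolding Y_def by (simp add: blinfun.scaleR_right infsum_scaleR_right scaleR_add_right)
    fix f
    have "(sum (\<lambda>n. P n f) \<longlongrightarrow> (\<Sum>\<^sub>\<infinity>n\<in>I. P n f)) (finite_subsets_at_top I)"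
      using has_sum_infsum[OF P_summable[of f]] unfolding has_sum_def .
    from tendsto_norm[OF this] have "norm (\<Sum>\<^sub>\<infinity>n\<in>I. P n f) \<le> K * norm f"
      by (rule tendsto_upperbound) (rule eventually_finite_subsets_at_top_weakI, rule K, simp_all)
    moreover have "norm (S N0 f) \<le> norm (S N0) * norm f" by (rule norm_blinfun)
    ultimately have "norm (Y f) \<le> norm (S N0) * norm f + K * norm f"
      unfolding Y_def by (intro order_trans[OF norm_triangle_ineq] add_mono)
    then show "norm (Y f) \<le> norm f * (norm (S N0) + K)" by (simp add: algebra_simps)
  qed
  have Y_D: "Y f = f" if "f \<in> D" for f
  proof (rule cin_eqI)
    fix g
    have "(\<lambda>M. cin (S (M + N0) f) g) \<longlonglongrightarrow> cin (Y f) g"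
      unfolding Y_def by (rule bounded_linear.tendsto[OF bounded_linear_cin S_strong_limit])
    then show "cin (Y f) g = cin f g" using S_weak_limit[OF that] by (rule LIMSEQ_unique)
  qed
  \<comment> \<open>Density of \<open>D\<close> enters through the basis vectors it contains: each
    term of the expansion of \<open>f\<close> is fixed by \<open>Y\<close>.\<close>
  have "((\<lambda>j. Y (cin f (e j) *\<^sub>C e j)) has_sum Y f) J"
    using has_sum_bounded_linear[OF \<open>bounded_linear Y\<close> expansion[of f]] by (simp add: o_def)
  moreover have "Y (cin f (e j) *\<^sub>C e j) = cin f (e j) *\<^sub>C e j" if "j \<in> J" for j
    by (intro Y_D D_scaleC e_in_D that)
  ultimately have "((\<lambda>j. cin f (e j) *\<^sub>C e j) has_sum Y f) J" by (simp cong: has_sum_cong)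
  then have "Y f = f" using expansion by (rule has_sum_unique)
  then show ?thesis by (simp add: Y_def)
qed

theorem spectral_decomposition_exists:
  "\<exists>N::nat. path_image (circlepath 0 (real N + 1 / 2)) \<subseteq> resolvent_set D L \<and>
    (\<forall>n\<in>G. \<bar>n\<bar> > int N \<longrightarrow> path_image (circlepath (of_int n) (1 / 4)) \<subseteq> resolvent_set D L) \<and>
    (\<forall>f. (\<lambda>n. riesz_projection D L (circlepath (of_int n) (1 / 4)) f) summable_on {n \<in> G. \<bar>n\<bar> > int N} \<and>
        f = riesz_projection D L (circlepath 0 (real N + 1 / 2)) f +
            (\<Sum>\<^sub>\<infinity>n\<in>{n \<in> G. \<bar>n\<bar> > int N}. riesz_projection D L (circlepath (of_int n) (1 / 4)) f))"
proof (intro exI[of _ N0] conjI ballI impI allI)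
  show "path_image (circlepath 0 (real N0 + 1 / 2)) \<subseteq> resolvent_set D L"
    using sphere_perforated_zero[OF G_nonempty order_refl, of N0] perforated_in_resolvent_set by auto
  show "path_image (circlepath (of_int n) (1 / 4)) \<subseteq> resolvent_set D L" if "n \<in> G" "\<bar>n\<bar> > int N0" for n
    using sphere_perforated_int[OF G_nonempty that, of "1/4"] perforated_in_resolvent_set by auto
qed (rule P_summable, rule spectral_decomposition)

end

section \<open>Completeness of the space of square integrable functions\<close>

lemma l2_cases:
  obtains f where "f \<in> L2_fun" "u = abs_l2 f"
proof
  show "u = abs_l2 (rep_l2 u)" using Quotient3_abs_rep[OF Quotient3_l2, of u] by simp
  show "rep_l2 u \<in> L2_fun" using Quotient3_rep_reflp[OF Quotient3_l2, of u] by (simp add: l2_rel_def)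
qed

lemma abs_l2_add: "f \<in> L2_fun \<Longrightarrow> g \<in> L2_fun \<Longrightarrow> abs_l2 f + abs_l2 g = abs_l2 (\<lambda>x. f x + g x)"
  by (simp add: plus_l2.abs_eq l2_rel_def)

lemma abs_l2_diff: "f \<in> L2_fun \<Longrightarrow> g \<in> L2_fun \<Longrightarrow> abs_l2 f - abs_l2 g = abs_l2 (\<lambda>x. f x - g x)"
  by (simp add: minus_l2.abs_eq l2_rel_def)

lemma abs_l2_scaleC: "f \<in> L2_fun \<Longrightarrow> a *\<^sub>C abs_l2 f = abs_l2 (\<lambda>x. a * f x)"
  by (simp add: scaleC_l2.abs_eq l2_rel_def)

lemma abs_l2_zero: "0 = abs_l2 (\<lambda>x. 0)"
  by (simp add: zero_l2_def)

lemma inner_abs_l2: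
  "f \<in> L2_fun \<Longrightarrow> g \<in> L2_fun \<Longrightarrow>
     inner (abs_l2 f) (abs_l2 g) = Re ((1 / of_real pi) * (LINT x|leb_pi. f x * cnj (g x)))"
  by (simp add: inner_l2.abs_eq l2_rel_def)

lemma cin_abs_l2:
  assumes "f \<in> L2_fun" "g \<in> L2_fun"
  shows "cin (abs_l2 f) (abs_l2 g) = (1 / of_real pi) * (LINT x|leb_pi. f x * cnj (g x))"
proof -
  have "(LINT x|leb_pi. f x * (\<i> * cnj (g x))) = (LINT x|leb_pi. \<i> * (f x * cnj (g x)))"
    by (rule Bochner_Integration.integral_cong) auto
  also have "\<dots> = \<i> * (LINT x|leb_pi. f x * cnj (g x))" by simp
  finally show ?thesis
    using assms by (simp add: cin_def complex_eq_iff inner_abs_l2 abs_l2_scaleC L2_fun_scale)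
qed

lemma norm_abs_l2_sq:
  assumes "f \<in> L2_fun"
  shows "(norm (abs_l2 f))\<^sup>2 = (LINT x|leb_pi. (cmod (f x))\<^sup>2) / pi"
proof -
  have "(norm (abs_l2 f))\<^sup>2 = Re ((1 / of_real pi) * (LINT x|leb_pi. f x * cnj (f x)))"
    using assms by (simp add: power2_norm_eq_inner inner_abs_l2)
  also have "(LINT x|leb_pi. f x * cnj (f x)) = of_real (LINT x|leb_pi. (cmod (f x))\<^sup>2)"
    by (simp add: complex_norm_square[symmetric] integral_complex_of_real flip: of_real_power)
  finally show ?thesis by (simp flip: of_real_divide)
qed

lemma L2_fun_integrable:
  assumes "f \<in> L2_fun"
  shows "integrable leb_pi f"
  using L2_fun_cinner_integrable[OF assms L2_fun_one] by simp

lemma L2_fun_norm: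
  assumes "f \<in> L2_fun"
  shows "(\<lambda>x. of_real (cmod (f x))) \<in> L2_fun"
proof -
  have [measurable]: "f \<in> borel_measurable leb_pi" using assms by (simp add: L2_fun_def)
  show ?thesis using assms by (simp add: L2_fun_def)
qed

text \<open>Cauchy-Schwarz for \<open>cmod (f x)\<close> and the constant 1, which has norm 1 in the
  normalised product; the factor \<open>pi\<close> undoes that normalisation.\<close>

lemma L1_le_norm_l2:
  assumes f: "f \<in> L2_fun"
  shows "(LINT x|leb_pi. cmod (f x)) \<le> pi * norm (abs_l2 f)"
proof -
  let ?g = "\<lambda>x. complex_of_real (cmod (f x))"
  have g: "?g \<in> L2_fun" by (rule L2_fun_norm[OF f])
  have sq: "(norm (abs_l2 ?g))\<^sup>2 = (norm (abs_l2 f))\<^sup>2" by (simp add: norm_abs_l2_sq f g)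
  then have ng: "norm (abs_l2 ?g) = norm (abs_l2 f)" by simp
  have "(norm (abs_l2 (\<lambda>x. 1)))\<^sup>2 = 1"
    by (simp add: norm_abs_l2_sq L2_fun_one measure_restrict_space)
  then have n1: "norm (abs_l2 (\<lambda>x. 1)) = 1" by (simp add: power2_eq_1_iff) (smt (verit) norm_ge_zero)
  have "inner (abs_l2 ?g) (abs_l2 (\<lambda>x. 1)) = (LINT x|leb_pi. cmod (f x)) / pi"
    by (simp add: inner_abs_l2 g L2_fun_one integral_complex_of_real flip: of_real_divide)
  moreover have "inner (abs_l2 ?g) (abs_l2 (\<lambda>x. 1)) \<le> norm (abs_l2 ?g) * norm (abs_l2 (\<lambda>x. 1))"
    by (rule norm_cauchy_schwarz)
  ultimately have "(LINT x|leb_pi. cmod (f x)) / pi \<le> norm (abs_l2 f)" using ng n1 by simp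
  then show ?thesis by (simp only: pos_divide_le_eq[OF pi_gt_zero] mult.commute[of pi])
qed

text \<open>The Riesz-Fischer argument: a sequence that is Cauchy in mean has a subsequence
  converging almost everywhere, and Fatou's lemma transfers the Cauchy estimate to the pointwise
  limit.\<close>

lemma l2_Cauchy_convergent:
  fixes X :: "nat \<Rightarrow> l2"
  assumes "Cauchy X"
  shows "convergent X"
proof -
  have "\<exists>f. \<forall>n. f n \<in> L2_fun \<and> X n = abs_l2 (f n)"
    by (intro choice allI) (metis l2_cases)
  then obtain f where f: "\<And>n. f n \<in> L2_fun" and X: "\<And>n. X n = abs_l2 (f n)" by blast
  have [measurable]: "f n \<in> borel_measurable leb_pi" for n using f by (simp add: L2_fun_def)
  have dX: "norm (X i - X j) = norm (abs_l2 (\<lambda>x. f i x - f j x))" for i j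
    by (simp add: X abs_l2_diff f)
  have L1: "\<exists>N. \<forall>i\<ge>N. \<forall>j\<ge>N. (LINT x|leb_pi. norm (f i x - f j x)) < e" if "e > 0" for e
  proof -
    have "e / pi > 0" using that by simp
    then obtain N where N: "\<And>i j. i \<ge> N \<Longrightarrow> j \<ge> N \<Longrightarrow> norm (X i - X j) < e / pi"
      using assms unfolding Cauchy_iff by meson
    have "(LINT x|leb_pi. norm (f i x - f j x)) < e" if "i \<ge> N" "j \<ge> N" for i j
    proof -
      have "(LINT x|leb_pi. norm (f i x - f j x)) \<le> pi * norm (X i - X j)"
        unfolding dX by (rule L1_le_norm_l2[OF L2_fun_diff[OF f f]])
      also have "\<dots> < pi * (e / pi)" using N[OF that] by (intro mult_strict_left_mono) auto
      finally show ?thesis by simp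
    qed
    then show ?thesis by blast
  qed
  obtain r where r: "strict_mono r" "AE x in leb_pi. Cauchy (\<lambda>i. f (r i) x)"
    using cauchy_L1_AE_cauchy_subseq[OF L2_fun_integrable[OF f] L1] by blast
  define F where "F = (\<lambda>x. lim (\<lambda>i. f (r i) x))"
  have [measurable]: "F \<in> borel_measurable leb_pi" unfolding F_def by measurable
  have lim: "AE x in leb_pi. (\<lambda>i. f (r i) x) \<longlonglongrightarrow> F x"
    using r(2) by eventually_elim (simp add: F_def Cauchy_convergent_iff convergent_LIMSEQ_iff)
  have close: "\<exists>N. \<forall>n\<ge>N. (\<lambda>x. F x - f n x) \<in> L2_fun \<and> norm (abs_l2 (\<lambda>x. F x - f n x)) \<le> e" if "e > 0" for e
  proof -
    obtain N where N: "\<And>i j. i \<ge> N \<Longrightarrow> j \<ge> N \<Longrightarrow> norm (X i - X j) < e"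
      using assms \<open>e > 0\<close> unfolding Cauchy_iff by meson
    have "(\<lambda>x. F x - f n x) \<in> L2_fun \<and> norm (abs_l2 (\<lambda>x. F x - f n x)) \<le> e" if n: "n \<ge> N" for n
    proof -
      let ?s = "\<lambda>g. \<integral>\<^sup>+x. ennreal ((cmod (g x))\<^sup>2) \<partial>leb_pi"
      have "?s (\<lambda>x. F x - f n x) = (\<integral>\<^sup>+x. liminf (\<lambda>i. ennreal ((cmod (f (r i) x - f n x))\<^sup>2)) \<partial>leb_pi)"
      proof (rule nn_integral_cong_AE)
        show "AE x in leb_pi. ennreal ((cmod (F x - f n x))\<^sup>2) = liminf (\<lambda>i. ennreal ((cmod (f (r i) x - f n x))\<^sup>2))"
          using lim
        proof eventually_elim
          case (elim x)
          have "(\<lambda>i. ennreal ((cmod (f (r i) x - f n x))\<^sup>2)) \<longlonglongrightarrow> ennreal ((cmod (F x - f n x))\<^sup>2)"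
            using elim by (intro tendsto_intros tendsto_ennrealI)
          from lim_imp_Liminf[OF trivial_limit_sequentially this] show ?case by (rule sym)
        qed
      qed
      also have "\<dots> \<le> liminf (\<lambda>i. ?s (\<lambda>x. f (r i) x - f n x))"
        by (rule nn_integral_liminf) measurable
      also have "\<dots> \<le> ennreal (pi * e\<^sup>2)"
      proof (rule Liminf_le)
        show "\<forall>\<^sub>F i in sequentially. ?s (\<lambda>x. f (r i) x - f n x) \<le> ennreal (pi * e\<^sup>2)"
        proof (rule eventually_sequentiallyI)
          fix i assume "N \<le> i"
          then have "N \<le> r i" using seq_suble[OF r(1), of i] by simp
          have d: "(\<lambda>x. f (r i) x - f n x) \<in> L2_fun" by (rule L2_fun_diff[OF f f])
          then have "?s (\<lambda>x. f (r i) x - f n x) = ennreal (LINT x|leb_pi. (cmod (f (r i) x - f n x))\<^sup>2)"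
            by (intro nn_integral_eq_integral) (auto simp: L2_fun_def)
          also have "(LINT x|leb_pi. (cmod (f (r i) x - f n x))\<^sup>2) = pi * (norm (X (r i) - X n))\<^sup>2"
            unfolding dX norm_abs_l2_sq[OF d] by simp
          also have "\<dots> \<le> pi * e\<^sup>2"
            using N[OF \<open>N \<le> r i\<close> n] by (intro mult_left_mono power_mono) auto
          finally show "?s (\<lambda>x. f (r i) x - f n x) \<le> ennreal (pi * e\<^sup>2)" by (simp add: ennreal_leI)
        qed
      qed simp
      finally have le: "?s (\<lambda>x. F x - f n x) \<le> ennreal (pi * e\<^sup>2)" .
      have int: "integrable leb_pi (\<lambda>x. (cmod (F x - f n x))\<^sup>2)"
        by (rule integrableI_nonneg) (use le in \<open>auto simp: less_top[symmetric] top_unique\<close>)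
      then have mem: "(\<lambda>x. F x - f n x) \<in> L2_fun" by (simp add: L2_fun_def)
      have "ennreal (LINT x|leb_pi. (cmod (F x - f n x))\<^sup>2) \<le> ennreal (pi * e\<^sup>2)"
        using le nn_integral_eq_integral[OF int] by simp
      then have "(LINT x|leb_pi. (cmod (F x - f n x))\<^sup>2) \<le> pi * e\<^sup>2" by (subst (asm) ennreal_le_iff) auto
      then have "(norm (abs_l2 (\<lambda>x. F x - f n x)))\<^sup>2 \<le> e\<^sup>2"
        unfolding norm_abs_l2_sq[OF mem] by (simp add: field_simps)
      then show ?thesis using mem \<open>e > 0\<close> by (simp add: power2_le_iff_abs_le)
    qed
    then show ?thesis by blast
  qed
  obtain N1 where "(\<lambda>x. F x - f N1 x) \<in> L2_fun" using close[of 1] by auto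
  then have FL: "F \<in> L2_fun" using L2_fun_add[OF _ f[of N1], of "\<lambda>x. F x - f N1 x"] by simp
  have "X \<longlonglongrightarrow> abs_l2 F"
  proof (rule LIMSEQ_I)
    fix e :: real assume "e > 0"
    then obtain N where N: "\<And>n. n \<ge> N \<Longrightarrow> norm (abs_l2 (\<lambda>x. F x - f n x)) \<le> e / 2"
      using close[of "e / 2"] by auto
    have "norm (X n - abs_l2 F) < e" if "n \<ge> N" for n
      using N[OF that] \<open>e > 0\<close> by (simp add: X abs_l2_diff[OF FL f, symmetric] norm_minus_commute)
    then show "\<exists>N. \<forall>n\<ge>N. norm (X n - abs_l2 F) < e" by blast
  qed
  then show ?thesis by (rule convergentI)
qed

instance l2 :: banach
  by standard (rule l2_Cauchy_convergent)

section \<open>Absolutely continuous functions\<close>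

text \<open>Points where the derivative fails are tagged by intervals inside an open set of small measure;
  absolute continuity bounds their contribution.\<close>

theorem fundamental_theorem_of_calculus_abs_cont:
  fixes f :: "real \<Rightarrow> 'a::banach"
  assumes ab: "a \<le> b" and ac: "abs_cont_on a b f" and N: "negligible N"
    and der: "\<And>x. x \<in> {a..b} - N \<Longrightarrow> (f has_vector_derivative g x) (at x within {a..b})"
  shows "(g has_integral (f b - f a)) {a..b}"
proof -
  \<comment> \<open>With value 0 on \<open>N\<close>, a tag in \<open>N\<close> contributes only the
    increment of \<open>f\<close> over its interval.\<close>
  define g' where "g' = (\<lambda>x. if x \<in> N then 0 else g x)"
  have "(g' has_integral (f b - f a)) (cbox a b)"
    unfolding has_integral
  proof (intro allI impI)
    fix e :: real assume e: "e > 0"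
    \<comment> \<open>Half of \<open>e\<close> spread over the length of the interval; the summand 1
      covers \<open>a = b\<close>.\<close>
    define e1 where "e1 = e / (2 * (b - a + 1))"
    have e1: "e1 > 0" using e ab by (simp add: e1_def)
    obtain \<delta> where \<delta>: "\<delta> > 0" and AC: "\<And>I. finite I \<Longrightarrow> (\<forall>(s, t)\<in>I. a \<le> s \<and> s \<le> t \<and> t \<le> b) \<Longrightarrow>
        disjoint_family_on (\<lambda>(s, t). {s<..<t}) I \<Longrightarrow> (\<Sum>(s, t)\<in>I. t - s) < \<delta> \<Longrightarrow>
        (\<Sum>(s, t)\<in>I. dist (f s) (f t)) < e / 2"
      using ac half_gt_zero[OF e] unfolding abs_cont_on_def by meson
    have Nset: "N \<in> sets lebesgue" and Nnull: "N \<in> null_sets lebesgue"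
      using N negligible_imp_sets negligible_iff_null_sets by auto
    obtain W where W: "open W" "N \<subseteq> W" "emeasure lebesgue (W - N) < ennreal \<delta>"
      using sets_lebesgue_outer_open[OF Nset \<delta>] by blast
    have Wset: "W \<in> sets lebesgue" using W(1) by (simp add: borel_open)
    have eW: "emeasure lebesgue W < ennreal \<delta>" using W(3) emeasure_Diff_null_set[OF Nnull Wset] by simp
    then have Wm: "W \<in> lmeasurable" using Wset by (intro fmeasurableI) (auto simp: less_top[symmetric] intro: order.strict_trans)
    have mW: "measure lebesgue W < \<delta>"
      using eW \<delta> by (simp add: emeasure_eq_measure2[OF Wm] ennreal_less_iff)
    have "\<forall>x. \<exists>d>0. (x \<in> {a..b} - N \<longrightarrow>
         (\<forall>y\<in>{a..b}. norm (y-x) < d \<longrightarrow> norm (f y - f x - (y-x) *\<^sub>R g x) \<le> e1 * norm (y-x))) \<and>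
         (x \<in> N \<longrightarrow> ball x d \<subseteq> W)"
    proof
      fix x
      show "\<exists>d>0. (x \<in> {a..b} - N \<longrightarrow>
         (\<forall>y\<in>{a..b}. norm (y-x) < d \<longrightarrow> norm (f y - f x - (y-x) *\<^sub>R g x) \<le> e1 * norm (y-x))) \<and>
         (x \<in> N \<longrightarrow> ball x d \<subseteq> W)"
      proof (cases "x \<in> N")
        case True
        then obtain d where "d > 0" "ball x d \<subseteq> W" using W openE by blast
        then show ?thesis using True by blast
      next
        case xN: False
        show ?thesis
        proof (cases "x \<in> {a..b}")
          case True
          then show ?thesis
            using der[of x] xN e1 unfolding has_vector_derivative_def has_derivative_within_alt by blast
        qed (use xN in \<open>auto intro: exI[of _ 1]\<close>)
      qed
    qed
    then obtain d where d: "\<And>x. 0 < d x"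
      and d1: "\<And>x y. x \<in> {a..b} - N \<Longrightarrow> y \<in> {a..b} \<Longrightarrow> norm (y-x) < d x \<Longrightarrow>
              norm (f y - f x - (y-x) *\<^sub>R g x) \<le> e1 * norm (y-x)"
      and d2: "\<And>x. x \<in> N \<Longrightarrow> ball x (d x) \<subseteq> W"
      by metis
    show "\<exists>\<gamma>. gauge \<gamma> \<and> (\<forall>p. p tagged_division_of cbox a b \<and> \<gamma> fine p \<longrightarrow>
        norm ((\<Sum>(x, K)\<in>p. measure lborel K *\<^sub>R g' x) - (f b - f a)) < e)"
    proof (intro exI[of _ "\<lambda>x. ball x (d x)"] conjI allI impI)
      show "gauge (\<lambda>x. ball x (d x))" using d gauge_ball_dependent by blast
      fix p assume "p tagged_division_of cbox a b \<and> (\<lambda>x. ball x (d x)) fine p"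
      then have ptag: "p tagged_division_of cbox a b" and fine: "(\<lambda>x. ball x (d x)) fine p" by auto
      have pfin: "finite p" using ptag by blast
      have pK: "\<exists>u v. K = {u..v} \<and> u \<le> v \<and> Inf K = u \<and> Sup K = v \<and> measure lborel K = v - u \<and> a \<le> u \<and> v \<le> b \<and> u \<le> x \<and> x \<le> v
          \<and> {u..v} \<subseteq> ball x (d x)"
        if xK: "(x, K) \<in> p" for x K
      proof -
        have "x \<in> K" "K \<subseteq> cbox a b" using ptag xK by blast+
        moreover obtain u v where k: "K = cbox u v" using ptag xK by blast
        moreover have "K \<subseteq> ball x (d x)" using fine xK by blast
        ultimately show ?thesis by (intro exI[of _ u] exI[of _ v]) auto
      qed
      define jump where "jump = (\<lambda>(x, K). measure lborel K *\<^sub>R g' x - (f (Sup K) - f (Inf K)))"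
      have ba: "b - a = (\<Sum>(x,K)\<in>p. Sup K - Inf K)" "f b - f a = (\<Sum>(x,K)\<in>p. f(Sup K) - f(Inf K))"
        using additive_tagged_division_1[where f= "\<lambda>x. x"] additive_tagged_division_1[where f= f] ab ptag by auto
      have sum_jump: "(\<Sum>(x, K)\<in>p. measure lborel K *\<^sub>R g' x) - (f b - f a) = sum jump p"
        unfolding ba(2) jump_def by (simp add: sum_subtractf case_prod_unfold)
      define p1 where "p1 = {y\<in>p. fst y \<notin> N}"
      define p2 where "p2 = {y\<in>p. fst y \<in> N}"
      \<comment> \<open>Degenerate intervals contribute nothing. Without them the endpoints
        determine the tagged interval, so sums can be reindexed along
        \<open>\<iota>\<close>.\<close>
      define q where "q = {y\<in>p2. Inf (snd y) < Sup (snd y)}"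
      have fin: "finite p1" "finite p2" "finite q" using pfin by (auto simp: p1_def p2_def q_def)
      have "sum jump p = sum jump p1 + sum jump p2"
      proof -
        have "p = p1 \<union> p2" "p1 \<inter> p2 = {}" by (auto simp: p1_def p2_def)
        then show ?thesis using sum.union_disjoint[OF fin(1,2), of jump] by simp
      qed
      then have "norm (sum jump p) \<le> norm (sum jump p1) + norm (sum jump p2)" by (simp add: norm_triangle_ineq)
      moreover have "norm (sum jump p1) \<le> e1 * (b - a)"
      proof -
        have "norm (sum jump p1) \<le> (\<Sum>y\<in>p1. e1 * (Sup (snd y) - Inf (snd y)))"
        proof (rule sum_norm_le)
          fix y assume "y \<in> p1"
          then obtain x K where y: "y = (x, K)" "(x, K) \<in> p" "x \<notin> N" by (cases y) (auto simp: p1_def)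
          from pK[OF y(2)] obtain u v where k: "K = {u..v}" "u \<le> v" "Inf K = u" "Sup K = v" "measure lborel K = v - u"
            "a \<le> u" "v \<le> b" "u \<le> x" "x \<le> v" "{u..v} \<subseteq> ball x (d x)" by blast
          have "u \<in> ball x (d x)" "v \<in> ball x (d x)" using k(2,10) by auto
          then have du: "norm (u - x) < d x" and dv: "norm (v - x) < d x"
            by (simp_all add: dist_norm norm_minus_commute)
          have xab: "x \<in> {a..b} - N" using k y by auto
          have "norm ((v - u) *\<^sub>R g x - (f v - f u)) = norm (f u - f x - (u - x) *\<^sub>R g x - (f v - f x - (v - x) *\<^sub>R g x))"
            by (auto simp: algebra_simps)
          also have "\<dots> \<le> norm (f u - f x - (u - x) *\<^sub>R g x) + norm (f v - f x - (v - x) *\<^sub>R g x)"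
            by (rule norm_triangle_ineq4)
          also have "\<dots> \<le> e1 * norm (u - x) + e1 * norm (v - x)"
            using k xab du dv by (intro add_mono d1) auto
          also have "\<dots> = e1 * (v - u)" using k by (simp add: algebra_simps)
          finally show "norm (jump y) \<le> e1 * (Sup (snd y) - Inf (snd y))"
            using y k by (simp add: jump_def g'_def)
        qed
        also have "\<dots> \<le> (\<Sum>y\<in>p. e1 * (Sup (snd y) - Inf (snd y)))"
        proof (rule sum_mono2[OF pfin])
          fix y assume "y \<in> p - p1"
          then show "0 \<le> e1 * (Sup (snd y) - Inf (snd y))"
            using pK[of "fst y" "snd y"] e1 by fastforce
        qed (auto simp: p1_def)
        also have "\<dots> = e1 * (b - a)" by (simp add: ba(1) sum_distrib_left case_prod_unfold)
        finally show ?thesis .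
      qed
      moreover have "norm (sum jump p2) < e / 2"
      proof -
        define \<iota> where "\<iota> = (\<lambda>y :: real \<times> real set. (Inf (snd y), Sup (snd y)))"
        have jump_p2: "norm (jump y) = dist (f (Inf (snd y))) (f (Sup (snd y)))" if "y \<in> p2" for y
          using that by (simp add: jump_def p2_def g'_def case_prod_unfold dist_norm norm_minus_commute)
        have qp: "(x, K) \<in> p" "x \<in> N" "Inf K < Sup K" if "(x, K) \<in> q" for x K
          using that by (auto simp: q_def p2_def)
        have int_q: "{Inf K<..<Sup K} = interior K" if "(x, K) \<in> q" for x K
        proof -
          from pK[OF qp(1)[OF that]] obtain u v where k: "K = {u..v}" "Inf K = u" "Sup K = v" by blast
          have "interior K = {u<..<v}" by (simp only: k(1) interior_atLeastAtMost_real)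
          then show ?thesis by (simp only: k(2,3))
        qed
        have disj: "{Inf K<..<Sup K} \<inter> {Inf K'<..<Sup K'} = {}" if "(x, K) \<in> q" "(x', K') \<in> q" "(x, K) \<noteq> (x', K')"
          for x K x' K'
          unfolding int_q[OF that(1)] int_q[OF that(2)]
          using tagged_division_ofD(5)[OF ptag qp(1)[OF that(1)] qp(1)[OF that(2)] that(3)] .
        have inj: "inj_on \<iota> q"
        proof (rule inj_onI)
          fix y y' assume yy: "y \<in> q" "y' \<in> q" "\<iota> y = \<iota> y'"
          show "y = y'"
          proof (rule ccontr)
            assume "y \<noteq> y'"
            then have "{Inf (snd y)<..<Sup (snd y)} \<inter> {Inf (snd y')<..<Sup (snd y')} = {}"
              using disj[of "fst y" "snd y" "fst y'" "snd y'"] yy by simp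
            then show False using yy qp(3)[of "fst y" "snd y"] by (simp add: \<iota>_def)
          qed
        qed
        have "norm (sum jump p2) \<le> (\<Sum>y\<in>p2. dist (f (Inf (snd y))) (f (Sup (snd y))))"
          by (rule order_trans[OF norm_sum]) (simp add: jump_p2)
        also have "\<dots> = (\<Sum>y\<in>q. dist (f (Inf (snd y))) (f (Sup (snd y))))"
        proof (rule sum.mono_neutral_right[OF fin(2)])
          show "\<forall>y\<in>p2 - q. dist (f (Inf (snd y))) (f (Sup (snd y))) = 0"
          proof
            fix y assume y: "y \<in> p2 - q"
            then have "(fst y, snd y) \<in> p" by (simp add: p2_def)
            from pK[OF this] y have "Inf (snd y) = Sup (snd y)" by (fastforce simp: q_def)
            then show "dist (f (Inf (snd y))) (f (Sup (snd y))) = 0" by simp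
          qed
        qed (auto simp: q_def)
        also have "\<dots> = (\<Sum>(s, t)\<in>\<iota> ` q. dist (f s) (f t))"
          by (subst sum.reindex[OF inj]) (simp add: \<iota>_def)
        also have "\<dots> < e / 2"
        proof (rule AC)
          show "finite (\<iota> ` q)" using fin by simp
          show "\<forall>(s, t)\<in>\<iota> ` q. a \<le> s \<and> s \<le> t \<and> t \<le> b"
          proof safe
            fix s t x K assume "(s, t) = \<iota> (x, K)" "(x, K) \<in> q"
            then show "a \<le> s" "s \<le> t" "t \<le> b" using pK[OF qp(1)] by (auto simp: \<iota>_def)
          qed
          show dis: "disjoint_family_on (\<lambda>(s, t). {s<..<t}) (\<iota> ` q)"
            unfolding disjoint_family_on_def
          proof (intro ballI impI)
            fix y y' assume "y \<in> \<iota> ` q" "y' \<in> \<iota> ` q" and ne: "y \<noteq> y'"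
            then obtain x K x' K' where qq: "(x, K) \<in> q" "(x', K') \<in> q" and yy: "y = \<iota> (x, K)" "y' = \<iota> (x', K')"
              by (metis imageE prod.exhaust)
            have "(x, K) \<noteq> (x', K')" using ne yy by auto
            from disj[OF qq this] show "(case y of (s, t) \<Rightarrow> {s<..<t}) \<inter> (case y' of (s, t) \<Rightarrow> {s<..<t}) = {}"
              unfolding yy \<iota>_def prod.case snd_conv .
          qed
          have "(\<Sum>(s, t)\<in>\<iota> ` q. t - s) = (\<Sum>y\<in>\<iota> ` q. measure lebesgue (case y of (s, t) \<Rightarrow> {s<..<t}))"
          proof (rule sum.cong[OF refl])
            fix y assume "y \<in> \<iota> ` q"
            then have "fst y \<le> snd y" using qp(3) by (fastforce simp: \<iota>_def)
            then show "(case y of (s, t) \<Rightarrow> t - s) = measure lebesgue (case y of (s, t) \<Rightarrow> {s<..<t})"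
              by (simp add: case_prod_unfold)
          qed
          also have "\<dots> = measure lebesgue (\<Union>y\<in>\<iota> ` q. case y of (s, t) \<Rightarrow> {s<..<t})"
          proof (rule measure_UNION'[symmetric])
            show "pairwise (\<lambda>i j. disjnt (case i of (s, t) \<Rightarrow> {s<..<t}) (case j of (s, t) \<Rightarrow> {s<..<t})) (\<iota> ` q)"
              using dis unfolding disjoint_family_on_def pairwise_def disjnt_def by blast
          qed (use fin in auto)
          also have "\<dots> \<le> measure lebesgue W"
          proof (rule measure_mono_fmeasurable[OF _ _ Wm])
            show "(\<Union>y\<in>\<iota> ` q. case y of (s, t) \<Rightarrow> {s<..<t}) \<subseteq> W"
            proof (rule UN_least)
              fix y assume "y \<in> \<iota> ` q"
              then obtain x K where xK: "(x, K) \<in> q" "y = \<iota> (x, K)" by (metis imageE prod.exhaust)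
              from pK[OF qp(1)[OF xK(1)]] obtain u v where k: "{u..v} \<subseteq> ball x (d x)" "Inf K = u" "Sup K = v" by blast
              have "(case y of (s, t) \<Rightarrow> {s<..<t}) \<subseteq> {u..v}" by (auto simp: xK(2) \<iota>_def k)
              then show "(case y of (s, t) \<Rightarrow> {s<..<t}) \<subseteq> W" using k(1) d2[OF qp(2)[OF xK(1)]] by blast
            qed
          qed (use fin in \<open>auto intro!: sets.finite_UN simp: case_prod_unfold\<close>)
          finally show "(\<Sum>(s, t)\<in>\<iota> ` q. t - s) < \<delta>" using mW by simp
        qed
        finally show ?thesis .
      qed
      moreover have "e1 * (b - a) \<le> e / 2"
      proof -
        have "e1 * (b - a) \<le> e1 * (b - a + 1)" using e1 by simp
        also have "\<dots> = e / 2" using ab by (simp add: e1_def field_simps)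
        finally show ?thesis .
      qed
      ultimately show "norm ((\<Sum>(x, K)\<in>p. measure lborel K *\<^sub>R g' x) - (f b - f a)) < e"
        unfolding sum_jump by linarith
    qed
  qed
  then have "(g' has_integral (f b - f a)) {a..b}" by simp
  then show ?thesis
    by (rule has_integral_spike[OF N, rotated]) (simp add: g'_def)
qed

text \<open>A common source for sums, products and continuously differentiable functions; for the
  last, both \<open>f\<close> and \<open>g\<close> are the identity.\<close>

lemma abs_cont_on_lipschitz_sum:
  fixes f :: "real \<Rightarrow> 'a::metric_space" and g :: "real \<Rightarrow> 'b::metric_space" and h :: "real \<Rightarrow> 'c::metric_space"
  assumes f: "abs_cont_on a b f" and g: "abs_cont_on a b g" and AB: "A > 0" "B > 0"
    and le: "\<And>s t. a \<le> s \<Longrightarrow> s \<le> t \<Longrightarrow> t \<le> b \<Longrightarrow> dist (h s) (h t) \<le> A * dist (f s) (f t) + B * dist (g s) (g t)"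
  shows "abs_cont_on a b h"
  unfolding abs_cont_on_def
proof (intro allI impI)
  fix e :: real assume e: "e > 0"
  have e1: "e / (2 * A) > 0" "e / (2 * B) > 0" using e AB by auto
  obtain \<delta>1 where \<delta>1: "\<delta>1 > 0" "\<And>I. finite I \<Longrightarrow> (\<forall>(s, t)\<in>I. a \<le> s \<and> s \<le> t \<and> t \<le> b) \<Longrightarrow>
        disjoint_family_on (\<lambda>(s, t). {s<..<t}) I \<Longrightarrow> (\<Sum>(s, t)\<in>I. t - s) < \<delta>1 \<Longrightarrow>
        (\<Sum>(s, t)\<in>I. dist (f s) (f t)) < e / (2 * A)"
    using f e1(1) unfolding abs_cont_on_def by meson
  obtain \<delta>2 where \<delta>2: "\<delta>2 > 0" "\<And>I. finite I \<Longrightarrow> (\<forall>(s, t)\<in>I. a \<le> s \<and> s \<le> t \<and> t \<le> b) \<Longrightarrow>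
        disjoint_family_on (\<lambda>(s, t). {s<..<t}) I \<Longrightarrow> (\<Sum>(s, t)\<in>I. t - s) < \<delta>2 \<Longrightarrow>
        (\<Sum>(s, t)\<in>I. dist (g s) (g t)) < e / (2 * B)"
    using g e1(2) unfolding abs_cont_on_def by meson
  show "\<exists>\<delta>>0. \<forall>I. finite I \<longrightarrow> (\<forall>(s, t)\<in>I. a \<le> s \<and> s \<le> t \<and> t \<le> b) \<longrightarrow>
        disjoint_family_on (\<lambda>(s, t). {s<..<t}) I \<longrightarrow> (\<Sum>(s, t)\<in>I. t - s) < \<delta> \<longrightarrow> (\<Sum>(s, t)\<in>I. dist (h s) (h t)) < e"
  proof (intro exI[of _ "min \<delta>1 \<delta>2"] conjI allI impI)
    fix I assume I: "finite I" "\<forall>(s, t)\<in>I. a \<le> s \<and> s \<le> t \<and> t \<le> b"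
      "disjoint_family_on (\<lambda>(s, t). {s<..<t}) I" "(\<Sum>(s, t)\<in>I. t - s) < min \<delta>1 \<delta>2"
    have "(\<Sum>(s, t)\<in>I. dist (h s) (h t)) \<le> (\<Sum>(s, t)\<in>I. A * dist (f s) (f t) + B * dist (g s) (g t))"
      using I(2) le by (intro sum_mono) fastforce
    also have "\<dots> = A * (\<Sum>(s, t)\<in>I. dist (f s) (f t)) + B * (\<Sum>(s, t)\<in>I. dist (g s) (g t))"
      by (simp add: sum.distrib sum_distrib_left case_prod_unfold)
    also have "\<dots> < A * (e / (2 * A)) + B * (e / (2 * B))"
      using I AB by (intro add_strict_mono mult_strict_left_mono \<delta>1 \<delta>2) auto
    also have "\<dots> = e" using AB by simp
    finally show "(\<Sum>(s, t)\<in>I. dist (h s) (h t)) < e" .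
  qed (use \<delta>1 \<delta>2 in simp)
qed

lemma abs_cont_on_id: "abs_cont_on a b (\<lambda>x::real. x)"
  unfolding abs_cont_on_def
proof (intro allI impI)
  fix e :: real assume e: "e > 0"
  show "\<exists>\<delta>>0. \<forall>I. finite I \<longrightarrow> (\<forall>(s, t)\<in>I. a \<le> s \<and> s \<le> t \<and> t \<le> b) \<longrightarrow>
        disjoint_family_on (\<lambda>(s, t). {s<..<t}) I \<longrightarrow> (\<Sum>(s, t)\<in>I. t - s) < \<delta> \<longrightarrow> (\<Sum>(s, t)\<in>I. dist s t) < e"
  proof (intro exI[of _ e] conjI allI impI e)
    fix I :: "(real \<times> real) set" assume I: "\<forall>(s, t)\<in>I. a \<le> s \<and> s \<le> t \<and> t \<le> b" "(\<Sum>(s, t)\<in>I. t - s) < e"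
    have "(\<Sum>(s, t)\<in>I. dist s t) = (\<Sum>(s, t)\<in>I. t - s)"
      by (rule sum.cong) (use I(1) in \<open>auto simp: dist_real_def\<close>)
    then show "(\<Sum>(s, t)\<in>I. dist s t) < e" using I(2) by simp
  qed
qed

lemma abs_cont_on_mult:
  fixes f g :: "real \<Rightarrow> 'a::real_normed_algebra"
  assumes f: "abs_cont_on a b f" and g: "abs_cont_on a b g"
  shows "abs_cont_on a b (\<lambda>x. f x * g x)"
proof -
  have bd: "\<exists>M>0. \<forall>x\<in>{a..b}. norm (u x) \<le> M" if u: "abs_cont_on a b u" for u :: "real \<Rightarrow> 'a"
  proof -
    have "bounded (u ` {a..b})"
      using abs_cont_on_continuous[OF u] compact_continuous_image compact_imp_bounded by blast
    then show ?thesis unfolding bounded_pos by auto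
  qed
  obtain A B where A: "A > 0" "\<And>x. x \<in> {a..b} \<Longrightarrow> norm (f x) \<le> A"
    and B: "B > 0" "\<And>x. x \<in> {a..b} \<Longrightarrow> norm (g x) \<le> B" using bd[OF f] bd[OF g] by blast
  show ?thesis
  proof (rule abs_cont_on_lipschitz_sum[OF f g B(1) A(1)])
    fix s t assume st: "a \<le> s" "s \<le> t" "t \<le> b"
    have "f s * g s - f t * g t = (f s - f t) * g s + f t * (g s - g t)" by (simp add: algebra_simps)
    then have "dist (f s * g s) (f t * g t) \<le> norm (f s - f t) * norm (g s) + norm (f t) * norm (g s - g t)"
      unfolding dist_norm by (metis norm_triangle_mono norm_mult_ineq)
    also have "\<dots> \<le> norm (f s - f t) * B + A * norm (g s - g t)"
      using st by (intro add_mono mult_left_mono mult_right_mono A B) auto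
    finally show "dist (f s * g s) (f t * g t) \<le> B * dist (f s) (f t) + A * dist (g s) (g t)"
      by (simp add: dist_norm mult.commute)
  qed
qed

lemma abs_cont_on_C1:
  fixes f :: "real \<Rightarrow> 'a::real_normed_vector"
  assumes der: "\<And>x. x \<in> {a..b} \<Longrightarrow> (f has_vector_derivative f' x) (at x within {a..b})"
    and cont: "continuous_on {a..b} f'"
  shows "abs_cont_on a b f"
proof -
  have "bounded (f' ` {a..b})" using cont compact_continuous_image compact_imp_bounded by blast
  then obtain M where M: "M > 0" "\<And>x. x \<in> {a..b} \<Longrightarrow> norm (f' x) \<le> M" unfolding bounded_pos by auto
  show ?thesis
  proof (rule abs_cont_on_lipschitz_sum[OF abs_cont_on_id abs_cont_on_id M(1) M(1)])
    fix s t assume st: "a \<le> s" "s \<le> t" "t \<le> b"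
    have "norm (f s - f t) \<le> M * norm (s - t)"
    proof (rule differentiable_bound[where S = "{a..b}" and f' = "\<lambda>x h. h *\<^sub>R f' x"])
      show "(f has_derivative (\<lambda>h. h *\<^sub>R f' x)) (at x within {a..b})" if "x \<in> {a..b}" for x
        using der[OF that] by (simp add: has_vector_derivative_def)
      show "onorm (\<lambda>h. h *\<^sub>R f' x) \<le> M" if "x \<in> {a..b}" for x
      proof (rule onorm_le)
        fix h :: real
        show "norm (h *\<^sub>R f' x) \<le> M * norm h"
          using mult_right_mono[OF M(2)[OF that], of "\<bar>h\<bar>"] by (simp add: mult.commute)
      qed
    qed (use st in auto)
    then show "dist (f s) (f t) \<le> M * dist s t + M * dist s t"
      using M(1) by (simp add: dist_norm) (smt (verit) mult_nonneg_nonneg norm_ge_zero abs_ge_zero)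
  qed
qed

section \<open>Almost everywhere derivatives and indefinite integrals\<close>

lemma AE_leb_piI:
  assumes "negligible N" "\<And>x. x \<in> {0..pi} \<Longrightarrow> x \<notin> N \<Longrightarrow> Q x"
  shows "AE x in leb_pi. Q x"
proof -
  have "AE x in lebesgue. x \<in> {0..pi} \<longrightarrow> Q x"
    by (rule AE_I'[of N]) (use assms in \<open>auto simp: negligible_iff_null_sets\<close>)
  then show ?thesis by (simp add: AE_restrict_space_iff)
qed

lemma AE_leb_piE:
  assumes "AE x in leb_pi. Q x"
  obtains N where "negligible N" "\<And>x. x \<in> {0..pi} \<Longrightarrow> x \<notin> N \<Longrightarrow> Q x"
proof -
  have "AE x in lebesgue. x \<in> {0..pi} \<longrightarrow> Q x" using assms by (simp add: AE_restrict_space_iff)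
  then obtain N where "N \<in> null_sets lebesgue" "{x. \<not> (x \<in> {0..pi} \<longrightarrow> Q x)} \<subseteq> N"
    unfolding eventually_ae_filter by auto
  then show thesis using that[of N] by (auto simp: negligible_iff_null_sets)
qed

text \<open>The library's one-sided Lebesgue differentiation theorem is applied to \<open>f\<close> and to its reflection.\<close>

lemma indefinite_integral_derivative_ae:
  fixes f :: "real \<Rightarrow> complex"
  assumes f: "f integrable_on {a..b}"
  obtains N where "negligible N"
    "\<And>x. x \<in> {a..b} - N \<Longrightarrow> ((\<lambda>x. integral {a..x} f) has_vector_derivative f x) (at x within {a..b})"
proof -
  \<comment> \<open>Extension by 0 makes the averages to the right and to the left of
    \<open>x\<close> meaningful up to both ends of the interval.\<close>
  define f0 where "f0 = (\<lambda>x. if x \<in> {a..b} then f x else 0)"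
  have int0: "f0 integrable_on UNIV" unfolding f0_def by (rule integrable_restrict_UNIV[THEN iffD2, OF f])
  have int1: "f0 integrable_on {u..v}" for u v
    using integrable_on_subcbox[OF int0, of u v] by simp
  have int2: "(\<lambda>x. f0 (- x)) integrable_on {u..v}" for u v
    using int1[of "- v" "- u"] Henstock_Kurzweil_Integration.integrable_reflect_real[where f = f0 and a = "- v" and b = "- u"] by simp
  obtain N1 where N1: "negligible N1" "\<And>x e. \<lbrakk>x \<notin> N1; 0 < e\<rbrakk> \<Longrightarrow>
      \<exists>d>0. \<forall>h. 0 < h \<and> h < d \<longrightarrow> norm (integral {x..x + h} f0 /\<^sub>R h - f0 x) < e"
    using integrable_ccontinuous_explicit[of f0] int1 by auto
  obtain N2 where N2: "negligible N2" "\<And>x e. \<lbrakk>x \<notin> N2; 0 < e\<rbrakk> \<Longrightarrow>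
      \<exists>d>0. \<forall>h. 0 < h \<and> h < d \<longrightarrow> norm (integral {x..x + h} (\<lambda>x. f0 (- x)) /\<^sub>R h - f0 (- x)) < e"
    using integrable_ccontinuous_explicit[of "\<lambda>x. f0 (- x)"] int2 by auto
  define N where "N = N1 \<union> uminus ` N2"
  have "negligible (uminus ` N2)"
    by (rule negligible_differentiable_image_negligible) (use N2 in \<open>auto intro!: derivative_intros\<close>)
  then have "negligible N" using N1 by (simp add: N_def)
  moreover have "((\<lambda>x. integral {a..x} f) has_vector_derivative f x) (at x within {a..b})" if x: "x \<in> {a..b} - N" for x
    unfolding has_vector_derivative_def has_derivative_within_alt
  proof (intro conjI allI impI)
    show "bounded_linear (\<lambda>h. h *\<^sub>R f x)" by (rule bounded_linear_scaleR_left)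
    fix e :: real assume e: "e > 0"
    have xN: "x \<notin> N1" "- x \<notin> N2" using x unfolding N_def by force+
    obtain d1 where d1: "d1 > 0" "\<And>h. 0 < h \<Longrightarrow> h < d1 \<Longrightarrow> norm (integral {x..x + h} f0 /\<^sub>R h - f0 x) < e"
      using N1(2)[OF xN(1) e] by blast
    obtain d2 where d2: "d2 > 0" "\<And>h. 0 < h \<Longrightarrow> h < d2 \<Longrightarrow>
        norm (integral {- x..- x + h} (\<lambda>x. f0 (- x)) /\<^sub>R h - f0 x) < e"
      using N2(2)[OF xN(2) e] by auto
    have scale: "norm (I - h *\<^sub>R c) \<le> e * h" if "norm (I /\<^sub>R h - c) < e" "h > 0" for I c :: complex and h :: real
    proof -
      have "I - h *\<^sub>R c = h *\<^sub>R (I /\<^sub>R h - c)" using that by (simp add: scaleR_diff_right)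
      then have "norm (I - h *\<^sub>R c) = h * norm (I /\<^sub>R h - c)" using that by simp
      also have "\<dots> \<le> h * e" using that by (intro mult_left_mono) auto
      finally show ?thesis by (simp add: mult.commute)
    qed
    have F: "integral {a..v} f - integral {a..u} f = integral {u..v} f0" if "a \<le> u" "u \<le> v" "v \<le> b" for u v
    proof -
      have "integral {a..u} f + integral {u..v} f = integral {a..v} f"
        by (rule Henstock_Kurzweil_Integration.integral_combine)
          (use that integrable_on_subinterval[OF f] in auto)
      moreover have "integral {u..v} f = integral {u..v} f0"
        by (rule integral_cong) (use that in \<open>auto simp: f0_def\<close>)
      ultimately show ?thesis by (simp add: algebra_simps)
    qed
    have fx: "f0 x = f x" using x by (simp add: f0_def)
    show "\<exists>d>0. \<forall>y\<in>{a..b}. norm (y - x) < d \<longrightarrow>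
        norm (integral {a..y} f - integral {a..x} f - (y - x) *\<^sub>R f x) \<le> e * norm (y - x)"
    proof (intro exI[of _ "min d1 d2"] conjI ballI impI)
      fix y assume y: "y \<in> {a..b}" "norm (y - x) < min d1 d2"
      consider "x = y" | "x < y" | "y < x" by linarith
      then show "norm (integral {a..y} f - integral {a..x} f - (y - x) *\<^sub>R f x) \<le> e * norm (y - x)"
      proof cases
        case 2
        have "norm (integral {x..x + (y - x)} f0 - (y - x) *\<^sub>R f0 x) \<le> e * (y - x)"
          by (rule scale[OF d1(2)]) (use 2 y in auto)
        then show ?thesis using F[of x y] 2 x y fx by simp
      next
        case 3
        have "norm (integral {- x..- x + (x - y)} (\<lambda>x. f0 (- x)) - (x - y) *\<^sub>R f0 x) \<le> e * (x - y)"
          by (rule scale[OF d2(2)]) (use 3 y in auto)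
        moreover have "integral {- x..- x + (x - y)} (\<lambda>x. f0 (- x)) = integral {y..x} f0"
          using Henstock_Kurzweil_Integration.integral_reflect_real[where f = f0 and a = y and b = x] by simp
        ultimately have "norm (integral {a..x} f - integral {a..y} f - (x - y) *\<^sub>R f x) \<le> e * (x - y)"
          using F[of y x] 3 x y fx by simp
        moreover have "integral {a..y} f - integral {a..x} f - (y - x) *\<^sub>R f x
            = - (integral {a..x} f - integral {a..y} f - (x - y) *\<^sub>R f x)" by (simp add: algebra_simps)
        ultimately show ?thesis using 3 by (simp only: norm_minus_cancel) simp
      qed simp
    qed (use d1 d2 in simp)
  qed
  ultimately show thesis by (rule that)
qed

text \<open>Square integrability gives an explicit modulus, since \<open>cmod (f x)\<close> is at
  most \<open>\<eta> * (cmod (f x))\<^sup>2 + 1 / (4 * \<eta>)\<close>. The first part sums to at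
  most \<open>\<eta> * K\<close>, kept within \<open>e / 2\<close> by the choice of
  \<open>\<eta>\<close>; a total length below \<open>2 * \<eta> * e\<close> keeps the second below
  \<open>e / 2\<close>.\<close>

lemma abs_cont_on_indefinite_integral:
  fixes f :: "real \<Rightarrow> complex"
  assumes f: "f integrable_on {a..b}" and f2: "(\<lambda>x. (cmod (f x))\<^sup>2) integrable_on {a..b}"
  shows "abs_cont_on a b (\<lambda>x. integral {a..x} f)"
  unfolding abs_cont_on_def
proof (intro allI impI)
  fix e :: real assume e: "e > 0"
  define K where "K = integral {a..b} (\<lambda>x. (cmod (f x))\<^sup>2)"
  have K: "K \<ge> 0" unfolding K_def by (rule Henstock_Kurzweil_Integration.integral_nonneg[OF f2]) simp
  define \<eta> where "\<eta> = e / 2 / (K + 1)"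
  have \<eta>: "\<eta> > 0" using e K by (simp add: \<eta>_def)
  show "\<exists>\<delta>>0. \<forall>I. finite I \<longrightarrow> (\<forall>(s, t)\<in>I. a \<le> s \<and> s \<le> t \<and> t \<le> b) \<longrightarrow>
        disjoint_family_on (\<lambda>(s, t). {s<..<t}) I \<longrightarrow> (\<Sum>(s, t)\<in>I. t - s) < \<delta> \<longrightarrow>
        (\<Sum>(s, t)\<in>I. dist (integral {a..s} f) (integral {a..t} f)) < e"
  proof (intro exI[of _ "2 * \<eta> * e"] conjI allI impI)
    show "0 < 2 * \<eta> * e" using \<eta> e by simp
    fix I assume I: "finite I" "\<forall>(s, t)\<in>I. a \<le> s \<and> s \<le> t \<and> t \<le> b"
      "disjoint_family_on (\<lambda>(s, t). {s<..<t}) I" "(\<Sum>(s, t)\<in>I. t - s) < 2 * \<eta> * e"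
    let ?k = "\<lambda>s t. integral {s..t} (\<lambda>x. (cmod (f x))\<^sup>2)"
    have le: "dist (integral {a..s} f) (integral {a..t} f) \<le> \<eta> * ?k s t + (t - s) / (4 * \<eta>)"
      if st: "a \<le> s" "s \<le> t" "t \<le> b" for s t
    proof -
      have fi: "f integrable_on {s..t}" and f2i: "(\<lambda>x. (cmod (f x))\<^sup>2) integrable_on {s..t}"
        using st by (auto intro: integrable_on_subinterval[OF f] integrable_on_subinterval[OF f2])
      have comb: "integral {a..t} f = integral {a..s} f + integral {s..t} f"
        by (rule Henstock_Kurzweil_Integration.integral_combine[symmetric])
          (use st in \<open>auto intro: integrable_on_subinterval[OF f]\<close>)
      have "dist (integral {a..s} f) (integral {a..t} f) = norm (integral {s..t} f)"
        unfolding comb by (simp add: dist_norm)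
      also have "\<dots> \<le> integral {s..t} (\<lambda>x. \<eta> * (cmod (f x))\<^sup>2 + 1 / (4 * \<eta>))"
      proof (rule Henstock_Kurzweil_Integration.integral_norm_bound_integral[OF fi])
        show "(\<lambda>x. \<eta> * (cmod (f x))\<^sup>2 + 1 / (4 * \<eta>)) integrable_on {s..t}"
          by (intro integrable_add integrable_on_mult_right f2i integrable_const_ivl)
        fix x
        have "0 \<le> (2 * \<eta> * cmod (f x) - 1)\<^sup>2 / (4 * \<eta>)" using \<eta> by simp
        also have "\<dots> = \<eta> * (cmod (f x))\<^sup>2 + 1 / (4 * \<eta>) - cmod (f x)"
          using \<eta> by (simp add: power2_eq_square field_simps)
        finally show "norm (f x) \<le> \<eta> * (cmod (f x))\<^sup>2 + 1 / (4 * \<eta>)" by simp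
      qed
      also have "\<dots> = \<eta> * ?k s t + (t - s) / (4 * \<eta>)"
        using st by (subst integral_add) (auto intro!: integrable_on_mult_right f2i integrable_const_ivl)
      finally show ?thesis .
    qed
    have "(\<Sum>(s, t)\<in>I. dist (integral {a..s} f) (integral {a..t} f)) \<le> (\<Sum>(s, t)\<in>I. \<eta> * ?k s t + (t - s) / (4 * \<eta>))"
      using I(2) le by (intro sum_mono) fastforce
    also have "\<dots> = \<eta> * (\<Sum>(s, t)\<in>I. ?k s t) + (\<Sum>(s, t)\<in>I. t - s) / (4 * \<eta>)"
      by (simp add: sum.distrib sum_distrib_left sum_divide_distrib case_prod_unfold)
    also have "\<dots> < \<eta> * (\<Sum>(s, t)\<in>I. ?k s t) + (2 * \<eta> * e) / (4 * \<eta>)"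
      using I(4) \<eta> by (intro add_strict_left_mono divide_strict_right_mono) auto
    also have "\<dots> \<le> \<eta> * K + e / 2"
    proof -
      let ?T = "\<lambda>y :: real \<times> real. {fst y<..<snd y}"
      have "((\<lambda>x. (cmod (f x))\<^sup>2) has_integral (\<Sum>y\<in>I. ?k (fst y) (snd y))) (\<Union>y\<in>I. ?T y)"
      proof (rule has_integral_UN[OF I(1)])
        fix y assume "y \<in> I"
        then have "a \<le> fst y" "snd y \<le> b" using I(2) by auto
        then have "(\<lambda>x. (cmod (f x))\<^sup>2) integrable_on {fst y..snd y}"
          by (intro integrable_on_subinterval[OF f2]) auto
        then show "((\<lambda>x. (cmod (f x))\<^sup>2) has_integral ?k (fst y) (snd y)) (?T y)"
          using integrable_integral has_integral_Icc_iff_Ioo by blast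
      next
        show "pairwise (\<lambda>i i'. negligible (?T i \<inter> ?T i')) I"
          using I(3) unfolding disjoint_family_on_def pairwise_def by (simp add: case_prod_unfold)
      qed
      then have "(\<Sum>y\<in>I. ?k (fst y) (snd y)) \<le> K" unfolding K_def
        by (rule has_integral_subset_le[rotated, OF _ integrable_integral[OF f2]]) (use I(2) in force)+
      then show ?thesis using \<eta> by (simp add: case_prod_unfold mult_left_mono)
    qed
    also have "\<dots> \<le> e"
    proof -
      have "\<eta> * K \<le> \<eta> * (K + 1)" using \<eta> by simp
      also have "\<eta> * (K + 1) = e / 2"
      proof -
        have "x / c * c = x" if "c > 0" for x c :: real using that by simp
        from this[of "K + 1" "e / 2"] show ?thesis using K by (simp only: \<eta>_def)
      qed
      finally show ?thesis by simp
    qed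
    finally show "(\<Sum>(s, t)\<in>I. dist (integral {a..s} f) (integral {a..t} f)) < e" .
  qed
qed

text \<open>Carries the derivative along as a second argument, so that sums and products are
  differentiated by composing rules. The link to \<open>vector_derivative\<close> is made once, in
  \<open>H1_deriv_vector_derivative\<close>.\<close>

definition H1_deriv :: "(real \<Rightarrow> complex) \<Rightarrow> (real \<Rightarrow> complex) \<Rightarrow> bool" where
  "H1_deriv f g \<longleftrightarrow> abs_cont_on 0 pi f \<and> g \<in> L2_fun \<and>
     (AE x in leb_pi. (f has_vector_derivative g x) (at x within {0..pi}))"

lemma H1_fun_iff: "f \<in> H1_fun \<longleftrightarrow> (\<exists>g. H1_deriv f g)"
  by (auto simp: H1_fun_def H1_deriv_def)

lemma H1_deriv_H1: "H1_deriv f g \<Longrightarrow> f \<in> H1_fun"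
  by (auto simp: H1_fun_iff)

lemma H1_deriv_L2: "H1_deriv f g \<Longrightarrow> g \<in> L2_fun"
  by (simp add: H1_deriv_def)

lemma H1_deriv_continuous: "H1_deriv f g \<Longrightarrow> continuous_on {0..pi} f"
  using H1_fun_continuous H1_deriv_H1 by blast

lemma L2_fun_integrable_on:
  assumes "f \<in> L2_fun"
  shows "f integrable_on {0..pi}" "(\<lambda>x. (cmod (f x))\<^sup>2) integrable_on {0..pi}"
    "(LINT x|leb_pi. f x) = integral {0..pi} f"
proof -
  note i = L2_fun_integrable[OF assms]
  show "f integrable_on {0..pi}" by (rule integrable_on_lebesgue_on[OF i]) simp
  show "(\<lambda>x. (cmod (f x))\<^sup>2) integrable_on {0..pi}"
    by (rule integrable_on_lebesgue_on) (use assms in \<open>simp_all add: L2_fun_def\<close>)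
  show "(LINT x|leb_pi. f x) = integral {0..pi} f" by (rule lebesgue_integral_eq_integral[OF i]) simp
qed

lemma continuous_L2_fun: "continuous_on {0..pi} f \<Longrightarrow> f \<in> L2_fun"
  using L2_fun_mult_continuous[OF L2_fun_one] by simp

lemma H1_deriv_integral:
  assumes "H1_deriv f g"
  shows "(LINT x|leb_pi. g x) = f pi - f 0"
proof -
  obtain N where N: "negligible N"
    "\<And>x. x \<in> {0..pi} \<Longrightarrow> x \<notin> N \<Longrightarrow> (f has_vector_derivative g x) (at x within {0..pi})"
    using AE_leb_piE assms unfolding H1_deriv_def by blast
  have "(g has_integral (f pi - f 0)) {0..pi}"
    by (rule fundamental_theorem_of_calculus_abs_cont[OF _ _ N(1)])
      (use assms N in \<open>auto simp: H1_deriv_def\<close>)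
  then show ?thesis using L2_fun_integrable_on(3)[of g] assms by (simp add: H1_deriv_def integral_unique)
qed

lemma H1_deriv_indefinite:
  assumes "g \<in> L2_fun"
  shows "H1_deriv (\<lambda>x. integral {0..x} g) g"
proof -
  obtain N where N: "negligible N" "\<And>x. x \<in> {0..pi} - N \<Longrightarrow>
      ((\<lambda>x. integral {0..x} g) has_vector_derivative g x) (at x within {0..pi})"
    using indefinite_integral_derivative_ae[OF L2_fun_integrable_on(1)[OF assms]] by blast
  have "AE x in leb_pi. ((\<lambda>x. integral {0..x} g) has_vector_derivative g x) (at x within {0..pi})"
    by (rule AE_leb_piI[OF N(1)]) (use N(2) in auto)
  then show ?thesis
    using abs_cont_on_indefinite_integral[OF L2_fun_integrable_on(1,2)[OF assms]] assms
    by (simp add: H1_deriv_def)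
qed

lemma H1_deriv_C1:
  assumes "\<And>x. x \<in> {0..pi} \<Longrightarrow> (f has_vector_derivative f' x) (at x within {0..pi})" "continuous_on {0..pi} f'"
  shows "H1_deriv f f'"
  unfolding H1_deriv_def
proof (intro conjI)
  show "abs_cont_on 0 pi f" by (rule abs_cont_on_C1) fact+
  show "f' \<in> L2_fun" by (rule continuous_L2_fun) fact
  show "AE x in leb_pi. (f has_vector_derivative f' x) (at x within {0..pi})"
    by (rule AE_leb_piI[of "{}"]) (use assms in auto)
qed

lemma H1_deriv_mult:
  assumes "H1_deriv f f'" "H1_deriv g g'"
  shows "H1_deriv (\<lambda>x. f x * g x) (\<lambda>x. f x * g' x + f' x * g x)"
  unfolding H1_deriv_def
proof (intro conjI)
  show "abs_cont_on 0 pi (\<lambda>x. f x * g x)" using assms by (intro abs_cont_on_mult) (auto simp: H1_deriv_def)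
  have "(\<lambda>x. g' x * f x) \<in> L2_fun" "(\<lambda>x. f' x * g x) \<in> L2_fun"
    by (rule L2_fun_mult_continuous[OF H1_deriv_L2[OF assms(2)] H1_deriv_continuous[OF assms(1)]],
        rule L2_fun_mult_continuous[OF H1_deriv_L2[OF assms(1)] H1_deriv_continuous[OF assms(2)]])
  then show "(\<lambda>x. f x * g' x + f' x * g x) \<in> L2_fun"
    using L2_fun_add[of "\<lambda>x. g' x * f x" "\<lambda>x. f' x * g x"] by (simp add: mult.commute)
  have "AE x in leb_pi. (f has_vector_derivative f' x) (at x within {0..pi})"
    "AE x in leb_pi. (g has_vector_derivative g' x) (at x within {0..pi})"
    using assms by (auto simp: H1_deriv_def)
  then show "AE x in leb_pi. ((\<lambda>x. f x * g x) has_vector_derivative f x * g' x + f' x * g x) (at x within {0..pi})"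
    by eventually_elim (rule has_vector_derivative_mult)
qed

lemma H1_deriv_const: "H1_deriv (\<lambda>x. c) (\<lambda>x. 0)"
  by (rule H1_deriv_C1) auto

lemma H1_deriv_add:
  assumes "H1_deriv f f'" "H1_deriv g g'"
  shows "H1_deriv (\<lambda>x. f x + g x) (\<lambda>x. f' x + g' x)"
  unfolding H1_deriv_def
proof (intro conjI)
  show "abs_cont_on 0 pi (\<lambda>x. f x + g x)"
  proof (rule abs_cont_on_lipschitz_sum[of _ _ f g 1 1])
    show "dist (f s + g s) (f t + g t) \<le> 1 * dist (f s) (f t) + 1 * dist (g s) (g t)" for s t
      by (simp add: dist_triangle_add)
  qed (use assms in \<open>auto simp: H1_deriv_def\<close>)
  show "(\<lambda>x. f' x + g' x) \<in> L2_fun" using assms by (auto intro: L2_fun_add simp: H1_deriv_def)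
  have "AE x in leb_pi. (f has_vector_derivative f' x) (at x within {0..pi})"
    "AE x in leb_pi. (g has_vector_derivative g' x) (at x within {0..pi})"
    using assms by (auto simp: H1_deriv_def)
  then show "AE x in leb_pi. ((\<lambda>x. f x + g x) has_vector_derivative f' x + g' x) (at x within {0..pi})"
    by eventually_elim (rule has_vector_derivative_add)
qed

lemma H1_deriv_cmult: "H1_deriv f f' \<Longrightarrow> H1_deriv (\<lambda>x. c * f x) (\<lambda>x. c * f' x)"
  using H1_deriv_mult[OF H1_deriv_const[of c], of f f'] by simp

lemma H1_deriv_exp: "H1_deriv (\<lambda>x. exp (c * of_real x)) (\<lambda>x. c * exp (c * of_real x))"
proof (rule H1_deriv_C1)
  fix x :: real
  have "((\<lambda>z. exp (c * z)) has_field_derivative c * exp (c * of_real x)) (at (of_real x))"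
    by (auto intro!: derivative_eq_intros)
  from has_vector_derivative_real_field[OF this]
  show "((\<lambda>x. exp (c * of_real x)) has_vector_derivative c * exp (c * of_real x)) (at x within {0..pi})" .
qed (intro continuous_intros)

lemma H1_deriv_vector_derivative:
  assumes "H1_deriv f g"
  shows "AE x in leb_pi. vector_derivative f (at x within {0..pi}) = g x"
proof -
  obtain N where N: "negligible N"
    "\<And>x. x \<in> {0..pi} \<Longrightarrow> x \<notin> N \<Longrightarrow> (f has_vector_derivative g x) (at x within {0..pi})"
    using AE_leb_piE assms unfolding H1_deriv_def by blast
  show ?thesis
    by (rule AE_leb_piI[OF N(1)]) (use N(2) pi_gt_zero in \<open>auto intro!: vector_derivative_within_closed_interval\<close>)
qed

lemma abs_l2_cong_AE: "f \<in> L2_fun \<Longrightarrow> AE x in leb_pi. f x = g x \<Longrightarrow> abs_l2 f = abs_l2 g"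
  using L2_fun_cong_AE[of f g] by (simp add: abs_l2_eq_iff)

lemma dirac_op_H1_deriv:
  assumes PQ: "P \<in> L2_fun" "Q \<in> L2_fun" and y: "H1_deriv y1 g1" "H1_deriv y2 g2"
  shows "dirac_op P Q (abs_l2 y1, abs_l2 y2) =
     (abs_l2 (\<lambda>x. \<i> * g1 x + P x * y2 x), abs_l2 (\<lambda>x. - \<i> * g2 x + Q x * y1 x))"
proof -
  note H = H1_deriv_H1[OF y(1)] H1_deriv_H1[OF y(2)]
  have "AE x in leb_pi. dirac_expr1 P y1 y2 x = \<i> * g1 x + P x * y2 x"
    using H1_deriv_vector_derivative[OF y(1)] by eventually_elim (simp add: dirac_expr1_def)
  moreover have "AE x in leb_pi. dirac_expr2 Q y1 y2 x = - \<i> * g2 x + Q x * y1 x"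
    using H1_deriv_vector_derivative[OF y(2)] by eventually_elim (simp add: dirac_expr2_def)
  ultimately show ?thesis
    unfolding dirac_op_eq[OF PQ H]
    by (intro arg_cong2[of _ _ _ _ Pair] abs_l2_cong_AE dirac_expr_L2 H PQ)
qed

section \<open>Completeness of the exponentials\<close>

definition ez :: "int \<Rightarrow> real \<Rightarrow> complex" where
  "ez n x = exp (\<i> * of_int n * of_real x)"

abbreviation It :: "(real \<Rightarrow> complex) \<Rightarrow> complex" where
  "It f \<equiv> (LINT x|leb_pi. f x)"

lemma ez_0 [simp]: "ez 0 x = 1" "ez n 0 = 1"
  by (simp_all add: ez_def)

lemma ez_mult: "ez m x * ez n x = ez (m + n) x"
  by (simp add: ez_def algebra_simps flip: exp_add)

lemma cnj_ez: "cnj (ez n x) = ez (- n) x"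
  by (simp add: ez_def exp_cnj)

lemma ez_cis: "ez n x = cis (of_int n * x)"
  by (simp add: ez_def cis_conv_exp mult.assoc)

lemma norm_ez [simp]: "cmod (ez n x) = 1"
  by (simp add: ez_cis)

lemma ez_nonzero [simp]: "ez n x \<noteq> 0"
  by (simp add: ez_def)

lemma ez_pi: "ez n pi = (if even n then 1 else - 1)"
proof -
  have e: "ez (2 * k) pi = 1" for k
    using cis_multiple_2pi[of "of_int k"] by (simp add: ez_cis mult.commute mult.left_commute)
  show ?thesis
  proof (cases "even n")
    case True
    then show ?thesis using e by (auto elim!: evenE)
  next
    case False
    then obtain k where "n = 2 * k + 1" by (auto elim: oddE)
    then have "ez n pi = ez (2 * k) pi * ez 1 pi" by (simp add: ez_mult)
    also have "\<dots> = - 1" using e[of k] by (simp add: ez_cis)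
    finally show ?thesis using False by simp
  qed
qed

lemma ez_reflect: "ez n (pi - x) = ez n pi * ez (- n) x"
  by (simp add: ez_def algebra_simps flip: exp_add)

lemma continuous_ez: "continuous_on S (ez n)"
  unfolding ez_def[abs_def] by (intro continuous_intros)

lemma H1_deriv_ez: "H1_deriv (ez n) (\<lambda>x. \<i> * of_int n * ez n x)"
  using H1_deriv_exp[of "\<i> * of_int n"] by (simp add: ez_def[abs_def])

lemma ez_L2: "ez n \<in> L2_fun"
  by (rule continuous_L2_fun[OF continuous_ez])

lemma L2_mult_ez: "f \<in> L2_fun \<Longrightarrow> (\<lambda>x. f x * ez n x) \<in> L2_fun"
  by (rule L2_fun_mult_continuous[OF _ continuous_ez])

lemma It_add: "f \<in> L2_fun \<Longrightarrow> g \<in> L2_fun \<Longrightarrow> It (\<lambda>x. f x + g x) = It f + It g"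
  by (intro Bochner_Integration.integral_add L2_fun_integrable)

lemma It_diff: "f \<in> L2_fun \<Longrightarrow> g \<in> L2_fun \<Longrightarrow> It (\<lambda>x. f x - g x) = It f - It g"
  by (intro Bochner_Integration.integral_diff L2_fun_integrable)

lemma It_cmult: "It (\<lambda>x. c * f x) = c * It f"
  by simp

lemma It_const: "It (\<lambda>x. c) = of_real pi * c"
  by (simp add: measure_restrict_space scaleR_conv_of_real)

lemma It_cong: "(\<And>x. x \<in> {0..pi} \<Longrightarrow> f x = g x) \<Longrightarrow> It f = It g"
  by (rule Bochner_Integration.integral_cong) auto

lemma It_ez:
  assumes "even n" "n \<noteq> 0"
  shows "It (ez n) = 0"
proof -
  have "It (\<lambda>x. \<i> * of_int n * ez n x) = ez n pi - ez n 0" by (rule H1_deriv_integral[OF H1_deriv_ez])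
  then have "\<i> * of_int n * It (ez n) = 0" using assms(1) unfolding It_cmult by (simp add: ez_pi)
  then show ?thesis using assms(2) by simp
qed

lemma cin_ez: "f \<in> L2_fun \<Longrightarrow> cin (abs_l2 f) (abs_l2 (ez n)) = 1 / of_real pi * It (\<lambda>x. f x * ez (- n) x)"
  by (simp add: cin_abs_l2 ez_L2 cnj_ez)

lemma cin_ez_ez:
  assumes "even (m - n)"
  shows "cin (abs_l2 (ez m)) (abs_l2 (ez n)) = of_bool (m = n)"
proof -
  have "It (\<lambda>x. ez m x * ez (- n) x) = It (ez (m - n))" by (simp add: ez_mult)
  also have "\<dots> = of_real pi * of_bool (m = n)"
    using It_ez[OF assms] It_const[of 1] by (cases "m = n") simp_all
  finally show ?thesis by (simp add: cin_ez ez_L2)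
qed

lemma parts_ez:
  assumes "H1_deriv f f'"
  shows "It (\<lambda>x. f' x * ez n x) = f pi * ez n pi - f 0 - \<i> * of_int n * It (\<lambda>x. f x * ez n x)"
proof -
  have fL: "f \<in> L2_fun" by (rule continuous_L2_fun[OF H1_deriv_continuous[OF assms]])
  have a: "(\<lambda>x. \<i> * of_int n * (f x * ez n x)) \<in> L2_fun" by (rule L2_fun_scale[OF L2_mult_ez[OF fL]])
  have b: "(\<lambda>x. f' x * ez n x) \<in> L2_fun" by (rule L2_mult_ez[OF H1_deriv_L2[OF assms]])
  have "It (\<lambda>x. f x * (\<i> * of_int n * ez n x) + f' x * ez n x) = f pi * ez n pi - f 0 * ez n 0"
    by (rule H1_deriv_integral[OF H1_deriv_mult[OF assms H1_deriv_ez]])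
  also have "(\<lambda>x. f x * (\<i> * of_int n * ez n x) + f' x * ez n x)
      = (\<lambda>x. \<i> * of_int n * (f x * ez n x) + f' x * ez n x)" by (simp add: mult_ac)
  finally show ?thesis unfolding It_add[OF a b] It_cmult by (simp add: algebra_simps)
qed

lemma even_exponentials_orthonormal: "orthonormal (\<lambda>k. abs_l2 (ez (2 * k))) UNIV"
  by standard (simp add: cin_ez_ez)

text \<open>Rests on Bessel's inequality for an orthonormal family, so that it may enter the proof
  that this family is total.\<close>

lemma fourier_coefficients_tendsto_0:
  assumes "f \<in> L2_fun"
  shows "(\<lambda>k::nat. It (\<lambda>x. f x * ez (2 * int k) x)) \<longlonglongrightarrow> 0"
    and "(\<lambda>k::nat. It (\<lambda>x. f x * ez (- 2 * int k) x)) \<longlonglongrightarrow> 0"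
proof -
  interpret orthonormal "\<lambda>k. abs_l2 (ez (2 * k))" UNIV by (rule even_exponentials_orthonormal)
  define c where "c = (\<lambda>k. cin (abs_l2 f) (abs_l2 (ez (2 * k))))"
  have c: "It (\<lambda>x. f x * ez (- 2 * k) x) = of_real pi * c k" for k
    using cin_ez[OF assms, of "2 * k"] by (simp add: c_def)
  have lim: "(\<lambda>k. of_real pi * c (\<sigma> (int k))) \<longlonglongrightarrow> 0" if "inj \<sigma>" for \<sigma>
  proof -
    have "(\<lambda>k. (cmod (c k))\<^sup>2) summable_on range (\<sigma> \<circ> int)"
      using coef_sq_summable[of "abs_l2 f"] unfolding c_def by (rule summable_on_subset_banach) simp
    moreover have "inj (\<sigma> \<circ> int)" by (intro inj_compose that) (simp add: inj_def)
    ultimately have "((\<lambda>k. (cmod (c k))\<^sup>2) \<circ> (\<sigma> \<circ> int)) summable_on UNIV"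
      by (subst (asm) summable_on_reindex) auto
    then have "(\<lambda>k. (cmod (c (\<sigma> (int k))))\<^sup>2) \<longlonglongrightarrow> 0"
      by (intro summable_LIMSEQ_zero summable_on_imp_summable) (simp add: o_def)
    then have "(\<lambda>k. sqrt ((cmod (c (\<sigma> (int k))))\<^sup>2)) \<longlonglongrightarrow> sqrt 0" by (rule tendsto_real_sqrt)
    then have "(\<lambda>k. c (\<sigma> (int k))) \<longlonglongrightarrow> 0" by (simp add: tendsto_norm_zero_iff)
    then show ?thesis by (rule tendsto_mult_right_zero)
  qed
  show "(\<lambda>k::nat. It (\<lambda>x. f x * ez (- 2 * int k) x)) \<longlonglongrightarrow> 0"
    unfolding c using lim[of "\<lambda>k. k"] by simp
  have "It (\<lambda>x. f x * ez (2 * int k) x) = of_real pi * c (- int k)" for k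
    using c[of "- int k"] by simp
  then show "(\<lambda>k::nat. It (\<lambda>x. f x * ez (2 * int k) x)) \<longlonglongrightarrow> 0"
    using lim[of uminus] by simp
qed

text \<open>The point \<open>x\<close> is taken in the interior because \<open>ez 2\<close> has the
  same value at 0 and at \<open>pi\<close>.\<close>

lemma ez2_eq_imp:
  assumes "x \<in> {0<..<pi}" "t \<in> {0..pi}" "ez 2 t = ez 2 x"
  shows "t = x"
proof -
  have "cos (2 * (t - x)) = 1"
  proof -
    have "ez 2 t * ez (- 2) x = 1" using assms(3) by (simp add: ez_mult)
    then have "cis (2 * (t - x)) = 1" by (simp add: ez_cis cis_mult right_diff_distrib)
    then show ?thesis by (metis cis.sel(1) one_complex.sel(1))
  qed
  then have "sin (t - x) = 0" using cos_double_sin[of "t - x"] by simp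
  moreover have "\<bar>t - x\<bar> < pi" using assms by (auto simp: abs_if)
  ultimately show ?thesis using sin_zero_pi_iff[of "t - x"] by auto
qed

text \<open>Dividing \<open>G - G x\<close> by \<open>e\<^sup>2\<^sup>i\<^sup>t - e\<^sup>2\<^sup>i\<^sup>x\<close> gives a continuous function whose Fourier
  coefficients telescope; they tend to zero, so the mean of \<open>G\<close> is \<open>G x\<close>.\<close>

lemma C1_eq_mean:
  assumes G': "\<And>t. t \<in> {0..pi} \<Longrightarrow> (G has_vector_derivative G' t) (at t within {0..pi})"
    and coef: "\<And>k. k \<noteq> 0 \<Longrightarrow> It (\<lambda>t. G t * ez (2 * k) t) = 0" and x: "x \<in> {0<..<pi}"
  shows "of_real pi * G x = It G"
proof -
  have contG: "continuous_on {0..pi} G"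
    using G' has_vector_derivative_continuous continuous_on_eq_continuous_within by blast
  \<comment> \<open>The value at \<open>x\<close> is the quotient of the two derivatives, that is,
    the limit of the other branch.\<close>
  define q where "q = (\<lambda>t. if t = x then G' x / (2 * \<i> * ez 2 x) else (G t - G x) / (ez 2 t - ez 2 x))"
  have xx: "x \<in> {0..pi}" using x by auto
  have "continuous_on {0..pi} q"
    unfolding continuous_on_eq_continuous_within
  proof
    fix t assume t: "t \<in> {0..pi}"
    show "continuous (at t within {0..pi}) q"
    proof (cases "t = x")
      case True
      have lim: "((\<lambda>y. (f y - f x) / of_real (y - x)) \<longlongrightarrow> d) (at x within {0..pi})"
        if "(f has_vector_derivative d) (at x within {0..pi})" for f :: "real \<Rightarrow> complex" and d
      proof -
        have "((\<lambda>y. (f y - (f x + (y - x) *\<^sub>R d)) /\<^sub>R norm (y - x)) \<longlongrightarrow> 0) (at x within {0..pi})"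
          using that unfolding has_vector_derivative_def has_derivative_within by (simp add: inverse_eq_divide)
        then have "((\<lambda>y. norm ((f y - (f x + (y - x) *\<^sub>R d)) /\<^sub>R norm (y - x))) \<longlongrightarrow> 0) (at x within {0..pi})"
          by (rule tendsto_norm_zero)
        moreover have "\<forall>\<^sub>F y in at x within {0..pi}. norm ((f y - (f x + (y - x) *\<^sub>R d)) /\<^sub>R norm (y - x))
            = norm ((f y - f x) / of_real (y - x) - d)"
          unfolding eventually_at_filter
        proof (rule always_eventually, intro allI impI)
          fix y assume "y \<noteq> x"
          then have "complex_of_real (y - x) \<noteq> 0" by simp
          then have "(f y - f x) / of_real (y - x) - d = (f y - (f x + (y - x) *\<^sub>R d)) / of_real (y - x)"
            by (simp only: scaleR_conv_of_real) (simp add: diff_divide_distrib add_divide_distrib)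
          then show "norm ((f y - (f x + (y - x) *\<^sub>R d)) /\<^sub>R norm (y - x)) = norm ((f y - f x) / of_real (y - x) - d)"
            by (simp only: norm_divide norm_of_real) (simp add: divide_inverse mult.commute)
        qed
        ultimately have "((\<lambda>y. norm ((f y - f x) / of_real (y - x) - d)) \<longlongrightarrow> 0) (at x within {0..pi})"
          by (rule Lim_transform_eventually)
        then have "((\<lambda>y. (f y - f x) / of_real (y - x) - d) \<longlongrightarrow> 0) (at x within {0..pi})"
          by (rule tendsto_norm_zero_cancel)
        then show ?thesis by (rule LIM_zero_cancel)
      qed
      have "(ez 2 has_vector_derivative 2 * \<i> * ez 2 x) (at x within {0..pi})"
      proof -
        have "((\<lambda>z. exp (\<i> * 2 * z)) has_field_derivative 2 * \<i> * exp (\<i> * 2 * of_real x)) (at (of_real x))"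
          by (auto intro!: derivative_eq_intros)
        from has_vector_derivative_real_field[OF this] show ?thesis by (simp add: ez_def[abs_def])
      qed
      from tendsto_divide[OF lim[OF G'[OF xx]] lim[OF this]]
      have "((\<lambda>y. ((G y - G x) / of_real (y - x)) / ((ez 2 y - ez 2 x) / of_real (y - x))) \<longlongrightarrow> q x)
          (at x within {0..pi})" by (simp add: q_def)
      moreover have "\<forall>\<^sub>F y in at x within {0..pi}.
          ((G y - G x) / of_real (y - x)) / ((ez 2 y - ez 2 x) / of_real (y - x)) = q y"
        unfolding eventually_at_filter by (rule always_eventually) (auto simp: q_def)
      ultimately show ?thesis unfolding True continuous_within by (rule Lim_transform_eventually)
    next
      case False
      have "continuous (at t within {0..pi}) (\<lambda>t. (G t - G x) / (ez 2 t - ez 2 x))"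
        using contG continuous_ez[of "{0..pi}" 2] t ez2_eq_imp[OF x t] False
        by (intro continuous_at_within_divide continuous_diff continuous_const)
          (auto simp: continuous_on_eq_continuous_within)
      moreover have "\<forall>\<^sub>F y in at t within {0..pi}. (G y - G x) / (ez 2 y - ez 2 x) = q y"
        unfolding eventually_at using False
        by (intro exI[of _ "dist t x"]) (auto simp: q_def dist_commute)
      ultimately show ?thesis
        unfolding continuous_within using False by (auto simp: q_def elim: Lim_transform_eventually)
    qed
  qed
  then have qL: "q \<in> L2_fun" by (rule continuous_L2_fun)
  have GL: "G \<in> L2_fun" by (rule continuous_L2_fun[OF contG])
  define E where "E = ez 2 x"
  define \<gamma> where "\<gamma> = (\<lambda>k. It (\<lambda>t. q t * ez (2 * k) t))"
  have key: "It (\<lambda>t. (G t - G x) * ez (2 * k) t) = \<gamma> (k + 1) - E * \<gamma> k" for k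
  proof -
    have "It (\<lambda>t. (G t - G x) * ez (2 * k) t) = It (\<lambda>t. q t * ez (2 * (k + 1)) t - E * (q t * ez (2 * k) t))"
    proof (rule It_cong)
      fix t assume t: "t \<in> {0..pi}"
      have q: "G t - G x = q t * (ez 2 t - E)"
        using ez2_eq_imp[OF x t] by (auto simp: q_def E_def)
      have e: "ez (2 * (k + 1)) t = ez 2 t * ez (2 * k) t" by (simp add: ez_mult algebra_simps)
      show "(G t - G x) * ez (2 * k) t = q t * ez (2 * (k + 1)) t - E * (q t * ez (2 * k) t)"
        unfolding q e by (simp add: algebra_simps)
    qed
    also have "\<dots> = \<gamma> (k + 1) - E * \<gamma> k" unfolding \<gamma>_def
      by (subst It_diff) (auto intro!: L2_mult_ez qL L2_fun_scale)
    finally show ?thesis .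
  qed
  have split: "It (\<lambda>t. (G t - G x) * ez (2 * k) t) = It (\<lambda>t. G t * ez (2 * k) t) - G x * It (ez (2 * k))" for k
    by (simp add: left_diff_distrib It_diff L2_mult_ez GL L2_fun_scale ez_L2)
  \<comment> \<open>The recursion is interrupted at \<open>k = 0\<close> only. On each of the chains
    1, 2, ... and 0, -1, ... the modulus of \<open>\<gamma>\<close> is constant and tends to 0, so
    \<open>\<gamma> 1\<close> and \<open>\<gamma> 0\<close> vanish and \<open>key\<close> at
    \<open>k = 0\<close> yields the mean.\<close>
  have rec: "\<gamma> (k + 1) = E * \<gamma> k" if "k \<noteq> 0" for k
    using key[of k] split[of k] coef[OF that] It_ez[of "2 * k"] that by simp
  have nE: "cmod E = 1" by (simp add: E_def)
  have up: "cmod (\<gamma> (1 + int j)) = cmod (\<gamma> 1)" for j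
  proof (induction j)
    case (Suc j)
    have "\<gamma> (1 + int j + 1) = E * \<gamma> (1 + int j)" by (rule rec) simp
    then show ?case using Suc nE by (simp add: norm_mult add_ac)
  qed simp
  have down: "cmod (\<gamma> (- int j)) = cmod (\<gamma> 0)" for j
  proof (induction j)
    case (Suc j)
    have "\<gamma> (- int (Suc j) + 1) = E * \<gamma> (- int (Suc j))" by (rule rec) simp
    then show ?case using Suc nE by (simp add: norm_mult)
  qed simp
  have "(\<lambda>j. cmod (\<gamma> (int j))) \<longlonglongrightarrow> 0"
    unfolding \<gamma>_def by (rule tendsto_norm_zero[OF fourier_coefficients_tendsto_0(1)[OF qL]])
  then have "(\<lambda>j. cmod (\<gamma> (int (Suc j)))) \<longlonglongrightarrow> 0" by (rule LIMSEQ_Suc)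
  then have g1: "\<gamma> 1 = 0" using up by (simp add: LIMSEQ_const_iff)
  have "(\<lambda>j. cmod (\<gamma> (- int j))) \<longlonglongrightarrow> 0"
    unfolding \<gamma>_def using tendsto_norm_zero[OF fourier_coefficients_tendsto_0(2)[OF qL]] by simp
  then have g0: "\<gamma> 0 = 0" using down by (simp add: LIMSEQ_const_iff)
  have e: "It G = G x * It (\<lambda>t. 1)" using key[of 0] split[of 0] g0 g1 by (simp add: ez_def)
  show ?thesis unfolding e It_const by simp
qed

text \<open>Lowers the regularity by one step: \<open>C1_eq_mean\<close> is applied to the
  antiderivative \<open>G\<close> of \<open>H\<close> minus its mean. Removing the mean makes
  \<open>G\<close> vanish at both ends, so no boundary term disturbs its coefficients; hence
  \<open>G\<close> is constant and its derivative is zero.\<close>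

lemma continuous_eq_mean:
  assumes cont: "continuous_on {0..pi} H" and coef: "\<And>k. k \<noteq> 0 \<Longrightarrow> It (\<lambda>t. H t * ez (2 * k) t) = 0"
    and x: "x \<in> {0..pi}"
  shows "of_real pi * H x = It H"
proof -
  define c where "c = It H / of_real pi"
  define K where "K = (\<lambda>t. H t - c)"
  have contK: "continuous_on {0..pi} K" unfolding K_def by (intro continuous_intros cont)
  note KL = continuous_L2_fun[OF contK] and HL = continuous_L2_fun[OF cont]
  have K0: "It K = 0" unfolding K_def
    using It_diff[OF HL L2_fun_scale[OF L2_fun_one, of c]] It_const[of c] by (simp add: c_def)
  have Kk: "It (\<lambda>t. K t * ez (2 * k) t) = 0" if "k \<noteq> 0" for k
    using coef[OF that] It_ez[of "2 * k"] that
    by (simp add: K_def left_diff_distrib It_diff L2_mult_ez HL L2_fun_scale ez_L2)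
  define G where "G = (\<lambda>t. integral {0..t} K)"
  have G': "(G has_vector_derivative K t) (at t within {0..pi})" if "t \<in> {0..pi}" for t
    unfolding G_def by (rule integral_has_vector_derivative[OF contK that])
  have hG: "H1_deriv G K" by (rule H1_deriv_C1[OF G' contK])
  have G0: "G 0 = 0" by (simp add: G_def)
  have Gpi: "G pi = 0" using H1_deriv_integral[OF hG] K0 G0 by simp
  have Gk: "It (\<lambda>t. G t * ez (2 * k) t) = 0" if "k \<noteq> 0" for k
    using parts_ez[OF hG, of "2 * k"] Kk[OF that] that by (simp add: G0 Gpi)
  have mean: "G t = It G / of_real pi" if "t \<in> {0<..<pi}" for t
    using C1_eq_mean[OF G' Gk that] by (simp add: field_simps)
  have clo: "closure {0<..<pi} = {0..pi}" by (rule closure_greaterThanLessThan) simp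
  have const: "G t = It G / of_real pi" if "t \<in> {0..pi}" for t
    by (rule continuous_constant_on_closure[of "{0<..<pi}"])
      (use H1_deriv_continuous[OF hG] mean that in \<open>auto simp: clo\<close>)
  have d0: "((\<lambda>t. It G / of_real pi) has_vector_derivative K x) (at x within {0..pi})"
    by (rule has_vector_derivative_transform[OF x _ G'[OF x]]) (use const in auto)
  have "K x = 0"
    by (rule vector_derivative_unique_within_closed_interval[OF pi_gt_zero _ d0[folded box_real(2)] has_vector_derivative_const])
      (use x in simp)
  then show ?thesis by (simp add: K_def c_def)
qed

lemma H1_deriv_zero:
  assumes "H1_deriv F f" "\<And>x. x \<in> {0..pi} \<Longrightarrow> F x = 0"
  shows "abs_l2 f = 0"
proof -
  have "AE x in leb_pi. f x = 0"
  proof -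
    obtain N where N: "negligible N"
      "\<And>x. x \<in> {0..pi} \<Longrightarrow> x \<notin> N \<Longrightarrow> (F has_vector_derivative f x) (at x within {0..pi})"
      using AE_leb_piE assms(1) unfolding H1_deriv_def by blast
    show ?thesis
    proof (rule AE_leb_piI[OF N(1)])
      fix x assume x: "x \<in> {0..pi}" "x \<notin> N"
      have d0: "((\<lambda>t. 0) has_vector_derivative f x) (at x within {0..pi})"
        by (rule has_vector_derivative_transform[OF x(1) _ N(2)[OF x]]) (use assms(2) in auto)
      show "f x = 0"
        by (rule vector_derivative_unique_within_closed_interval[OF pi_gt_zero _ d0[folded box_real(2)] has_vector_derivative_const])
          (use x in simp)
    qed
  qed
  then show ?thesis unfolding abs_l2_zero by (rule abs_l2_cong_AE[OF H1_deriv_L2[OF assms(1)]])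
qed

text \<open>The same step once more, from continuous to square integrable functions: the
  antiderivative vanishes at both ends, is constant, and is therefore zero.\<close>

lemma even_exponentials_total:
  assumes f: "f \<in> L2_fun" and coef: "\<And>k. It (\<lambda>t. f t * ez (2 * k) t) = 0"
  shows "abs_l2 f = 0"
proof -
  define F where "F = (\<lambda>x. integral {0..x} f)"
  have hF: "H1_deriv F f" unfolding F_def by (rule H1_deriv_indefinite[OF f])
  have F0: "F 0 = 0" by (simp add: F_def)
  have Fpi: "F pi = 0" using H1_deriv_integral[OF hF] coef[of 0] F0 by simp
  have "It (\<lambda>t. F t * ez (2 * k) t) = 0" if "k \<noteq> 0" for k
    using parts_ez[OF hF, of "2 * k"] coef[of k] that by (simp add: F0 Fpi)
  from continuous_eq_mean[OF H1_deriv_continuous[OF hF] this]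
  have c: "of_real pi * F x = It F" if "x \<in> {0..pi}" for x using that by blast
  have "It F = 0" using c[of 0] F0 by simp
  then show ?thesis using c by (intro H1_deriv_zero[OF hF]) simp
qed

lemma odd_exponentials_total:
  assumes f: "f \<in> L2_fun" and coef: "\<And>k. It (\<lambda>t. f t * ez (2 * k + 1) t) = 0"
  shows "abs_l2 f = 0"
proof -
  have g: "(\<lambda>t. f t * ez 1 t) \<in> L2_fun" by (rule L2_mult_ez[OF f])
  have "It (\<lambda>t. (f t * ez 1 t) * ez (2 * k) t) = 0" for k
    using coef[of k] by (simp add: ez_mult mult.assoc add.commute)
  then have "abs_l2 (\<lambda>t. f t * ez 1 t) = 0" by (rule even_exponentials_total[OF g])
  then have "AE t in leb_pi. f t * ez 1 t = 0"
    using abs_l2_eq_iff[OF g L2_fun_zero] by (simp add: abs_l2_zero)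
  then have "AE t in leb_pi. f t = 0" by eventually_elim simp
  then show ?thesis unfolding abs_l2_zero by (rule abs_l2_cong_AE[OF f])
qed

lemma It_reflect:
  assumes "continuous_on {0..pi} f"
  shows "It (\<lambda>x. f (pi - x)) = It f"
proof -
  have c: "continuous_on {0..pi} (\<lambda>x. f (pi - x))"
    by (rule continuous_on_compose2[OF assms]) (auto intro!: continuous_intros)
  have "(f has_integral integral {0..pi} f) (cbox 0 pi)"
    using integrable_integral[OF integrable_continuous_real[OF assms]] by simp
  from has_integral_affinity[OF this, of "- 1" pi]
  have "((\<lambda>x. f (pi - x)) has_integral integral {0..pi} f) ((\<lambda>x. pi - x) ` {0..pi})" by simp
  also have "(\<lambda>x. pi - x) ` {0..pi} = {0..pi}" by (auto intro: image_eqI[of _ _ "pi - _"])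
  finally have "integral {0..pi} (\<lambda>x. f (pi - x)) = integral {0..pi} f" by (rule integral_unique)
  then show ?thesis
    using L2_fun_integrable_on(3)[OF continuous_L2_fun[OF c]] L2_fun_integrable_on(3)[OF continuous_L2_fun[OF assms]]
    by simp
qed

text \<open>The antiderivatives \<open>F1 (\<pi> - x)\<close> and \<open>F2\<close> are compared separately on even and on odd frequencies.\<close>

lemma dirichlet_exponentials_total:
  assumes f1: "f1 \<in> L2_fun" and f2: "f2 \<in> L2_fun"
    and coef: "\<And>n. It (\<lambda>t. f1 t * ez n t) + It (\<lambda>t. f2 t * ez (- n) t) = 0"
  shows "abs_l2 f1 = 0 \<and> abs_l2 f2 = 0"
proof -
  define F1 where "F1 = (\<lambda>x. integral {0..x} f1)"
  define F2 where "F2 = (\<lambda>x. integral {0..x} f2)"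
  have h1: "H1_deriv F1 f1" unfolding F1_def by (rule H1_deriv_indefinite[OF f1])
  have h2: "H1_deriv F2 f2" unfolding F2_def by (rule H1_deriv_indefinite[OF f2])
  note c1 = H1_deriv_continuous[OF h1] and c2 = H1_deriv_continuous[OF h2]
  have F0: "F1 0 = 0" "F2 0 = 0" by (simp_all add: F1_def F2_def)
  have Fpi: "F1 pi + F2 pi = 0"
    using H1_deriv_integral[OF h1] H1_deriv_integral[OF h2] coef[of 0] F0 by simp
  have eq: "It (\<lambda>t. F1 t * ez n t) = It (\<lambda>t. F2 t * ez (- n) t)" if "n \<noteq> 0" for n
  proof -
    have "ez (- n) pi = ez n pi" by (simp add: ez_pi)
    then have "(F1 pi + F2 pi) * ez n pi - \<i> * of_int n * (It (\<lambda>t. F1 t * ez n t) - It (\<lambda>t. F2 t * ez (- n) t)) = 0"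
      using coef[of n] parts_ez[OF h1, of n] parts_ez[OF h2, of "- n"] F0 by (simp add: algebra_simps)
    then show ?thesis using that Fpi by simp
  qed
  define R where "R = (\<lambda>x. F1 (pi - x))"
  have cR: "continuous_on {0..pi} R" unfolding R_def
    by (rule continuous_on_compose2[OF c1]) (auto intro!: continuous_intros)
  have R: "It (\<lambda>t. R t * ez (- n) t) = ez n pi * It (\<lambda>t. F1 t * ez n t)" for n
  proof -
    have "It (\<lambda>t. F1 t * ez n t) = It (\<lambda>t. F1 (pi - t) * ez n (pi - t))"
      by (rule It_reflect[symmetric]) (intro continuous_intros c1 continuous_ez)
    also have "\<dots> = It (\<lambda>t. ez n pi * (R t * ez (- n) t))" by (simp add: R_def ez_reflect mult_ac)
    also have "\<dots> = ez n pi * It (\<lambda>t. R t * ez (- n) t)" by (rule It_cmult)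
    finally show ?thesis by (simp add: ez_pi split: if_splits)
  qed
  have RL: "(\<lambda>t. R t * ez n t) \<in> L2_fun" and FL: "(\<lambda>t. F2 t * ez n t) \<in> L2_fun" for n
    by (intro L2_mult_ez continuous_L2_fun cR c2)+
  \<comment> \<open>Reflection multiplies the coefficient at \<open>n\<close> by
    \<open>ez n pi\<close>, which is 1 or -1 according to parity. Hence the even coefficients of
    \<open>R - F2\<close> vanish except for the mean, and so do all odd ones of
    \<open>R + F2\<close>.\<close>
  have even: "It (\<lambda>t. (R t - F2 t) * ez (2 * k) t) = 0" if "k \<noteq> 0" for k
    using R[of "- (2 * k)"] eq[of "- (2 * k)"] that
    by (simp add: left_diff_distrib It_diff RL FL ez_pi)
  have odd: "It (\<lambda>t. (R t + F2 t) * ez (2 * k + 1) t) = 0" for k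
  proof -
    have "- (2 * k + 1) \<noteq> 0" by presburger
    from eq[OF this] R[of "- (2 * k + 1)"] show ?thesis
      by (simp add: distrib_right It_add RL FL ez_pi add.commute[of "2 * k" 1])
  qed
  have cst: "of_real pi * (R x - F2 x) = It (\<lambda>t. R t - F2 t)" if "x \<in> {0..pi}" for x
    by (rule continuous_eq_mean[OF _ even that]) (intro continuous_intros cR c2)
  have zero: "R x + F2 x = 0" if x: "x \<in> {0..pi}" for x
  proof -
    have "of_real pi * ((R x + F2 x) * ez 1 x) = It (\<lambda>t. (R t + F2 t) * ez 1 t)"
    proof (rule continuous_eq_mean[OF _ _ x])
      show "continuous_on {0..pi} (\<lambda>t. (R t + F2 t) * ez 1 t)" by (intro continuous_intros cR c2 continuous_ez)
      show "It (\<lambda>t. (R t + F2 t) * ez 1 t * ez (2 * k) t) = 0" for k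
        using odd[of k] by (simp add: mult.assoc ez_mult add.commute)
    qed
    then show ?thesis using odd[of 0] by simp
  qed
  \<comment> \<open>\<open>R - F2\<close> is constant and \<open>R + F2\<close> vanishes, so
    \<open>F2\<close> is constant, with value \<open>F2 0 = 0\<close>.\<close>
  have F2z: "F2 x = 0" if "x \<in> {0..pi}" for x
  proof -
    have "of_real pi * (R x - F2 x) = of_real pi * (R 0 - F2 0)"
      unfolding cst[OF that] by (rule cst[symmetric]) simp
    then have "R x - F2 x = R 0 - F2 0" by simp
    then show ?thesis using zero[OF that] zero[of 0] F0 by (simp add: algebra_simps add_eq_0_iff)
  qed
  have F1z: "F1 x = 0" if "x \<in> {0..pi}" for x
    using zero[of "pi - x"] F2z[of "pi - x"] that by (simp add: R_def)
  show ?thesis using H1_deriv_zero[OF h1 F1z] H1_deriv_zero[OF h2 F2z] by simp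
qed

section \<open>The Dirac operator in the basis of the free operator\<close>

lemma cin_Pair: "cin (u1, u2) (v1, v2) = cin u1 v1 + cin u2 v2"
  by (simp add: cin_def scaleC_prod_def complex_eq_iff)

text \<open>Amplitudes of the two components of a basis vector. For periodic and antiperiodic
  conditions a frequency has two branches, each carried by one component; for \<open>Dir\<close> the
  only branch couples both components with equal weight.\<close>

definition amp1 :: "boundary_condition \<Rightarrow> bool \<Rightarrow> real" where
  "amp1 bc b = (if bc = Dir then 1 / sqrt 2 else of_bool b)"

definition amp2 :: "boundary_condition \<Rightarrow> bool \<Rightarrow> real" where
  "amp2 bc b = (if bc = Dir then 1 / sqrt 2 else of_bool (\<not> b))"

definition branches :: "boundary_condition \<Rightarrow> bool set" where
  "branches bc = (if bc = Dir then {True} else UNIV)"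

text \<open>The equation i y1' = n y1 is solved by the exponential of frequency \<open>- n\<close>,
  and - i y2' = n y2 by that of frequency \<open>n\<close>.\<close>

definition free_basis :: "boundary_condition \<Rightarrow> int \<times> bool \<Rightarrow> l2 \<times> l2" where
  "free_basis bc j = (abs_l2 (\<lambda>x. of_real (amp1 bc (snd j)) * ez (- fst j) x),
                      abs_l2 (\<lambda>x. of_real (amp2 bc (snd j)) * ez (fst j) x))"

lemma amp_le_1: "\<bar>amp1 bc b\<bar> \<le> 1" "\<bar>amp2 bc b\<bar> \<le> 1"
  by (auto simp: amp1_def amp2_def)

lemma cin_scaled_ez:
  "f \<in> L2_fun \<Longrightarrow> cin (abs_l2 f) (abs_l2 (\<lambda>x. of_real a * ez n x)) = of_real a / of_real pi * It (\<lambda>x. f x * ez (- n) x)"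
  by (simp add: cin_ez cin_scaleC_right ez_L2 flip: abs_l2_scaleC)

lemma cin_free_basis:
  assumes "f1 \<in> L2_fun" "f2 \<in> L2_fun"
  shows "cin (abs_l2 f1, abs_l2 f2) (free_basis bc (n, b)) =
    (of_real (amp1 bc b) * It (\<lambda>x. f1 x * ez n x) + of_real (amp2 bc b) * It (\<lambda>x. f2 x * ez (- n) x)) / of_real pi"
  by (simp add: free_basis_def cin_Pair cin_scaled_ez assms add_divide_distrib)

text \<open>For odd \<open>n\<close> neither integral vanishes; they cancel each other, which makes
  the coupled vectors for \<open>Dir\<close> orthogonal.\<close>

lemma It_ez_pair: "n \<noteq> 0 \<Longrightarrow> It (ez n) + It (ez (- n)) = 0"
proof -
  assume n: "n \<noteq> 0"
  have e: "\<i> * of_int n * It (ez n) = ez n pi - 1" for n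
    using H1_deriv_integral[OF H1_deriv_ez, of n] unfolding It_cmult by simp
  have "\<i> * of_int n * (It (ez n) + It (ez (- n))) = \<i> * of_int n * It (ez n) - \<i> * of_int (- n) * It (ez (- n))"
    by (simp add: algebra_simps)
  also have "\<dots> = 0" unfolding e by (simp add: ez_pi)
  finally have "\<i> * of_int n * (It (ez n) + It (ez (- n))) = 0" .
  then show ?thesis using n by simp
qed

lemma It_ez_mult: "It (\<lambda>x. ez m x * ez n x) = It (ez (m + n))"
  by (simp add: ez_mult)

lemma free_basis_orth:
  assumes "i \<in> free_spectrum bc \<times> branches bc" "j \<in> free_spectrum bc \<times> branches bc"
  shows "cin (free_basis bc i) (free_basis bc j) = of_bool (i = j)"
proof -
  obtain m a n b where ij: "i = (m, a)" "j = (n, b)" by (cases i, cases j)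
  have pi: "It (ez 0) = of_real pi" using It_const[of 1] by (simp add: ez_def[abs_def])
  have "cin (free_basis bc i) (free_basis bc j) =
     (of_real (amp1 bc b) * (of_real (amp1 bc a) * It (ez (n - m))) +
      of_real (amp2 bc b) * (of_real (amp2 bc a) * It (ez (m - n)))) / of_real pi"
    unfolding ij free_basis_def[of bc "(m, a)"]
    by (subst cin_free_basis) (simp_all add: L2_fun_scale ez_L2 mult.assoc It_ez_mult)
  also have "\<dots> = of_bool (i = j)"
  proof (cases "bc = Dir")
    case True
    then have ab: "a" "b" using assms ij by (auto simp: branches_def)
    have sq: "complex_of_real (1 / sqrt 2) * (complex_of_real (1 / sqrt 2) * c) = c / 2" for c
      by (simp flip: of_real_mult mult.assoc)
    show ?thesis
    proof (cases "m = n")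
      case False
      then have "It (ez (n - m)) + It (ez (m - n)) = 0" using It_ez_pair[of "n - m"] by simp
      then have "It (ez (n - m)) / 2 + It (ez (m - n)) / 2 = 0" by (simp flip: add_divide_distrib)
      then show ?thesis using True False ij unfolding amp1_def amp2_def by (simp only: if_True sq refl) simp
    next
      case mn: True
      show ?thesis using True ab ij unfolding mn amp1_def amp2_def
        by (simp only: if_True sq refl pi diff_self) simp
    qed
  next
    case False
    then have "even (m - n)" "even (n - m)" using assms ij by (cases bc; auto)+
    then show ?thesis
      using False pi It_ez[of "m - n"] It_ez[of "n - m"] ij
      by (cases "m = n"; cases a; cases b) (simp_all add: amp1_def amp2_def)
  qed
  finally show ?thesis .
qed

text \<open>Under periodic and antiperiodic conditions the two components are treated separately;
  for \<open>Dir\<close> a single family of coefficients has to determine both.\<close>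

lemma free_basis_total:
  assumes "\<And>j. j \<in> free_spectrum bc \<times> branches bc \<Longrightarrow> cin u (free_basis bc j) = 0"
  shows "u = 0"
proof -
  obtain f1 f2 where f: "f1 \<in> L2_fun" "f2 \<in> L2_fun" and u: "u = (abs_l2 f1, abs_l2 f2)"
    by (metis l2_cases surj_pair)
  have c: "of_real (amp1 bc b) * It (\<lambda>x. f1 x * ez n x) + of_real (amp2 bc b) * It (\<lambda>x. f2 x * ez (- n) x) = 0"
    if "n \<in> free_spectrum bc" "b \<in> branches bc" for n b
    using assms[of "(n, b)"] that by (simp add: u cin_free_basis f)
  have "abs_l2 f1 = 0 \<and> abs_l2 f2 = 0"
  proof (cases bc)
    case Per_plus
    have 1: "It (\<lambda>x. f1 x * ez (2 * k) x) = 0" for k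
      using c[of "2 * k" True] by (simp add: Per_plus branches_def amp1_def amp2_def)
    have 2: "It (\<lambda>x. f2 x * ez (2 * k) x) = 0" for k
      using c[of "- (2 * k)" False] by (simp add: Per_plus branches_def amp1_def amp2_def)
    show ?thesis using even_exponentials_total[OF f(1) 1] even_exponentials_total[OF f(2) 2] by simp
  next
    case Per_minus
    have 1: "It (\<lambda>x. f1 x * ez (2 * k + 1) x) = 0" for k
      using c[of "2 * k + 1" True] by (simp add: Per_minus branches_def amp1_def amp2_def)
    have 2: "It (\<lambda>x. f2 x * ez (2 * k + 1) x) = 0" for k
      using c[of "- (2 * k + 1)" False] by (simp only: minus_minus) (simp add: Per_minus branches_def amp1_def amp2_def)
    show ?thesis using odd_exponentials_total[OF f(1) 1] odd_exponentials_total[OF f(2) 2] by simp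
  next
    case Dir
    have "It (\<lambda>x. f1 x * ez n x) + It (\<lambda>x. f2 x * ez (- n) x) = 0" for n
      using c[of n True] by (simp add: Dir branches_def amp1_def amp2_def flip: add_divide_distrib)
    then show ?thesis by (rule dirichlet_exponentials_total[OF f])
  qed
  then show ?thesis by (simp add: u zero_prod_def)
qed

section \<open>Domain, linearity and matrix entries of the Dirac operator\<close>

lemma H1_pairE:
  assumes "u \<in> dirac_dom bc"
  obtains y1 g1 y2 g2 where "H1_deriv y1 g1" "H1_deriv y2 g2" "satisfies_bc bc y1 y2" "u = (abs_l2 y1, abs_l2 y2)"
  using assms unfolding dirac_dom_def H1_fun_iff by blast

lemma dirac_domI:
  "H1_deriv y1 g1 \<Longrightarrow> H1_deriv y2 g2 \<Longrightarrow> satisfies_bc bc y1 y2 \<Longrightarrow> (abs_l2 y1, abs_l2 y2) \<in> dirac_dom bc"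
  unfolding dirac_dom_def H1_fun_iff by blast

lemma H1_deriv_fun_L2: "H1_deriv y g \<Longrightarrow> y \<in> L2_fun"
  using H1_fun_L2 H1_deriv_H1 by blast

lemma dirac_components_L2:
  assumes "P \<in> L2_fun" "H1_deriv y1 g1" "H1_deriv y2 g2"
  shows "(\<lambda>x. c * g1 x + P x * y2 x) \<in> L2_fun"
  by (intro L2_fun_add L2_fun_scale H1_deriv_L2[OF assms(2)] L2_fun_mult_continuous[OF assms(1)]
      H1_deriv_continuous[OF assms(3)])

lemma dirac_dom_add:
  assumes "x \<in> dirac_dom bc" "y \<in> dirac_dom bc"
  shows "x + y \<in> dirac_dom bc"
    and "P \<in> L2_fun \<Longrightarrow> Q \<in> L2_fun \<Longrightarrow> dirac_op P Q (x + y) = dirac_op P Q x + dirac_op P Q y"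
proof -
  obtain x1 a1 x2 a2 where x: "H1_deriv x1 a1" "H1_deriv x2 a2" "satisfies_bc bc x1 x2" "x = (abs_l2 x1, abs_l2 x2)"
    using assms(1) by (rule H1_pairE)
  obtain y1 g1 y2 g2 where y: "H1_deriv y1 g1" "H1_deriv y2 g2" "satisfies_bc bc y1 y2" "y = (abs_l2 y1, abs_l2 y2)"
    using assms(2) by (rule H1_pairE)
  note s = H1_deriv_add[OF x(1) y(1)] H1_deriv_add[OF x(2) y(2)]
  have xy: "x + y = (abs_l2 (\<lambda>t. x1 t + y1 t), abs_l2 (\<lambda>t. x2 t + y2 t))"
    using x y by (simp add: abs_l2_add H1_deriv_fun_L2)
  have "satisfies_bc bc (\<lambda>t. x1 t + y1 t) (\<lambda>t. x2 t + y2 t)"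
    using x(3) y(3) by (cases bc) simp_all
  then show "x + y \<in> dirac_dom bc" unfolding xy by (rule dirac_domI[OF s])
  assume PQ: "P \<in> L2_fun" "Q \<in> L2_fun"
  have "dirac_op P Q x + dirac_op P Q y =
      (abs_l2 (\<lambda>t. \<i> * (a1 t + g1 t) + P t * (x2 t + y2 t)), abs_l2 (\<lambda>t. - \<i> * (a2 t + g2 t) + Q t * (x1 t + y1 t)))"
    unfolding x(4) y(4) dirac_op_H1_deriv[OF PQ x(1,2)] dirac_op_H1_deriv[OF PQ y(1,2)]
      plus_prod_def fst_conv snd_conv
      abs_l2_add[OF dirac_components_L2[OF PQ(1) x(1,2)] dirac_components_L2[OF PQ(1) y(1,2)]]
      abs_l2_add[OF dirac_components_L2[OF PQ(2) x(2,1)] dirac_components_L2[OF PQ(2) y(2,1)]]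
    by (simp add: algebra_simps)
  then show "dirac_op P Q (x + y) = dirac_op P Q x + dirac_op P Q y"
    unfolding xy dirac_op_H1_deriv[OF PQ s] by (rule sym)
qed

lemma dirac_dom_scaleC:
  assumes "x \<in> dirac_dom bc"
  shows "a *\<^sub>C x \<in> dirac_dom bc"
    and "P \<in> L2_fun \<Longrightarrow> Q \<in> L2_fun \<Longrightarrow> dirac_op P Q (a *\<^sub>C x) = a *\<^sub>C dirac_op P Q x"
proof -
  obtain x1 a1 x2 a2 where x: "H1_deriv x1 a1" "H1_deriv x2 a2" "satisfies_bc bc x1 x2" "x = (abs_l2 x1, abs_l2 x2)"
    using assms(1) by (rule H1_pairE)
  note s = H1_deriv_cmult[OF x(1), of a] H1_deriv_cmult[OF x(2), of a]
  have ax: "a *\<^sub>C x = (abs_l2 (\<lambda>t. a * x1 t), abs_l2 (\<lambda>t. a * x2 t))"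
    using x by (simp add: abs_l2_scaleC scaleC_prod_def H1_deriv_fun_L2)
  have "satisfies_bc bc (\<lambda>t. a * x1 t) (\<lambda>t. a * x2 t)" using x(3) by (cases bc) simp_all
  then show "a *\<^sub>C x \<in> dirac_dom bc" unfolding ax by (rule dirac_domI[OF s])
  assume PQ: "P \<in> L2_fun" "Q \<in> L2_fun"
  have "a *\<^sub>C dirac_op P Q x =
      (abs_l2 (\<lambda>t. \<i> * (a * a1 t) + P t * (a * x2 t)), abs_l2 (\<lambda>t. - \<i> * (a * a2 t) + Q t * (a * x1 t)))"
    unfolding x(4) dirac_op_H1_deriv[OF PQ x(1,2)]
      scaleC_prod_def fst_conv snd_conv
      abs_l2_scaleC[OF dirac_components_L2[OF PQ(1) x(1,2)]] abs_l2_scaleC[OF dirac_components_L2[OF PQ(2) x(2,1)]]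
    by (simp add: algebra_simps)
  then show "dirac_op P Q (a *\<^sub>C x) = a *\<^sub>C dirac_op P Q x"
    unfolding ax dirac_op_H1_deriv[OF PQ s] by (rule sym)
qed

abbreviation free_op :: "l2 \<times> l2 \<Rightarrow> l2 \<times> l2" where
  "free_op \<equiv> dirac_op (\<lambda>x. 0) (\<lambda>x. 0)"

lemma free_op_H1_deriv:
  assumes "H1_deriv y1 g1" "H1_deriv y2 g2"
  shows "free_op (abs_l2 y1, abs_l2 y2) = (abs_l2 (\<lambda>x. \<i> * g1 x), abs_l2 (\<lambda>x. - \<i> * g2 x))"
  using dirac_op_H1_deriv[OF L2_fun_zero L2_fun_zero assms] by simp

text \<open>The point at which the boundary conditions act: the boundary terms of integration by
  parts in the two components cancel, so that the exponentials behave as eigenvectors in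
  \<open>free_op_coef\<close>.\<close>

lemma boundary_term:
  assumes bc: "satisfies_bc bc y1 y2" and n: "n \<in> free_spectrum bc" and b: "b \<in> branches bc"
  shows "of_real (amp1 bc b) * (y1 pi * ez n pi - y1 0) = of_real (amp2 bc b) * (y2 pi * ez (- n) pi - y2 0)"
  using assms by (cases bc; cases b) (simp_all add: amp1_def amp2_def branches_def ez_pi)

lemma free_op_coef:
  assumes "u \<in> dirac_dom bc" "n \<in> free_spectrum bc" "b \<in> branches bc"
  shows "cin (free_op u) (free_basis bc (n, b)) = of_int n * cin u (free_basis bc (n, b))"
proof -
  obtain y1 g1 y2 g2 where y: "H1_deriv y1 g1" "H1_deriv y2 g2" "satisfies_bc bc y1 y2" "u = (abs_l2 y1, abs_l2 y2)"
    using assms(1) by (rule H1_pairE)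
  let ?a = "complex_of_real (amp1 bc b)" and ?b = "complex_of_real (amp2 bc b)"
  let ?I1 = "It (\<lambda>x. y1 x * ez n x)" and ?I2 = "It (\<lambda>x. y2 x * ez (- n) x)"
  have p1: "It (\<lambda>x. \<i> * g1 x * ez n x) = \<i> * (y1 pi * ez n pi - y1 0) + of_int n * ?I1"
  proof -
    have "It (\<lambda>x. \<i> * g1 x * ez n x) = \<i> * It (\<lambda>x. g1 x * ez n x)" by (simp add: mult.assoc)
    then show ?thesis unfolding parts_ez[OF y(1)] by (simp add: algebra_simps)
  qed
  have p2: "It (\<lambda>x. - \<i> * g2 x * ez (- n) x) = - \<i> * (y2 pi * ez (- n) pi - y2 0) + of_int n * ?I2"
  proof -
    have "It (\<lambda>x. - \<i> * g2 x * ez (- n) x) = - \<i> * It (\<lambda>x. g2 x * ez (- n) x)" by (simp add: mult.assoc)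
    then show ?thesis unfolding parts_ez[OF y(2)] by (simp add: algebra_simps)
  qed
  have "cin (free_op u) (free_basis bc (n, b)) =
      (?a * It (\<lambda>x. \<i> * g1 x * ez n x) + ?b * It (\<lambda>x. - \<i> * g2 x * ez (- n) x)) / of_real pi"
    unfolding y(4) free_op_H1_deriv[OF y(1,2)]
    by (rule cin_free_basis) (intro L2_fun_scale H1_deriv_L2[OF y(1)] H1_deriv_L2[OF y(2)])+
  also have "?a * It (\<lambda>x. \<i> * g1 x * ez n x) + ?b * It (\<lambda>x. - \<i> * g2 x * ez (- n) x)
      = \<i> * (?a * (y1 pi * ez n pi - y1 0) - ?b * (y2 pi * ez (- n) pi - y2 0)) + of_int n * (?a * ?I1 + ?b * ?I2)"
    unfolding p1 p2 by (simp add: algebra_simps)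
  also have "\<dots> = of_int n * (?a * ?I1 + ?b * ?I2)"
    unfolding boundary_term[OF y(3) assms(2,3)] by simp
  also have "\<dots> / of_real pi = of_int n * cin u (free_basis bc (n, b))"
    unfolding y(4) by (subst cin_free_basis) (use y in \<open>simp_all add: H1_deriv_fun_L2\<close>)
  finally show ?thesis .
qed

text \<open>The adjoint potential matrix, with \<open>cnj (Q x)\<close> above and
  \<open>cnj (P x)\<close> below the diagonal, applied to the basis vector with index
  \<open>j\<close>. The result is square integrable because basis vectors are bounded
  functions.\<close>

definition pert_vector :: "(real \<Rightarrow> complex) \<Rightarrow> (real \<Rightarrow> complex) \<Rightarrow> boundary_condition \<Rightarrow> int \<times> bool \<Rightarrow> l2 \<times> l2" where
  "pert_vector P Q bc j =
     (abs_l2 (\<lambda>x. cnj (Q x) * (of_real (amp2 bc (snd j)) * ez (fst j) x)),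
      abs_l2 (\<lambda>x. cnj (P x) * (of_real (amp1 bc (snd j)) * ez (- fst j) x)))"

lemma L2_fun_cnj:
  assumes "f \<in> L2_fun"
  shows "(\<lambda>x. cnj (f x)) \<in> L2_fun"
proof -
  have [measurable]: "f \<in> borel_measurable leb_pi" using assms by (simp add: L2_fun_def)
  have "cnj \<in> borel_measurable borel" by (intro borel_measurable_continuous_onI continuous_intros)
  then have "(\<lambda>x. cnj (f x)) \<in> borel_measurable leb_pi" by measurable
  then show ?thesis using assms by (simp add: L2_fun_def)
qed

lemma pert_vector_L2:
  assumes "f \<in> L2_fun"
  shows "(\<lambda>x. cnj (f x) * (of_real a * ez n x)) \<in> L2_fun"
  by (intro L2_fun_mult_continuous[OF L2_fun_cnj[OF assms]] continuous_intros continuous_ez)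

lemma cin_pert_vector:
  assumes "P \<in> L2_fun" "Q \<in> L2_fun" "y1 \<in> L2_fun" "y2 \<in> L2_fun"
  shows "cin (abs_l2 y1, abs_l2 y2) (pert_vector P Q bc (n, b)) =
     (of_real (amp2 bc b) * It (\<lambda>x. Q x * y1 x * ez (- n) x) + of_real (amp1 bc b) * It (\<lambda>x. P x * y2 x * ez n x)) / of_real pi"
proof -
  have 1: "It (\<lambda>x. y1 x * cnj (cnj (Q x) * (of_real a * ez m x))) = of_real a * It (\<lambda>x. Q x * y1 x * ez (- m) x)"
    for a m Q y1
    unfolding It_cmult[symmetric] by (rule It_cong) (simp add: cnj_ez mult_ac)
  show ?thesis
    unfolding pert_vector_def cin_Pair fst_conv snd_conv
    by (simp only: cin_abs_l2 pert_vector_L2 assms 1) (simp add: add_divide_distrib)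
qed

lemma perturbation_coef:
  assumes PQ: "P \<in> L2_fun" "Q \<in> L2_fun" and u: "u \<in> dirac_dom bc"
  shows "cin (dirac_op P Q u - free_op u) (free_basis bc (n, b)) = cin u (pert_vector P Q bc (n, b))"
proof -
  obtain y1 g1 y2 g2 where y: "H1_deriv y1 g1" "H1_deriv y2 g2" "u = (abs_l2 y1, abs_l2 y2)"
    using u by (rule H1_pairE)
  have L: "(\<lambda>x. P x * y2 x) \<in> L2_fun" "(\<lambda>x. Q x * y1 x) \<in> L2_fun"
    by (intro L2_fun_mult_continuous PQ H1_deriv_continuous[OF y(1)] H1_deriv_continuous[OF y(2)])+
  have "dirac_op P Q u - free_op u = (abs_l2 (\<lambda>x. P x * y2 x), abs_l2 (\<lambda>x. Q x * y1 x))"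
    unfolding y(3) dirac_op_H1_deriv[OF PQ y(1,2)] free_op_H1_deriv[OF y(1,2)] minus_prod_def fst_conv snd_conv
      abs_l2_diff[OF dirac_components_L2[OF PQ(1) y(1,2)] L2_fun_scale[OF H1_deriv_L2[OF y(1)]]]
      abs_l2_diff[OF dirac_components_L2[OF PQ(2) y(2,1)] L2_fun_scale[OF H1_deriv_L2[OF y(2)]]]
    by simp
  then show ?thesis
    unfolding y(3) using y by (simp add: cin_free_basis L cin_pert_vector PQ H1_deriv_fun_L2 add.commute)
qed

text \<open>One weight for both off-diagonal entries. When basis vectors of frequencies
  \<open>j\<close> and \<open>k\<close> are paired, \<open>P\<close> meets \<open>ez (j + k)\<close>
  and \<open>Q\<close> meets \<open>ez (- (j + k))\<close>, whence the opposite signs.\<close>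

definition potential_weight :: "(real \<Rightarrow> complex) \<Rightarrow> (real \<Rightarrow> complex) \<Rightarrow> int \<Rightarrow> real" where
  "potential_weight P Q m = (cmod (It (\<lambda>x. P x * ez m x)) + cmod (It (\<lambda>x. Q x * ez (- m) x))) / pi"

lemma pert_vector_bound:
  assumes "P \<in> L2_fun" "Q \<in> L2_fun"
  shows "cmod (cin (free_basis bc k) (pert_vector P Q bc j)) \<le> potential_weight P Q (fst j + fst k)"
proof -
  obtain m c n b where jk: "k = (m, c)" "j = (n, b)" by (cases j, cases k)
  have e: "It (\<lambda>x. f x * (of_real a * ez i x) * ez l x) = of_real a * It (\<lambda>x. f x * ez (i + l) x)" for f a i l
    unfolding It_cmult[symmetric] by (rule It_cong) (simp add: mult_ac flip: ez_mult)
  have le: "cmod (of_real a * (of_real a' * I)) \<le> cmod I" if "\<bar>a\<bar> \<le> 1" "\<bar>a'\<bar> \<le> 1" for a a' I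
  proof -
    have "\<bar>a\<bar> * \<bar>a'\<bar> \<le> 1" using that by (simp add: mult_le_one)
    then have "\<bar>a\<bar> * \<bar>a'\<bar> * cmod I \<le> 1 * cmod I" by (rule mult_right_mono) simp
    then show ?thesis by (simp add: norm_mult mult.assoc)
  qed
  have "cin (free_basis bc k) (pert_vector P Q bc j) =
     (of_real (amp2 bc b) * (of_real (amp1 bc c) * It (\<lambda>x. Q x * ez (- m + - n) x)) +
      of_real (amp1 bc b) * (of_real (amp2 bc c) * It (\<lambda>x. P x * ez (m + n) x))) / of_real pi"
    unfolding jk free_basis_def fst_conv snd_conv
    by (subst cin_pert_vector[OF assms L2_fun_scale[OF ez_L2] L2_fun_scale[OF ez_L2]]) (simp only: e)
  then have "cmod (cin (free_basis bc k) (pert_vector P Q bc j)) \<le>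
     (cmod (It (\<lambda>x. Q x * ez (- m + - n) x)) + cmod (It (\<lambda>x. P x * ez (m + n) x))) / pi"
    by (simp only: norm_divide norm_of_real)
      (auto intro!: divide_right_mono order_trans[OF norm_triangle_ineq] add_mono le amp_le_1)
  also have "\<dots> = potential_weight P Q (fst j + fst k)"
    by (simp add: potential_weight_def jk algebra_simps)
  finally show ?thesis .
qed

text \<open>On an interval of length \<open>pi\<close> distinct exponentials are orthogonal only if
  their parities agree, so Bessel's inequality is applied to the even ones; the odd coefficients of
  \<open>f\<close> are even coefficients of \<open>f\<close> times \<open>ez 1\<close>.\<close>

lemma fourier_coefficients_sq_summable:
  assumes "f \<in> L2_fun"
  shows "(\<lambda>m. (cmod (It (\<lambda>x. f x * ez m x)))\<^sup>2) summable_on UNIV"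
proof -
  have ev: "(\<lambda>k. (cmod (It (\<lambda>x. f x * ez (2 * k) x)))\<^sup>2) summable_on UNIV" if "f \<in> L2_fun" for f
  proof -
    interpret orthonormal "\<lambda>k. abs_l2 (ez (2 * k))" UNIV by (rule even_exponentials_orthonormal)
    have "(\<lambda>k. (cmod (cin (abs_l2 f) (abs_l2 (ez (2 * k)))))\<^sup>2) summable_on range uminus"
      using coef_sq_summable[of "abs_l2 f"] by (rule summable_on_subset_banach) simp
    then have "(\<lambda>k. (cmod (cin (abs_l2 f) (abs_l2 (ez (2 * - k)))))\<^sup>2) summable_on UNIV"
      by (subst (asm) summable_on_reindex) (simp_all add: o_def)
    then have "(\<lambda>k. pi\<^sup>2 * (cmod (cin (abs_l2 f) (abs_l2 (ez (2 * - k)))))\<^sup>2) summable_on UNIV"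
      by (rule summable_on_cmult_right)
    moreover have "pi\<^sup>2 * (cmod (cin (abs_l2 f) (abs_l2 (ez (2 * - k)))))\<^sup>2 = (cmod (It (\<lambda>x. f x * ez (2 * k) x)))\<^sup>2" for k
      using cin_ez[OF that, of "2 * - k"] by (simp add: norm_mult norm_divide power_mult_distrib power_divide)
    ultimately show ?thesis by simp
  qed
  let ?g = "\<lambda>m. (cmod (It (\<lambda>x. f x * ez m x)))\<^sup>2"
  have "?g summable_on range (\<lambda>k. 2 * k)"
    by (subst summable_on_reindex) (use ev[OF assms] in \<open>auto simp: o_def inj_on_def\<close>)
  moreover have "?g summable_on range (\<lambda>k. 2 * k + 1)"
    by (subst summable_on_reindex)
      (use ev[OF L2_mult_ez[OF assms, of 1]] in \<open>auto simp: o_def inj_on_def mult.assoc ez_mult add.commute\<close>)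
  moreover have "range (\<lambda>k::int. 2 * k) \<inter> range (\<lambda>k. 2 * k + 1) = {}" by (auto, presburger)
  ultimately have "?g summable_on (range (\<lambda>k::int. 2 * k) \<union> range (\<lambda>k. 2 * k + 1))"
    by (rule summable_on_Un_disjoint)
  moreover have "m \<in> range (\<lambda>k::int. 2 * k) \<union> range (\<lambda>k. 2 * k + 1)" for m
    by (cases "even m") (auto elim!: evenE oddE)
  then have "range (\<lambda>k::int. 2 * k) \<union> range (\<lambda>k. 2 * k + 1) = UNIV" by blast
  ultimately show ?thesis by simp
qed

lemma potential_weight_sq_summable:
  assumes "P \<in> L2_fun" "Q \<in> L2_fun"
  shows "(\<lambda>m. (potential_weight P Q m)\<^sup>2) summable_on UNIV"
proof (rule summable_on_comparison_test)
  let ?p = "\<lambda>m. (cmod (It (\<lambda>x. P x * ez m x)))\<^sup>2" and ?q = "\<lambda>m. (cmod (It (\<lambda>x. Q x * ez (- m) x)))\<^sup>2"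
  have "?q summable_on UNIV"
  proof -
    have "(\<lambda>m. (cmod (It (\<lambda>x. Q x * ez m x)))\<^sup>2) summable_on range uminus"
      using fourier_coefficients_sq_summable[OF assms(2)] by (rule summable_on_subset_banach) simp
    then show ?thesis by (subst (asm) summable_on_reindex) (simp_all add: o_def)
  qed
  then show "(\<lambda>m. 2 / pi\<^sup>2 * (?p m + ?q m)) summable_on UNIV"
    by (intro summable_on_cmult_right summable_on_add fourier_coefficients_sq_summable assms)
  fix m
  have "(s + t)\<^sup>2 \<le> 2 * (s\<^sup>2 + t\<^sup>2)" for s t :: real
    using sum_squares_bound[of s t] by (simp add: power2_sum)
  then have "(cmod (It (\<lambda>x. P x * ez m x)) + cmod (It (\<lambda>x. Q x * ez (- m) x)))\<^sup>2 / pi\<^sup>2 \<le> 2 * (?p m + ?q m) / pi\<^sup>2"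
    by (rule divide_right_mono) simp
  then show "(potential_weight P Q m)\<^sup>2 \<le> 2 / pi\<^sup>2 * (?p m + ?q m)"
    by (simp add: potential_weight_def power_divide)
qed simp

section \<open>Solvability of the free equation\<close>

lemma exp_pi_sq_eq_1:
  assumes "(exp (- \<i> * z * of_real pi))\<^sup>2 = 1"
  obtains n where "z = of_int n"
proof -
  have "exp (- 2 * \<i> * z * of_real pi) = 1"
    using assms by (simp add: mult_ac flip: exp_double)
  then obtain n :: int where "Im z = 0" "- 2 * Re z * pi = of_int (2 * n) * pi"
    unfolding exp_eq_1 by auto
  then have "Im z = 0" "(2 * Re z + 2 * of_int n) * pi = 0" by (simp_all add: algebra_simps)
  then have "z = of_int (- n)" by (simp add: complex_eq_iff)
  then show thesis by (rule that)
qed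

text \<open>Variation of constants solves the inhomogeneous equation; the two constants of integration are
  fixed by the boundary conditions.\<close>

lemma free_op_solvable:
  assumes z: "z \<notin> of_int ` free_spectrum bc"
  shows "\<exists>u\<in>dirac_dom bc. z *\<^sub>C u - free_op u = f"
proof -
  obtain f1 f2 where f: "f1 \<in> L2_fun" "f2 \<in> L2_fun" "f = (abs_l2 f1, abs_l2 f2)"
    by (metis l2_cases surj_pair)
  define k where "k = \<i> * z"
  have contE: "continuous_on S (\<lambda>x. exp (c * complex_of_real x))" for S c by (intro continuous_intros)
  define F1 where "F1 = (\<lambda>x. integral {0..x} (\<lambda>s. f1 s * exp (k * of_real s)))"
  define F2 where "F2 = (\<lambda>x. integral {0..x} (\<lambda>s. f2 s * exp (- k * of_real s)))"
  have h1: "H1_deriv F1 (\<lambda>s. f1 s * exp (k * of_real s))" unfolding F1_def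
    by (rule H1_deriv_indefinite[OF L2_fun_mult_continuous[OF f(1) contE]])
  have h2: "H1_deriv F2 (\<lambda>s. f2 s * exp (- k * of_real s))" unfolding F2_def
    by (rule H1_deriv_indefinite[OF L2_fun_mult_continuous[OF f(2) contE]])
  define y1 where "y1 = (\<lambda>c x. exp (- k * of_real x) * (c + \<i> * F1 x))"
  define y2 where "y2 = (\<lambda>c x. exp (k * of_real x) * (c + - \<i> * F2 x))"
  \<comment> \<open>The boundary conditions become linear equations for the constants, with
    coefficient \<open>1 - w\<close> for \<open>Per_plus\<close>, \<open>1 + w\<close> for
    \<open>Per_minus\<close> and \<open>w\<^sup>2 - 1\<close> for \<open>Dir\<close>, up to sign.
    Each vanishes only if \<open>z\<close> lies in the respective free spectrum.\<close>
  define w where "w = exp (- k * of_real pi)"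
  have w0: "w \<noteq> 0" by (simp add: w_def)
  have wi: "exp (k * of_real pi) = 1 / w" by (simp add: w_def exp_minus field_simps)
  have w_int: "\<exists>n. z = of_int n \<and> w = ez (- n) pi" if "w\<^sup>2 = 1"
  proof -
    have "(exp (- \<i> * z * of_real pi))\<^sup>2 = 1" using that by (simp add: w_def k_def)
    then obtain n where "z = of_int n" by (rule exp_pi_sq_eq_1)
    then show ?thesis by (auto simp: w_def k_def ez_def)
  qed
  have vals: "y1 c 0 = c" "y1 c pi = w * (c + \<i> * F1 pi)" "y2 c 0 = c" "y2 c pi = (c - \<i> * F2 pi) / w" for c
  proof -
    have F0: "F1 0 = 0" "F2 0 = 0" by (simp_all add: F1_def F2_def)
    have "exp (- k * of_real pi) * (c + \<i> * F1 pi) = w * (c + \<i> * F1 pi)" by (simp only: w_def)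
    moreover have "exp (k * of_real pi) * (c + - \<i> * F2 pi) = (c - \<i> * F2 pi) / w" unfolding wi by simp
    ultimately show "y1 c 0 = c" "y1 c pi = w * (c + \<i> * F1 pi)" "y2 c 0 = c" "y2 c pi = (c - \<i> * F2 pi) / w"
      unfolding y1_def y2_def F0 by simp_all
  qed
  have "\<exists>c1 c2. satisfies_bc bc (y1 c1) (y2 c2)"
  proof (cases bc)
    case Per_plus
    have "w \<noteq> 1"
    proof
      assume "w = 1"
      then obtain n where "z = of_int n" "ez (- n) pi = 1" using w_int by auto
      then show False using z by (auto simp: Per_plus ez_pi split: if_splits)
    qed
    then have "1 - w \<noteq> 0" "w - 1 \<noteq> 0" by auto
    then have "\<i> * w * F1 pi / (1 - w) = w * (\<i> * w * F1 pi / (1 - w) + \<i> * F1 pi)"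
      "- \<i> * F2 pi / (w - 1) = (- \<i> * F2 pi / (w - 1) - \<i> * F2 pi) / w"
      using w0 by (simp_all add: field_simps)
    then have "satisfies_bc bc (y1 (\<i> * w * F1 pi / (1 - w))) (y2 (- \<i> * F2 pi / (w - 1)))"
      unfolding Per_plus satisfies_bc.simps vals by blast
    then show ?thesis by blast
  next
    case Per_minus
    have "w \<noteq> - 1"
    proof
      assume w: "w = - 1"
      then obtain n where "z = of_int n" "ez (- n) pi = - 1" using w_int by auto
      then show False using z by (auto simp: Per_minus ez_pi split: if_splits)
    qed
    then have "1 + w \<noteq> 0" by (metis add.commute add_eq_0_iff)
    have "- \<i> * w * F1 pi / (1 + w) = - (w * (- \<i> * w * F1 pi / (1 + w) + \<i> * F1 pi))"
      using w0 \<open>1 + w \<noteq> 0\<close> by (simp add: field_simps)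
    moreover have "\<i> * F2 pi / (1 + w) = - ((\<i> * F2 pi / (1 + w) - \<i> * F2 pi) / w)"
    proof -
      have *: "c = - ((c - d) / w)" if "c * (1 + w) = d" for c d
        using w0 by (simp add: eq_divide_eq algebra_simps flip: that minus_divide_left)
      show ?thesis by (rule *) (use \<open>1 + w \<noteq> 0\<close> in simp)
    qed
    ultimately have "satisfies_bc bc (y1 (- \<i> * w * F1 pi / (1 + w))) (y2 (\<i> * F2 pi / (1 + w)))"
      unfolding Per_minus satisfies_bc.simps vals by blast
    then show ?thesis by blast
  next
    case Dir
    have "w\<^sup>2 - 1 \<noteq> 0" using w_int z Dir by auto
    \<comment> \<open>The condition at 0 makes the two constants equal; the condition at
      \<open>pi\<close> then determines their common value.\<close>
    define c where "c = - \<i> * (F2 pi + w\<^sup>2 * F1 pi) / (w\<^sup>2 - 1)"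
    have "c * (w\<^sup>2 - 1) = - \<i> * (F2 pi + w\<^sup>2 * F1 pi)" using \<open>w\<^sup>2 - 1 \<noteq> 0\<close> by (simp add: c_def)
    then have "w * (c + \<i> * F1 pi) = (c - \<i> * F2 pi) / w"
      using w0 by (simp add: eq_divide_eq power2_eq_square algebra_simps)
    then have "satisfies_bc bc (y1 c) (y2 c)" unfolding Dir satisfies_bc.simps vals by simp
    then show ?thesis by blast
  qed
  then obtain c1 c2 where bc: "satisfies_bc bc (y1 c1) (y2 c2)" by blast
  have e: "exp (- k * of_real x) * exp (k * of_real x) = 1" "exp (k * of_real x) * exp (- k * of_real x) = 1" for x
    by (simp_all flip: exp_add)
  have d1: "H1_deriv (y1 c1) (\<lambda>x. \<i> * f1 x - k * y1 c1 x)"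
  proof -
    have "H1_deriv (y1 c1) (\<lambda>x. exp (- k * of_real x) * (0 + \<i> * (f1 x * exp (k * of_real x))) +
        - k * exp (- k * of_real x) * (c1 + \<i> * F1 x))"
      unfolding y1_def by (intro H1_deriv_mult H1_deriv_exp H1_deriv_add H1_deriv_const H1_deriv_cmult h1)
    also have "(\<lambda>x. exp (- k * of_real x) * (0 + \<i> * (f1 x * exp (k * of_real x))) +
        - k * exp (- k * of_real x) * (c1 + \<i> * F1 x)) = (\<lambda>x. \<i> * f1 x - k * y1 c1 x)"
    proof
      fix x
      have "exp (- k * of_real x) * (0 + \<i> * (f1 x * exp (k * of_real x))) = \<i> * f1 x * (exp (- k * of_real x) * exp (k * of_real x))"
        by (simp only: mult_ac add_0_left)
      then show "exp (- k * of_real x) * (0 + \<i> * (f1 x * exp (k * of_real x))) +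
        - k * exp (- k * of_real x) * (c1 + \<i> * F1 x) = \<i> * f1 x - k * y1 c1 x"
        unfolding e by (simp add: y1_def mult.assoc)
    qed
    finally show ?thesis .
  qed
  have d2: "H1_deriv (y2 c2) (\<lambda>x. - \<i> * f2 x + k * y2 c2 x)"
  proof -
    have "H1_deriv (y2 c2) (\<lambda>x. exp (k * of_real x) * (0 + - \<i> * (f2 x * exp (- k * of_real x))) +
        k * exp (k * of_real x) * (c2 + - \<i> * F2 x))"
      unfolding y2_def by (intro H1_deriv_mult H1_deriv_exp H1_deriv_add H1_deriv_const H1_deriv_cmult h2)
    also have "(\<lambda>x. exp (k * of_real x) * (0 + - \<i> * (f2 x * exp (- k * of_real x))) +
        k * exp (k * of_real x) * (c2 + - \<i> * F2 x)) = (\<lambda>x. - \<i> * f2 x + k * y2 c2 x)"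
    proof
      fix x
      have "exp (k * of_real x) * (0 + - \<i> * (f2 x * exp (- k * of_real x))) = - \<i> * f2 x * (exp (k * of_real x) * exp (- k * of_real x))"
        by (simp only: mult_ac add_0_left)
      then show "exp (k * of_real x) * (0 + - \<i> * (f2 x * exp (- k * of_real x))) +
        k * exp (k * of_real x) * (c2 + - \<i> * F2 x) = - \<i> * f2 x + k * y2 c2 x"
        unfolding e by (simp add: y2_def mult.assoc)
    qed
    finally show ?thesis .
  qed
  have ik: "\<i> * (k * y) = - (z * y)" for y by (simp add: k_def flip: mult.assoc)
  have "z *\<^sub>C (abs_l2 (y1 c1), abs_l2 (y2 c2)) - free_op (abs_l2 (y1 c1), abs_l2 (y2 c2)) = f"
    unfolding free_op_H1_deriv[OF d1 d2] scaleC_prod_def minus_prod_def fst_conv snd_conv f(3)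
      abs_l2_scaleC[OF H1_deriv_fun_L2[OF d1]] abs_l2_scaleC[OF H1_deriv_fun_L2[OF d2]]
      abs_l2_diff[OF L2_fun_scale[OF H1_deriv_fun_L2[OF d1]] L2_fun_scale[OF H1_deriv_L2[OF d1]]]
      abs_l2_diff[OF L2_fun_scale[OF H1_deriv_fun_L2[OF d2]] L2_fun_scale[OF H1_deriv_L2[OF d2]]]
    by (simp add: right_diff_distrib distrib_left ik)
  then show ?thesis using dirac_domI[OF d1 d2 bc] by blast
qed

lemma dirac_perturbed_diagonal:
  assumes PQ: "P \<in> L2_fun" "Q \<in> L2_fun"
  shows "perturbed_diagonal (free_basis bc) (free_spectrum bc) (branches bc) (dirac_dom bc) free_op
     (dirac_op P Q) (pert_vector P Q bc) (potential_weight P Q)"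
proof (unfold_locales, goal_cases)
  case (1 i j) then show ?case by (rule free_basis_orth)
next
  case (2 u) then show ?case by (rule free_basis_total)
next
  case (3 x y) then show ?case by (rule dirac_dom_add)
next
  case (4 x a) then show ?case by (rule dirac_dom_scaleC)
next
  case (5 x y) then show ?case using PQ by (rule dirac_dom_add)
next
  case (6 x a) then show ?case using PQ by (rule dirac_dom_scaleC)
next
  case (7 y j) then show ?case by (cases j) (auto simp: free_op_coef)
next
  case (8 y j) then show ?case by (cases j) (auto simp: perturbation_coef PQ)
next
  case (9 j k) show ?case by (rule pert_vector_bound[OF PQ])
next
  case (10 m) show ?case by (simp add: potential_weight_def)
next
  case 11 show ?case by (rule potential_weight_sq_summable[OF PQ])
next
  case (12 z f) then show ?case by (rule free_op_solvable)
next
  case (13 n) then show ?case by (cases bc) auto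
next
  case 14
  have "0 \<in> free_spectrum bc \<or> 1 \<in> free_spectrum bc" by (cases bc) auto
  then show ?case by blast
qed

theorem theorem9:
  fixes P Q :: "real \<Rightarrow> complex" and bc :: boundary_condition
  assumes "P \<in> L2_fun" and "Q \<in> L2_fun"
  defines "D \<equiv> dirac_dom bc" and "L \<equiv> dirac_op P Q"
  shows "\<exists>N::nat.
    path_image (circlepath 0 (real N + 1 / 2)) \<subseteq> resolvent_set D L \<and>
    (\<forall>n\<in>free_spectrum bc. \<bar>n\<bar> > int N \<longrightarrow>
        path_image (circlepath (of_int n) (1 / 4)) \<subseteq> resolvent_set D L) \<and>
    (\<forall>f :: l2 \<times> l2.
        (\<lambda>n. riesz_projection D L (circlepath (of_int n) (1 / 4)) f)
          summable_on {n \<in> free_spectrum bc. \<bar>n\<bar> > int N} \<and>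
        f = riesz_projection D L (circlepath 0 (real N + 1 / 2)) f +
            (\<Sum>\<^sub>\<infinity>n\<in>{n \<in> free_spectrum bc. \<bar>n\<bar> > int N}.
               riesz_projection D L (circlepath (of_int n) (1 / 4)) f))"
  unfolding D_def L_def
  by (rule perturbed_diagonal.spectral_decomposition_exists[OF dirac_perturbed_diagonal[OF assms(1,2)]])

end
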